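(* Let $C\subseteq V$ be a proper polyhedral cone in a three-dimensional real vector space $V$ with at least five extreme rays, let $u$ be an interior point of $C$, and let $B=\{\varphi\in C^\vee\mid \varphi(u)=1\}$ be the corresponding compact base of the dual cone (equivalently, $B$ is a convex polygon with at least five vertices). Then, for every integer $m\geqslant 1$, the level $B^{\rm ph}(2m)$ of the free polyhedron over $B$ contains an irreducible Arveson boundary point. Consequently, there is no $d\geqslant1$ with $B^{\rm ph}=\operatorname{mconv}(B^{\rm ph}(d))$ (that is, $B^{\rm ph}$ is not generated by any fixed finite level), and the minimal operator system $C^{\min}$ is not subhomogeneous.
   Context: A proper polyhedral cone $C\subseteq V$ in a finite-dimensional real vector space is a finitely generated convex cone that is pointed ($C\cap(-C)=\{0\}$) and has nonempty interior. $C^\vee=\{\varphi\in V^*\mid \varphi(c)\geqslant0\ \forall c\in C\}$. $\operatorname{Her}_s$ is the real vector space of complex Hermitian $s\times s$ matrices; $\operatorname{Her}_s(V)=\operatorname{Her}_s\otimes_{\mathbb R}V$. Minimal operator system: $C^{\min}=(V,(C^{\min}_s)_{s\geqslant1},u)$, where $u$ is the fixed interior point of $C$ and $C_s^{\min}=\operatorname{cone}\{A\otimes c\mid A\in\operatorname{Her}_s,\ A\geqslant0,\ c\in C\}\subseteq\operatorname{Her}_s(V)$, with matrix order unit $I_s\otimes u$ at level $s$. It is called $d$-subhomogeneous if it admits a unital complete order embedding into $\operatorname{Mat}_d(\mathcal A)$ for some commutative $C^*$-algebra $\mathcal A$, i.e. a real-linear map $\Phi$ from $V$ to the Hermitian elements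 of $\operatorname{Mat}_d(\mathcal A)$ with $\Phi(u)=1$ such that for all $s\geqslant1$ and $X\in\operatorname{Her}_s(V)$: $X\in C_s^{\min}$ if and only if $(\mathrm{id}\otimes\Phi)(X)\geqslant0$ in $\operatorname{Mat}_s(\operatorname{Mat}_d(\mathcal A))$. It is subhomogeneous if it is $d$-subhomogeneous for some $d\geqslant 1$. Free polyhedron: for $X=\sum_k A_k\otimes\varphi_k$ (with $A_k$ matrices and $\varphi_k\in V^*$) and $c\in V$ put $X(c)=\sum_k\varphi_k(c)A_k$. The (maximal) free polyhedron over $B$ is $B^{\rm ph}=(B^{\rm ph}(s))_{s\geqslant1}$ with $B^{\rm ph}(s)=\{X\in\operatorname{Her}_s\otimes_{\mathbb R}V^*\mid X(c)\geqslant0\ \forall c\in C,\ X(u)=I_s\}$. $\operatorname{mconv}(B^{\rm ph}(d))$ is the graded set whose level $s$ consists of all finite sums $\sum_j V_j^*Y_jV_j$ with $Y_j\in B^{\rm ph}(d)$, $V_j\in\operatorname{Mat}_{d,s}(\mathbb C)$, $\sum_jV_j^*V_j=I_s$. A point $X\in B^{\rm ph}(s)$ is an Arveson boundary point if, whenever $r\geqslant1$ and $\widetilde X=\begin{pmatrix}X&\beta\\ \beta^*&\gamma\end{pmatrix}\in B^{\rm ph}(s+r)$, one has $\beta=0$. It is irreducible if the commutant in $\operatorname{Mat}_s(\mathbb C)$ of $\{X(c)\mid c\in V\}$ consists only of scalar matrices. *)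

theory Defs
  imports "HOL-Analysis.Analysis" "Jordan_Normal_Form.Schur_Decomposition"
begin

hide_const (open) Finite_Cartesian_Product.mat Finite_Cartesian_Product.vec
hide_type (open) Finite_Cartesian_Product.vec
no_notation inner (infix "\<bullet>" 70)

section \<open>Cones\<close>

definition proper_polyhedral_cone :: "'a::euclidean_space set \<Rightarrow> bool" where
  "proper_polyhedral_cone C \<longleftrightarrow>
     (\<exists>S. finite S \<and> C = convex_cone hull S) \<and> C \<inter> uminus ` C = {0} \<and> interior C \<noteq> {}"

definition extreme_rays :: "'a::real_vector set \<Rightarrow> 'a set set" where
  "extreme_rays C = {R. R face_of C \<and> (\<exists>r. r \<noteq> 0 \<and> R = {t *\<^sub>R r | t. 0 \<le> t})}"

text \<open>The dual space of the finite-dimensional space \<open>'a\<close> is the type of bounded linear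
  functionals on \<open>'a\<close>; there every linear functional is bounded.\<close>

type_synonym 'a dual = "'a \<Rightarrow>\<^sub>L real"

definition dual_cone :: "'a::euclidean_space set \<Rightarrow> 'a dual set" where
  "dual_cone C = {\<phi>. \<forall>c\<in>C. 0 \<le> blinfun_apply \<phi> c}"

definition dual_base :: "'a::euclidean_space set \<Rightarrow> 'a \<Rightarrow> 'a dual set" where
  "dual_base C u = {\<phi> \<in> dual_cone C. blinfun_apply \<phi> u = 1}"


section \<open>Hermitian matrices and Hermitian tensors\<close>

definition Her :: "nat \<Rightarrow> complex mat set" where
  "Her s = {A \<in> carrier_mat s s. mat_adjoint A = A}"

definition psd :: "nat \<Rightarrow> complex mat \<Rightarrow> bool" where
  "psd s A \<longleftrightarrow> A \<in> Her s \<and> (\<forall>v \<in> carrier_vec s. 0 \<le> (A *\<^sub>v v) \<bullet>c v)"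

text \<open>For a real vector space \<open>W\<close>, the complex space \<open>Mat\<^sub>s(\<complex>) \<otimes>\<^sub>\<real> W\<close> is the space of
  \<open>s \<times> s\<close> matrices over the complexification of \<open>W\<close>. A pair \<open>(x, y)\<close> stands for \<open>x + \<i> y\<close>.\<close>

type_synonym 'w cplx = "'w \<times> 'w"

definition cmult :: "complex \<Rightarrow> 'w::real_vector cplx \<Rightarrow> 'w cplx" where
  "cmult z p = (Re z *\<^sub>R fst p - Im z *\<^sub>R snd p, Re z *\<^sub>R snd p + Im z *\<^sub>R fst p)"

definition cconj :: "'w::real_vector cplx \<Rightarrow> 'w cplx" where
  "cconj p = (fst p, - snd p)"

definition elem_tensor :: "complex mat \<Rightarrow> 'w::real_vector \<Rightarrow> 'w cplx mat" (infix "\<otimes>\<^sub>t" 70) where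
  "A \<otimes>\<^sub>t w = map_mat (\<lambda>z. cmult z (w, 0)) A"

definition mat_sum :: "nat \<Rightarrow> nat \<Rightarrow> (nat \<Rightarrow> 'b::comm_monoid_add mat) \<Rightarrow> 'b mat" where
  "mat_sum s n F = mat s s (\<lambda>(i, j). \<Sum>k<n. F k $$ (i, j))"

definition Her_tensor :: "nat \<Rightarrow> 'w::real_vector cplx mat set" where
  "Her_tensor s = {mat_sum s n (\<lambda>k. A k \<otimes>\<^sub>t w k) | n A w. \<forall>k<n. A k \<in> Her s}"

definition eval_at :: "'a::real_normed_vector dual cplx mat \<Rightarrow> 'a \<Rightarrow> complex mat" where
  "eval_at X c = map_mat (\<lambda>p. Complex (blinfun_apply (fst p) c) (blinfun_apply (snd p) c)) X"

text \<open>The matrix \<open>V\<^sup>* Y V\<close>, for a complex matrix \<open>V\<close> and a matrix \<open>Y\<close> over a complexification.\<close>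

definition compress :: "complex mat \<Rightarrow> 'w::real_vector cplx mat \<Rightarrow> 'w cplx mat" where
  "compress V Y = mat (dim_col V) (dim_col V) (\<lambda>(p, q).
     \<Sum>a<dim_row V. \<Sum>b<dim_row V. cmult (cnj (V $$ (a, p)) * V $$ (b, q)) (Y $$ (a, b)))"


section \<open>The free polyhedron\<close>

text \<open>The free polyhedron over \<open>B = dual_base C u\<close>.\<close>

definition free_polyhedron :: "'a::euclidean_space set \<Rightarrow> 'a \<Rightarrow> nat \<Rightarrow> 'a dual cplx mat set" where
  "free_polyhedron C u s =
     {X \<in> Her_tensor s. (\<forall>c\<in>C. psd s (eval_at X c)) \<and> eval_at X u = 1\<^sub>m s}"

lemma eval_at_compress:
  assumes "V \<in> carrier_mat d s" "Y \<in> carrier_mat d d"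
  shows "eval_at (compress V Y) c = mat_adjoint V * eval_at Y c * V"
proof (rule eq_matI)
  have adj: "mat_adjoint V \<in> carrier_mat s d"
    using assms(1) unfolding mat_adjoint_def by auto
  have entry: "mat_adjoint V $$ (p, a) = cnj (V $$ (a, p))" if "p < s" "a < d" for p a
    using assms(1) that by (auto simp: mat_adjoint_def mat_of_rows_def)
  have ev: "Complex (blinfun_apply (fst (\<Sum>x\<in>S. f x)) c) (blinfun_apply (snd (\<Sum>x\<in>S. f x)) c)
      = (\<Sum>x\<in>S. Complex (blinfun_apply (fst (f x)) c) (blinfun_apply (snd (f x)) c))"
    for S :: "nat set" and f :: "nat \<Rightarrow> 'a dual cplx"
    by (induction S rule: infinite_finite_induct)
      (auto simp: blinfun.add_left zero_complex.ctr complex_eq_iff)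
  have evc: "Complex (blinfun_apply (fst (cmult z y)) c) (blinfun_apply (snd (cmult z y)) c)
      = z * Complex (blinfun_apply (fst y) c) (blinfun_apply (snd y) c)" for z and y :: "'a dual cplx"
    by (simp add: cmult_def complex_eq_iff blinfun.add_left blinfun.diff_left blinfun.scaleR_left)
  fix p q
  assume "p < dim_row (mat_adjoint V * eval_at Y c * V)"
    and "q < dim_col (mat_adjoint V * eval_at Y c * V)"
  then have pq: "p < s" "q < s" using assms adj by auto
  have "eval_at (compress V Y) c $$ (p, q) =
      (\<Sum>a<d. \<Sum>b<d. cnj (V $$ (a, p)) * V $$ (b, q) * eval_at Y c $$ (a, b))"
    using assms pq by (simp add: eval_at_def compress_def ev evc)
  also have "\<dots> = (mat_adjoint V * eval_at Y c * V) $$ (p, q)"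
    using assms pq adj
    by (simp add: scalar_prod_def eval_at_def entry lessThan_atLeast0 sum_distrib_left mult_ac)
  finally show "eval_at (compress V Y) c $$ (p, q) = (mat_adjoint V * eval_at Y c * V) $$ (p, q)" .
qed (use assms in \<open>auto simp: eval_at_def compress_def mat_adjoint_def\<close>)

text \<open>Level one of the free polyhedron is the base of the dual cone.\<close>

lemma free_polyhedron_1:
  "free_polyhedron C u 1 = (\<lambda>\<phi>. mat 1 1 (\<lambda>_. (\<phi>, 0))) ` dual_base C u"
proof -
  have her: "mat 1 1 (\<lambda>_. z) \<in> Her 1 \<longleftrightarrow> Im z = 0" for z
    by (auto simp: Her_def mat_adjoint_def mat_of_rows_def mat_eq_iff complex_eq_iff)
  have psd: "psd 1 (mat 1 1 (\<lambda>_. Complex t 0)) \<longleftrightarrow> 0 \<le> t" for t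
  proof
    assume "psd 1 (mat 1 1 (\<lambda>_. Complex t 0))"
    then have "0 \<le> (mat 1 1 (\<lambda>_. Complex t 0) *\<^sub>v vec 1 (\<lambda>_. 1)) \<bullet>c vec 1 (\<lambda>_. 1)"
      unfolding psd_def by auto
    then show "0 \<le> t" by (simp add: scalar_prod_def less_eq_complex_def)
  next
    assume t: "0 \<le> t"
    have "0 \<le> (mat 1 1 (\<lambda>_. Complex t 0) *\<^sub>v v) \<bullet>c v" if "v \<in> carrier_vec 1" for v
    proof -
      have "(mat 1 1 (\<lambda>_. Complex t 0) *\<^sub>v v) \<bullet>c v = Complex t 0 * (v $ 0 * cnj (v $ 0))"
        using that by (simp add: scalar_prod_def)
      also have "\<dots> = complex_of_real (t * (cmod (v $ 0))\<^sup>2)"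
        by (simp add: complex_norm_square complex_of_real_def[symmetric] del: of_real_power)
      finally show ?thesis using t by (simp add: less_eq_complex_def)
    qed
    with her[of "Complex t 0"] show "psd 1 (mat 1 1 (\<lambda>_. Complex t 0))" by (simp add: psd_def)
  qed
  have ev: "eval_at (mat 1 1 (\<lambda>_. (\<phi>, 0))) c = mat 1 1 (\<lambda>_. Complex (blinfun_apply \<phi> c) 0)"
    for \<phi> :: "'a dual" and c
    by (auto simp: eval_at_def)
  have one: "mat 1 1 (\<lambda>_. Complex t 0) = 1\<^sub>m 1 \<longleftrightarrow> t = 1" for t
    by (auto simp: mat_eq_iff complex_eq_iff)
  have tensor: "(X :: 'a dual cplx mat) \<in> Her_tensor 1 \<longleftrightarrow> (\<exists>\<phi>. X = mat 1 1 (\<lambda>_. (\<phi>, 0)))" for X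
  proof
    assume "X \<in> Her_tensor 1"
    then obtain n A w where A: "\<forall>k<n. A k \<in> Her 1"
      and X: "X = mat_sum 1 n (\<lambda>k. A k \<otimes>\<^sub>t w k)"
      unfolding Her_tensor_def by auto
    have "Im (A k $$ (0, 0)) = 0 \<and> A k \<in> carrier_mat 1 1" if "k < n" for k
    proof -
      have c: "A k \<in> carrier_mat 1 1" using A that by (auto simp: Her_def)
      then have "A k = mat 1 1 (\<lambda>_. A k $$ (0, 0))" by (auto simp: mat_eq_iff)
      then show ?thesis using A that her[of "A k $$ (0, 0)"] c by auto
    qed
    then have im: "Im (A k $$ (0, 0)) = 0" "dim_row (A k) = 1" "dim_col (A k) = 1" if "k < n" for k
      using that by blast+
    have e: "(A k \<otimes>\<^sub>t w k) $$ (0, 0) = (Re (A k $$ (0, 0)) *\<^sub>R w k, 0)" if "k < n" for k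
      using im[OF that] by (simp add: elem_tensor_def cmult_def)
    have "(\<Sum>k<n. (A k \<otimes>\<^sub>t w k) $$ (0, 0)) = (\<Sum>k<n. (Re (A k $$ (0, 0)) *\<^sub>R w k, 0))"
      using e by (intro sum.cong) auto
    also have "\<dots> = (\<Sum>k<n. Re (A k $$ (0, 0)) *\<^sub>R w k, 0)"
      by (simp add: sum_prod)
    finally show "\<exists>\<phi>. X = mat 1 1 (\<lambda>_. (\<phi>, 0))"
      unfolding X mat_sum_def by (intro exI eq_matI) auto
  next
    assume "\<exists>\<phi>. X = mat 1 1 (\<lambda>_. (\<phi>, 0))"
    then obtain \<phi> where X: "X = mat 1 1 (\<lambda>_. (\<phi>, 0))" by auto
    have "X = mat_sum 1 1 (\<lambda>k. mat 1 1 (\<lambda>_. 1) \<otimes>\<^sub>t \<phi>)"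
      unfolding X mat_sum_def by (intro eq_matI) (auto simp: elem_tensor_def cmult_def)
    moreover have "mat 1 1 (\<lambda>_. 1) \<in> Her 1" using her[of 1] by simp
    ultimately show "X \<in> Her_tensor 1" unfolding Her_tensor_def
      by (intro CollectI exI[of _ 1] exI[of _ "\<lambda>_. mat 1 1 (\<lambda>_. 1)"] exI[of _ "\<lambda>_. \<phi>"]) auto
  qed
  show ?thesis
    unfolding free_polyhedron_def dual_base_def dual_cone_def
    by (auto simp: tensor ev psd one simp del: One_nat_def)
qed

text \<open>Level \<open>s\<close> of the matrix convex hull of a set \<open>K\<close> of tensors of size \<open>d\<close>.\<close>

definition mconv :: "nat \<Rightarrow> 'w::real_vector cplx mat set \<Rightarrow> nat \<Rightarrow> 'w cplx mat set" where
  "mconv d K s = {mat_sum s n (\<lambda>j. compress (V j) (Y j)) | n V Y.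
     (\<forall>j<n. Y j \<in> K \<and> V j \<in> carrier_mat d s) \<and>
     mat_sum s n (\<lambda>j. mat_adjoint (V j) * V j) = 1\<^sub>m s}"

definition arveson_boundary_point ::
  "'a::euclidean_space set \<Rightarrow> 'a \<Rightarrow> nat \<Rightarrow> 'a dual cplx mat \<Rightarrow> bool" where
  "arveson_boundary_point C u s X \<longleftrightarrow> X \<in> free_polyhedron C u s \<and>
     (\<forall>r\<ge>1. \<forall>\<beta> \<in> carrier_mat s r. \<forall>\<gamma> \<in> carrier_mat r r.
        four_block_mat X \<beta> (map_mat cconj (transpose_mat \<beta>)) \<gamma> \<in> free_polyhedron C u (s + r)
        \<longrightarrow> \<beta> = 0\<^sub>m s r)"

definition irreducible_point :: "nat \<Rightarrow> 'a::euclidean_space dual cplx mat \<Rightarrow> bool" where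
  "irreducible_point s X \<longleftrightarrow>
     (\<forall>T \<in> carrier_mat s s. (\<forall>c. T * eval_at X c = eval_at X c * T) \<longrightarrow> (\<exists>z. T = z \<cdot>\<^sub>m 1\<^sub>m s))"


section \<open>Commutative C*-algebras\<close>

text \<open>Unital commutative C*-algebras; the involution is \<open>conjugate\<close>. The inherited axiom
  \<open>norm 1 = 1\<close> holds in every nonzero unital C*-algebra.\<close>

class comm_cstar_algebra = comm_ring_1 + real_normed_algebra_1 + banach + conjugatable_ring +
  fixes scaleC :: "complex \<Rightarrow> 'a \<Rightarrow> 'a"
  assumes scaleC_add_right: "scaleC z (a + b) = scaleC z a + scaleC z b"
    and scaleC_add_left: "scaleC (z + w) a = scaleC z a + scaleC w a"
    and scaleC_scaleC: "scaleC z (scaleC w a) = scaleC (z * w) a"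
    and scaleC_of_real: "scaleC (complex_of_real r) a = r *\<^sub>R a"
    and mult_scaleC_left: "scaleC z a * b = scaleC z (a * b)"
    and norm_scaleC: "norm (scaleC z a) = cmod z * norm a"
    and conjugate_scaleC: "conjugate (scaleC z a) = scaleC (cnj z) (conjugate a)"
    and cstar_identity: "norm (conjugate a * a) = (norm a)\<^sup>2"

instantiation complex :: comm_cstar_algebra
begin

definition scaleC_complex :: "complex \<Rightarrow> complex \<Rightarrow> complex" where
  "scaleC_complex z a = z * a"

instance
  by standard
    (auto simp: scaleC_complex_def algebra_simps norm_mult power2_eq_square scaleR_conv_of_real)

end

text \<open>Positivity in the C*-algebra \<open>Mat\<^sub>n(\<A>)\<close>: the positive elements are those of the form
  \<open>Y\<^sup>* Y\<close>.\<close>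

definition cstar_mat_pos :: "nat \<Rightarrow> 'b::comm_cstar_algebra mat \<Rightarrow> bool" where
  "cstar_mat_pos n M \<longleftrightarrow>
     (\<exists>Y \<in> carrier_mat n n. M = map_mat conjugate (transpose_mat Y) * Y)"


section \<open>The minimal operator system\<close>

text \<open>Nonnegative coefficients are absorbed into the positive semidefinite factors.\<close>

definition Cmin :: "'a::euclidean_space set \<Rightarrow> nat \<Rightarrow> 'a cplx mat set" where
  "Cmin C s = {mat_sum s n (\<lambda>k. A k \<otimes>\<^sub>t c k) | n A c. \<forall>k<n. psd s (A k) \<and> c k \<in> C}"

text \<open>The element \<open>(id \<otimes> \<Phi>)(X)\<close> of \<open>Mat\<^sub>s(Mat\<^sub>d(\<A>))\<close>, written as an element of
  \<open>Mat\<^sub>s\<^sub>d(\<A>)\<close>: the block in position \<open>(i, j)\<close> is the value at the entry \<open>X\<^sub>i\<^sub>j = x + \<i> y\<close> of the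
  complex-linear extension of \<open>\<Phi>\<close>, namely \<open>\<Phi> x + \<i> \<Phi> y\<close>.\<close>

definition amplify ::
  "nat \<Rightarrow> ('a \<Rightarrow> 'b::comm_cstar_algebra mat) \<Rightarrow> 'a cplx mat \<Rightarrow> 'b mat" where
  "amplify d \<Phi> X = mat (dim_row X * d) (dim_col X * d) (\<lambda>(p, q).
     let x = fst (X $$ (p div d, q div d)); y = snd (X $$ (p div d, q div d))
     in \<Phi> x $$ (p mod d, q mod d) + scaleC \<i> (\<Phi> y $$ (p mod d, q mod d)))"

definition unital_complete_order_embedding ::
  "'a::euclidean_space set \<Rightarrow> 'a \<Rightarrow> nat \<Rightarrow> ('a \<Rightarrow> 'b::comm_cstar_algebra mat) \<Rightarrow> bool" where
  "unital_complete_order_embedding C u d \<Phi> \<longleftrightarrow>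
     (\<forall>x. \<Phi> x \<in> carrier_mat d d \<and> map_mat conjugate (transpose_mat (\<Phi> x)) = \<Phi> x) \<and>
     (\<forall>k<d. \<forall>l<d. linear (\<lambda>x. \<Phi> x $$ (k, l))) \<and>
     \<Phi> u = 1\<^sub>m d \<and>
     (\<forall>s\<ge>1. \<forall>X \<in> Her_tensor s. X \<in> Cmin C s \<longleftrightarrow> cstar_mat_pos (s * d) (amplify d \<Phi> X))"

text \<open>HOL does not quantify over types inside a formula, so the C*-algebra is a type argument.
  The minimal operator system is not subhomogeneous iff the predicate below fails for every
  type \<open>'b\<close>; a theorem stating its negation for a type variable \<open>'b\<close> says exactly this.\<close>

definition Cmin_subhomogeneous_over ::
  "'b::comm_cstar_algebra itself \<Rightarrow> 'a::euclidean_space set \<Rightarrow> 'a \<Rightarrow> bool" where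
  "Cmin_subhomogeneous_over (_ :: 'b itself) C u \<longleftrightarrow>
     (\<exists>d\<ge>1. \<exists>\<Phi> :: 'a \<Rightarrow> 'b mat. unital_complete_order_embedding C u d \<Phi>)"

end

theory Submission
  imports Defs "HOL-Library.Function_Algebras"
begin

text \<open>Call \<open>X\<close> rigid if no nonzero linear family of row vectors \<open>b(c)\<close> with \<open>b(u) = 0\<close> vanishes on
  \<open>ker X(c)\<close> for all \<open>c \<in> C\<close>. The block \<open>\<beta>\<^sup>*\<close> of a dilation of \<open>X\<close> consists of such families, so rigid
  points are Arveson boundary points.

  Suppose moreover that the matrices \<open>X(c)\<close> generate \<open>Mat\<^sub>s(\<complex>)\<close>. If \<open>X \<in> mconv(B(d))\<close>, then rigidity makes
  some \<open>V \<noteq> 0\<close> intertwine \<open>X\<close> with a point of size \<open>d\<close>. If \<open>\<Phi>\<close> embeds the minimal system in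
  \<open>Mat\<^sub>d(\<A>)\<close>, extend the trace pairing with \<open>X\<close> from the image of the system to a positive functional on
  \<open>Mat\<^sub>s\<^sub>d(\<A>)\<close> (M. Riesz); rigidity makes \<open>\<Phi>(c)\<close> and \<open>X(c)\<close> act alike on its GNS space. In both cases the
  Capelli identity of \<open>d \<times> d\<close> matrices over a commutative ring passes to \<open>Mat\<^sub>s(\<complex>)\<close>, and \<open>s \<le> d\<^sup>2 + 1\<close>.

  For the construction choose a generator \<open>c2\<close> of the cone with neighbours \<open>c1\<close> and \<open>c3\<close>. Up to scaling, the
  other generators, of which there are at least two, are \<open>x c1 - c2 + z c3\<close>, where the pairs \<open>(x, z)\<close> of
  positive numbers form an antichain. For Hermitian \<open>E, F > 0\<close> let \<open>X\<close> take the values \<open>E \<oplus> 0\<close>, \<open>(E F)\<^sup>*(E F)\<close>,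
  \<open>0 \<oplus> F\<close> at \<open>c1, c2, c3\<close>. It is nonnegative at \<open>x c1 - c2 + z c3\<close> iff \<open>E / x + F / z \<le> 1\<close>, and its kernel there
  is isomorphic to that of \<open>1 - E / x - F / z\<close>. Combinations \<open>E, F\<close> of the identity, \<open>diag(0, \<dots>, m - 1)\<close> and the
  all-ones matrix can be chosen such that \<open>E / x + F / z \<le> 1\<close> at all these generators, while \<open>1 - E / x - F / z\<close>
  has kernel spanned by the first unit vector at one of them and kernel the vectors with sum zero at another. Normalized at \<open>u\<close>, this \<open>X\<close> is rigid and generates
  \<open>Mat\<^sub>2\<^sub>m(\<complex>)\<close>.\<close>

section \<open>Sums of squares in commutative C*-algebras\<close>

text \<open>The algebra \<A> is an arbitrary commutative C*-algebra given as a type, and positivity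
  in its matrix algebras means being of the form Y* Y. This shapes the part on embeddings: matrices
  are tested by quadratic forms whose values are sums of squares, square roots come from the
  binomial series, and a form is factored by Cholesky elimination after adding \<epsilon> times the
  identity; \<epsilon> then disappears in a scalar estimate.

  Five extreme rays leave two pairs (x, z) besides c1, c2, c3. The kernels at c1, c2, c3 bring a row
  family into a shape described by three vectors of length m, and it has the form y X(c) iff a
  certain combination h of them is 0. A kernel vector w of 1 - E / x - F / z says h . w = 0; a line
  from one pair and a complementary hyperplane from the other leave only h = 0. The same two pairs
  give generation: 1 - E / x - F / z is a multiple of D = diag(0, ..., m - 1) at one and of the
  all-ones matrix J at the other, where D has distinct eigenvalues and J has no zero entry.\<close>

lemma conjugate_diff: "conjugate (a - b) = conjugate a - conjugate (b::'a::conjugatable_ring)"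
  by (metis conjugate_dist_add conjugate_neg diff_conv_add_uminus)

lemma conjugate_one: "conjugate (1::'b::comm_cstar_algebra) = 1"
  using conjugate_dist_mul[of "conjugate 1" "1::'b"] by simp

lemma mult_scaleC_right: "a * scaleC z b = scaleC z (a * (b::'b::comm_cstar_algebra))"
  using mult_scaleC_left[of z b a] by (simp add: mult.commute)

lemma scaleC_zero: "scaleC 0 (a::'b::comm_cstar_algebra) = 0"
  using scaleC_of_real[of 0 a] by simp

lemma scaleC_one: "scaleC 1 (a::'b::comm_cstar_algebra) = a"
  using scaleC_of_real[of 1 a] by simp

text \<open>The C*-identity and submultiplicativity bound the norm of every element by the norm of
  its adjoint; using this for a and for its adjoint gives equality.\<close>

lemma norm_conjugate: "norm (conjugate a) = norm (a::'b::comm_cstar_algebra)"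
proof -
  have le: "norm b \<le> norm (conjugate b)" for b :: 'b
  proof (cases "b = 0")
    case False
    have "norm b * norm b \<le> norm (conjugate b) * norm b"
      using cstar_identity[of b] norm_mult_ineq[of "conjugate b" b] by (simp add: power2_eq_square)
    then show ?thesis using False by simp
  qed simp
  show ?thesis using le[of a] le[of "conjugate a"] by simp
qed

lemma conjugate_scaleR: "conjugate (r *\<^sub>R a) = r *\<^sub>R conjugate (a::'b::comm_cstar_algebra)"
  using conjugate_scaleC[of "complex_of_real r" a] by (simp add: scaleC_of_real)

lemma bounded_linear_conjugate: "bounded_linear (conjugate :: 'b::comm_cstar_algebra \<Rightarrow> 'b)"
  by (rule bounded_linear_intro[where K=1])
    (simp_all add: conjugate_dist_add conjugate_scaleR norm_conjugate)

lemma conjugate_power: "conjugate (x ^ n) = conjugate (x::'b::comm_cstar_algebra) ^ n"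
  by (induction n) (simp_all add: conjugate_one conjugate_dist_mul)

section \<open>Square roots through the binomial series of (1 + x)^\<alpha>\<close>

definition binomial_series :: "real \<Rightarrow> 'b \<Rightarrow> 'b::comm_cstar_algebra" where
  "binomial_series \<alpha> x = (\<Sum>n. (\<alpha> gchoose n) *\<^sub>R x ^ n)"

text \<open>The real binomial series converges at a point z strictly between norm x and 1, hence
  absolutely at norm x; submultiplicativity of the norm transfers this to the algebra.\<close>

lemma summable_binomial_series:
  fixes x :: "'b::comm_cstar_algebra"
  assumes "norm x < 1"
  shows "summable (\<lambda>n. norm ((\<alpha> gchoose n) *\<^sub>R x ^ n))"
proof -
  obtain z where z: "norm x < z" "z < 1" using dense[OF assms] by blast
  then have "0 < z" by (meson norm_ge_zero le_less_trans)
  with z have "summable (\<lambda>n. (\<alpha> gchoose n) * z ^ n)"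
    using gen_binomial_real[of z \<alpha>] by (auto intro: sums_summable)
  then have "summable (\<lambda>n. norm ((\<alpha> gchoose n) * norm x ^ n))"
    by (rule powser_insidea) (use z \<open>0 < z\<close> in simp)
  then show ?thesis
    by (rule summable_comparison_test'[where N=0])
      (simp add: abs_mult mult_left_mono norm_power_ineq)
qed

text \<open>The coefficients of the Cauchy product are Vandermonde convolutions. Exponents 1/2 and
  -1/2 thus give a square root and its inverse.\<close>

lemma binomial_series_mult:
  assumes "norm x < 1"
  shows "binomial_series \<alpha> x * binomial_series \<beta> x = binomial_series (\<alpha> + \<beta>) x"
proof -
  have "(\<lambda>n. \<Sum>k\<le>n. ((\<alpha> gchoose k) *\<^sub>R x ^ k) * ((\<beta> gchoose (n - k)) *\<^sub>R x ^ (n - k)))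
      sums (binomial_series \<alpha> x * binomial_series \<beta> x)"
    unfolding binomial_series_def
    by (intro Cauchy_product_sums summable_binomial_series assms)
  moreover have "(\<Sum>k\<le>n. ((\<alpha> gchoose k) *\<^sub>R x ^ k) * ((\<beta> gchoose (n - k)) *\<^sub>R x ^ (n - k)))
      = (\<alpha> + \<beta> gchoose n) *\<^sub>R x ^ n" for n
  proof -
    have "(\<Sum>k\<le>n. ((\<alpha> gchoose k) *\<^sub>R x ^ k) * ((\<beta> gchoose (n - k)) *\<^sub>R x ^ (n - k)))
        = (\<Sum>k\<le>n. ((\<alpha> gchoose k) * (\<beta> gchoose (n - k))) *\<^sub>R x ^ n)"
      by (intro sum.cong) (simp_all flip: power_add)
    also have "\<dots> = (\<alpha> + \<beta> gchoose n) *\<^sub>R x ^ n"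
      by (simp add: gbinomial_Vandermonde atMost_atLeast0 flip: scaleR_sum_left)
    finally show ?thesis .
  qed
  ultimately show ?thesis
    by (simp add: binomial_series_def sums_iff)
qed

lemma binomial_series_0: "binomial_series 0 x = 1"
proof -
  have "binomial_series 0 x = (\<Sum>n\<in>{0}. (0 gchoose n) *\<^sub>R x ^ n)"
    unfolding binomial_series_def
    by (rule suminf_finite) (auto simp: gbinomial_0_left split: if_splits)
  then show ?thesis by simp
qed

lemma binomial_series_1: "binomial_series 1 x = 1 + x"
proof -
  have z: "((1::real) gchoose n) = 0" if "n \<notin> {0,1}" for n
    using that binomial_gbinomial[of 1 n, where 'a=real] by (simp add: binomial_eq_0)
  have "binomial_series 1 x = (\<Sum>n\<in>{0,1}. (1 gchoose n) *\<^sub>R x ^ n)"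
    unfolding binomial_series_def
    by (rule suminf_finite) (use z in \<open>auto\<close>)
  then show ?thesis by simp
qed

lemma conjugate_binomial_series:
  assumes "norm x < 1" "conjugate x = x"
  shows "conjugate (binomial_series \<alpha> x) = binomial_series \<alpha> x"
proof -
  have "summable (\<lambda>n. (\<alpha> gchoose n) *\<^sub>R x ^ n)"
    by (rule summable_norm_cancel, rule summable_binomial_series[OF assms(1)])
  from bounded_linear.suminf[OF bounded_linear_conjugate this] show ?thesis
    unfolding binomial_series_def by (simp add: conjugate_scaleR conjugate_power assms)
qed

text \<open>Write t - b = t (1 + x) with x = - b / t of norm less than 1. The exponents 1/2 and -1/2
  give the root \<open>g\<close> and its inverse \<open>k\<close>; both are Hermitian because x
  is.\<close>

lemma exists_hermitian_sqrt:
  fixes b :: "'b::comm_cstar_algebra"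
  assumes "conjugate b = b" "norm b < t"
  shows "\<exists>g k. conjugate g = g \<and> conjugate k = k \<and> g * g = t *\<^sub>R 1 - b \<and> g * k = 1"
proof -
  have t: "t > 0" using assms(2) norm_ge_zero[of b] by linarith
  define x where "x = (- 1 / t) *\<^sub>R b"
  have x: "norm x < 1" "conjugate x = x"
    using assms t by (simp_all add: x_def conjugate_scaleR conjugate_neg)
  define g where "g = sqrt t *\<^sub>R binomial_series (1/2) x"
  define k where "k = (1 / sqrt t) *\<^sub>R binomial_series (- 1/2) x"
  have "g * g = t *\<^sub>R (1 + x)"
    using t by (simp add: g_def binomial_series_mult[OF x(1)] binomial_series_1)
  also have "\<dots> = t *\<^sub>R 1 - b" using t by (simp add: x_def scaleR_right_diff_distrib)
  finally have "g * g = t *\<^sub>R 1 - b" .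
  moreover have "g * k = 1"
    using t by (simp add: g_def k_def binomial_series_mult[OF x(1)] binomial_series_0)
  moreover have "conjugate g = g" "conjugate k = k"
    by (simp_all add: g_def k_def conjugate_scaleR conjugate_binomial_series[OF x])
  ultimately show ?thesis by blast
qed

section \<open>Sums of squares as the positive cone of the algebra\<close>

inductive sos :: "'b::comm_cstar_algebra \<Rightarrow> bool" where
  sos_zero: "sos 0"
| sos_step: "sos a \<Longrightarrow> sos (a + conjugate y * y)"

lemma sos_square: "sos (conjugate y * y)"
  using sos_step[OF sos_zero, of y] by simp

lemma sos_add: "sos b \<Longrightarrow> sos a \<Longrightarrow> sos (a + b)"
  by (induction rule: sos.induct) (auto simp: add.assoc[symmetric] intro: sos.intros)

lemma sos_sum: "(\<And>i. i \<in> I \<Longrightarrow> sos (f i)) \<Longrightarrow> sos (sum f I)"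
  by (induction I rule: infinite_finite_induct) (auto intro: sos_zero sos_add)

lemma conjugate_sos: "sos a \<Longrightarrow> conjugate a = a"
  by (induction rule: sos.induct) (simp_all add: conjugate_dist_add conjugate_dist_mul mult.commute)

lemma sos_conjugate_mult: "sos a \<Longrightarrow> sos (conjugate y * a * y)"
proof (induction rule: sos.induct)
  case (sos_step a x)
  have "conjugate y * (a + conjugate x * x) * y = conjugate y * a * y + conjugate (x * y) * (x * y)"
    by (simp add: algebra_simps conjugate_dist_mul)
  then show ?case using sos_step.IH by (simp add: sos.sos_step)
qed (simp add: sos_zero)

lemma sos_scaleR:
  assumes "sos a" "0 \<le> t"
  shows "sos (t *\<^sub>R a)"
proof -
  have "conjugate (sqrt t *\<^sub>R 1) * a * (sqrt t *\<^sub>R 1) = t *\<^sub>R a"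
    using assms(2) by (simp add: conjugate_scaleR conjugate_one)
  then show ?thesis using sos_conjugate_mult[OF assms(1), of "sqrt t *\<^sub>R 1"] by simp
qed

text \<open>By the C*-identity y* y has norm less than t, so t - y* y has a Hermitian square
  root.\<close>

lemma sos_bound:
  assumes "(norm y)\<^sup>2 < t"
  shows "sos (t *\<^sub>R 1 - conjugate y * (y::'b::comm_cstar_algebra))"
proof -
  obtain g where "conjugate g = g" "g * g = t *\<^sub>R 1 - conjugate y * y"
    using exists_hermitian_sqrt[of "conjugate y * y" t] assms cstar_identity[of y]
    by (auto simp: conjugate_dist_mul mult.commute[of y])
  then show ?thesis using sos_square[of g] by simp
qed

text \<open>With g the square root of t - h^2, the element z = g + i h satisfies z* z = g^2 + h^2 =
  t, so its norm is sqrt t. As g is the real part of z, its norm is at most sqrt t, and t - h^2 =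
  g^2.\<close>

lemma norm_diff_hermitian_square:
  fixes h :: "'b::comm_cstar_algebra"
  assumes "conjugate h = h" "(norm h)\<^sup>2 < t"
  shows "norm (t *\<^sub>R 1 - h * h) \<le> t"
proof -
  have t: "t > 0" using assms(2) zero_le_power2[of "norm h"] by linarith
  obtain g where g: "conjugate g = g" "g * g = t *\<^sub>R 1 - h * h"
    using exists_hermitian_sqrt[of "h * h" t] assms cstar_identity[of h]
    by (auto simp: conjugate_dist_mul)
  define z where "z = g + scaleC \<i> h"
  have m: "scaleC (- \<i>) h * scaleC \<i> h = h * h"
    by (simp add: mult_scaleC_left mult_scaleC_right scaleC_scaleC scaleC_one)
  then have m': "scaleC \<i> h * scaleC (- \<i>) h = h * h" by (simp only: mult.commute)
  have z': "conjugate z = g + scaleC (- \<i>) h"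
    by (simp add: z_def conjugate_dist_add conjugate_scaleC g assms)
  have c: "g * scaleC \<i> h + scaleC (- \<i>) h * g = 0"
    by (simp add: mult_scaleC_left mult_scaleC_right mult.commute[of h g] scaleC_zero flip: scaleC_add_left)
  have "conjugate z * z = g * g + h * h + (g * scaleC \<i> h + scaleC (- \<i>) h * g)"
    unfolding z' by (simp add: z_def algebra_simps m m')
  also have "\<dots> = t *\<^sub>R 1" by (simp add: c g)
  finally have "(norm z)\<^sup>2 = t" using cstar_identity[of z] t by simp
  have "2 *\<^sub>R g = z + conjugate z"
  proof -
    have "scaleC \<i> h + scaleC (- \<i>) h = 0"
      by (simp add: scaleC_zero flip: scaleC_add_left)
    then show ?thesis unfolding z' by (simp add: z_def scaleR_2 algebra_simps)
  qed
  then have "2 * norm g \<le> 2 * norm z"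
    using norm_triangle_ineq[of z "conjugate z"] by (simp add: norm_conjugate flip: \<open>2 *\<^sub>R g = _\<close>)
  then have "(norm g)\<^sup>2 \<le> t" using \<open>(norm z)\<^sup>2 = t\<close>
    using power_mono[of "norm g" "norm z" 2] by simp
  then show ?thesis using cstar_identity[of g] g by simp
qed

text \<open>Positivity in terms of the norm. The condition survives sums by the triangle inequality,
  so a single square suffices. A square y* y is reduced to Hermitian squares by y = h + i k, where
  y* y = h^2 + k^2 because the algebra is commutative.\<close>

lemma sos_norm_bound:
  fixes a :: "'b::comm_cstar_algebra"
  assumes "sos a"
  shows "\<exists>T\<ge>0. norm (T *\<^sub>R 1 - a) \<le> T"
  using assms
proof (induction rule: sos.induct)
  case sos_zero
  show ?case by (intro exI[of _ 0]) simp
next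
  case (sos_step a y)
  then obtain T where T: "T \<ge> 0" "norm (T *\<^sub>R 1 - a) \<le> T" by blast
  define h where "h = (1/2) *\<^sub>R (y + conjugate y)"
  define k where "k = scaleC (- \<i> / 2) (y - conjugate y)"
  have h: "conjugate h = h" by (simp add: h_def conjugate_scaleR conjugate_dist_add add.commute)
  have k: "conjugate k = k"
  proof -
    have "conjugate k = scaleC (\<i> / 2) (conjugate y - y)"
      by (simp add: k_def conjugate_scaleC conjugate_diff)
    also have "conjugate y - y = scaleC (complex_of_real (-1)) (y - conjugate y)"
      by (simp only: scaleC_of_real) simp
    also have "scaleC (\<i> / 2) \<dots> = k" by (simp add: k_def scaleC_scaleC)
    finally show ?thesis .
  qed
  have kk: "k * k = (-1/4) *\<^sub>R ((y - conjugate y) * (y - conjugate y))"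
  proof -
    have "k * k = scaleC ((- \<i> / 2) * (- \<i> / 2)) ((y - conjugate y) * (y - conjugate y))"
      by (simp add: k_def mult_scaleC_left mult_scaleC_right scaleC_scaleC)
    also have "(- \<i> / 2) * (- \<i> / 2) = complex_of_real (-1/4)" by simp
    finally show ?thesis by (simp only: scaleC_of_real)
  qed
  have "h * h + k * k = conjugate y * y"
  proof -
    have "4 *\<^sub>R (h * h + k * k) = (y + conjugate y) * (y + conjugate y) - (y - conjugate y) * (y - conjugate y)"
      by (simp add: kk h_def scaleR_right_diff_distrib flip: scaleR_right_distrib)
    also have "\<dots> = 4 *\<^sub>R (conjugate y * y)"
      by (simp add: algebra_simps scaleR_conv_of_real)
    finally show ?thesis by simp
  qed
  define s where "s = (norm h)\<^sup>2 + 1"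
  define t where "t = (norm k)\<^sup>2 + 1"
  have "(T + s + t) *\<^sub>R 1 - (a + conjugate y * y)
      = (T *\<^sub>R 1 - a) + (s *\<^sub>R 1 - h * h) + (t *\<^sub>R 1 - k * k)"
    using \<open>h * h + k * k = _\<close>[symmetric] by (simp add: scaleR_left_distrib)
  also have "norm \<dots> \<le> T + s + t"
    by (intro norm_triangle_mono T norm_diff_hermitian_square h k) (simp_all add: s_def t_def)
  finally show ?case using T by (intro exI[of _ "T + s + t"]) (simp add: s_def t_def)
qed

text \<open>Rewrite a + \<epsilon> = (T + \<epsilon>) - (T - a), where T - a has norm at most T < T
  + \<epsilon>. The shift by \<epsilon> makes the root invertible, so that it can serve as a
  pivot.\<close>

lemma sos_plus_eps_sqrt:
  fixes a :: "'b::comm_cstar_algebra"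
  assumes "sos a" "\<epsilon> > 0"
  shows "\<exists>g k. conjugate g = g \<and> conjugate k = k \<and> g * g = a + \<epsilon> *\<^sub>R 1 \<and> g * k = 1"
proof -
  obtain T where T: "T \<ge> 0" "norm (T *\<^sub>R 1 - a) \<le> T" using sos_norm_bound[OF assms(1)] by blast
  have "conjugate (T *\<^sub>R 1 - a) = T *\<^sub>R 1 - a"
    by (simp add: conjugate_diff conjugate_scaleR conjugate_one conjugate_sos assms)
  from exists_hermitian_sqrt[OF this, of "T + \<epsilon>"] show ?thesis
    using T assms(2) by (simp add: algebra_simps)
qed

section \<open>Quadratic forms and Cholesky factorization\<close>

definition quad_form :: "nat \<Rightarrow> (nat \<Rightarrow> nat \<Rightarrow> 'b) \<Rightarrow> (nat \<Rightarrow> 'b) \<Rightarrow> 'b::{conjugate,semiring_0}" where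
  "quad_form n M v = (\<Sum>i<n. \<Sum>j<n. conjugate (v i) * M i j * v j)"

text \<open>Elimination starts from the last index. The gap \<epsilon> gives the pivot
  \<open>M n n\<close> an invertible Hermitian root and passes unchanged to the Schur complement.
  The lemma serves for matrices over the algebra and for complex matrices.\<close>

lemma cholesky:
  fixes M :: "nat \<Rightarrow> nat \<Rightarrow> 'b::comm_cstar_algebra"
  assumes "\<And>i j. i < n \<Longrightarrow> j < n \<Longrightarrow> M j i = conjugate (M i j)" and "\<epsilon> > 0"
    and "\<And>v. sos (quad_form n M v - \<epsilon> *\<^sub>R (\<Sum>i<n. conjugate (v i) * v i))"
  shows "\<exists>W. \<forall>i<n. \<forall>j<n. M i j = (\<Sum>k<n. conjugate (W k i) * W k j)"
  using assms
proof (induction n arbitrary: M)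
  case (Suc n)
  \<comment> \<open>Evaluation at the last unit vector bounds the pivot from below.\<close>
  have "sos (M n n - \<epsilon> *\<^sub>R 1)"
    using Suc.prems(3)[of "(\<lambda>_. 0)(n := 1)"]
    by (simp add: quad_form_def conjugate_one)
  from sos_plus_eps_sqrt[OF this Suc.prems(2)] obtain g k
    where gk: "conjugate g = g" "conjugate k = k" "g * g = M n n" "g * k = 1" by auto
  have kM: "k * (k * M n n) = 1"
  proof -
    have "k * (k * M n n) = (g * k) * (g * k)" by (simp add: mult_ac flip: gk(3))
    then show ?thesis by (simp add: gk(4))
  qed
  \<comment> \<open>The Schur complement of the pivot: \<open>k * k\<close> is the inverse of
    \<open>M n n\<close>.\<close>
  define N where "N i j = M i j - conjugate (k * M n i) * (k * M n j)" for i j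
  have "\<exists>W. \<forall>i<n. \<forall>j<n. N i j = (\<Sum>k<n. conjugate (W k i) * W k j)"
  proof (rule Suc.IH[OF _ Suc.prems(2)])
    show "N j i = conjugate (N i j)" if "i < n" "j < n" for i j
      using Suc.prems(1)[of i j] that
      by (simp add: N_def conjugate_diff conjugate_dist_mul mult.commute)
    fix v :: "nat \<Rightarrow> 'b"
    define L where "L = (\<Sum>j<n. M n j * v j)"
    \<comment> \<open>This last coordinate completes the square, so the form of \<open>M\<close> at
      \<open>v'\<close> equals the form of \<open>N\<close> at \<open>v\<close>.\<close>
    define c where "c = - (k * k * L)"
    define v' where "v' = v(n := c)"
    have cL: "(\<Sum>i<n. conjugate (v i) * M i n) = conjugate L"
      unfolding L_def using Suc.prems(1)[of n]
      by (simp add: sum_conjugate conjugate_dist_mul mult.commute)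
    have "quad_form (Suc n) M v' = quad_form n M v + conjugate L * c
        + conjugate c * L + conjugate c * M n n * c"
    proof -
      have "(\<Sum>i<n. conjugate (v i) * M i n * c) = conjugate L * c"
        by (simp add: sum_distrib_right flip: cL)
      moreover have "(\<Sum>j<n. conjugate c * M n j * v j) = conjugate c * L"
        by (simp add: L_def sum_distrib_left mult.assoc)
      ultimately show ?thesis by (simp add: quad_form_def v'_def sum.distrib)
    qed
    also have "\<dots> = quad_form n M v - conjugate (k * L) * (k * L)"
    proof -
      have "conjugate c * M n n * c = conjugate L * L * k * k * (k * (k * M n n))"
        by (simp add: c_def conjugate_neg conjugate_dist_mul gk mult_ac)
      then show ?thesis
        by (simp add: kM) (simp add: c_def conjugate_neg conjugate_dist_mul gk mult_ac)
    qed
    also have "\<dots> = quad_form n N v"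
    proof -
      have kL: "k * L = (\<Sum>j<n. k * (M n j * v j))" by (simp add: L_def sum_distrib_left)
      have "conjugate (k * L) * (k * L) = (\<Sum>i<n. \<Sum>j<n. conjugate (k * (M n i * v i)) * (k * (M n j * v j)))"
        by (simp only: kL sum_conjugate[OF finite_lessThan] sum_product)
      also have "\<dots> = (\<Sum>i<n. \<Sum>j<n. conjugate (v i) * (conjugate (k * M n i) * (k * M n j)) * v j)"
        by (simp add: conjugate_dist_mul mult_ac)
      finally show ?thesis
        by (simp add: quad_form_def N_def algebra_simps sum_subtractf)
    qed
    finally have q: "quad_form (Suc n) M v' = quad_form n N v" .
    have "(\<Sum>i<Suc n. conjugate (v' i) * v' i) = (\<Sum>i<n. conjugate (v i) * v i) + conjugate c * c"
      by (simp add: v'_def)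
    \<comment> \<open>Passing from \<open>v\<close> to \<open>v'\<close> only enlarges the
      subtracted norm by c* c, so the gap \<epsilon> carries over to \<open>N\<close>.\<close>
    then have "quad_form n N v - \<epsilon> *\<^sub>R (\<Sum>i<n. conjugate (v i) * v i)
      = (quad_form (Suc n) M v' - \<epsilon> *\<^sub>R (\<Sum>i<Suc n. conjugate (v' i) * v' i)) + \<epsilon> *\<^sub>R (conjugate c * c)"
      by (simp add: q scaleR_right_distrib)
    then show "sos (quad_form n N v - \<epsilon> *\<^sub>R (\<Sum>i<n. conjugate (v i) * v i))"
      using Suc.prems by (simp add: sos_add sos_scaleR sos_square del: sum.lessThan_Suc)
  qed
  then obtain W where W: "N i j = (\<Sum>k<n. conjugate (W k i) * W k j)" if "i < n" "j < n" for i j by blast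
  \<comment> \<open>Row \<open>n\<close> is the pivot row divided by the root \<open>g\<close>; the
    other rows come from \<open>N\<close> and have entry 0 in column \<open>n\<close>.\<close>
  define W' where "W' a i = (if a = n then k * M n i else if i = n then 0 else W a i)" for a i
  have "M i j = (\<Sum>k<Suc n. conjugate (W' k i) * W' k j)" if ij: "i < Suc n" "j < Suc n" for i j
  proof -
    have *: "(\<Sum>k<Suc n. conjugate (W' k i) * W' k j)
        = (\<Sum>k<n. conjugate (if i = n then 0 else W k i) * (if j = n then 0 else W k j))
          + conjugate (k * M n i) * (k * M n j)"
      by (simp add: W'_def)
    consider "i < n" "j < n" | "i = n" | "j = n" "i < n"
      using ij unfolding less_Suc_eq by blast
    then show ?thesis
    proof cases
      case 1
      then show ?thesis using W[of i j] unfolding * by (simp add: N_def algebra_simps)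
    next
      case 2
      have "conjugate (M n n) = M n n" using Suc.prems(1)[of n n] by simp
      then have "conjugate (k * M n n) * (k * M n j) = (k * (k * M n n)) * M n j"
        by (simp add: conjugate_dist_mul gk mult_ac)
      then show ?thesis unfolding * using 2 by (simp add: kM)
    next
      case 3
      have "conjugate (k * M n i) * (k * M n n) = (k * (k * M n n)) * conjugate (M n i)"
        by (simp add: conjugate_dist_mul gk mult_ac)
      then show ?thesis unfolding * using 3 Suc.prems(1)[of n i] by (simp add: kM)
    qed
  qed
  then show ?case by blast
qed simp

section \<open>Extension of positive functionals\<close>

text \<open>M. Riesz extension with the functional given by its graph \<open>G\<close>. Positivity
  makes the graph single-valued: if two values of one vector differ by r, then (0, r) and (0, -r)
  lie in the graph, and 0 lies in \<open>K\<close>. Zorn's lemma is applied to the positive graphs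
  above \<open>G\<close>; the order unit \<open>e\<close> in the domain makes a one-step extension
  possible.\<close>

lemma riesz_extension:
  fixes K :: "'v::real_vector set" and G :: "('v \<times> real) set"
  assumes Kadd: "\<And>x y. x \<in> K \<Longrightarrow> y \<in> K \<Longrightarrow> x + y \<in> K"
    and Kscale: "\<And>t x. x \<in> K \<Longrightarrow> 0 \<le> t \<Longrightarrow> t *\<^sub>R x \<in> K"
    and unit: "\<And>v. \<exists>t. t *\<^sub>R e - v \<in> K"
    and G: "Real_Vector_Spaces.subspace G" "\<And>v r. (v, r) \<in> G \<Longrightarrow> v \<in> K \<Longrightarrow> 0 \<le> r" "(e, r0) \<in> G"
  shows "\<exists>g. linear g \<and> (\<forall>v\<in>K. 0 \<le> g v) \<and> (\<forall>v r. (v, r) \<in> G \<longrightarrow> g v = r)"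
proof -
  define \<A> where "\<A> = {H. Real_Vector_Spaces.subspace H \<and> G \<subseteq> H \<and> (\<forall>v r. (v, r) \<in> H \<longrightarrow> v \<in> K \<longrightarrow> 0 \<le> r)}"
  have "\<exists>M\<in>\<A>. \<forall>X\<in>\<A>. M \<subseteq> X \<longrightarrow> X = M"
  proof (rule subset_Zorn_nonempty)
    show "\<A> \<noteq> {}" using G by (auto simp: \<A>_def)
    fix \<C> assume C: "\<C> \<noteq> {}" "subset.chain \<A> \<C>"
    then have CA: "\<C> \<subseteq> \<A>" and lin: "\<And>X Y. X \<in> \<C> \<Longrightarrow> Y \<in> \<C> \<Longrightarrow> X \<subseteq> Y \<or> Y \<subseteq> X"
      by (auto simp: subset_chain_def)
    have "Real_Vector_Spaces.subspace (\<Union>\<C>)"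
      unfolding real_vector.subspace_def
    proof (intro conjI ballI allI)
      show "0 \<in> \<Union>\<C>" using C(1) CA by (auto simp: \<A>_def real_vector.subspace_def)
      fix x assume "x \<in> \<Union>\<C>"
      then obtain X where "X \<in> \<C>" "x \<in> X" by blast
      then show "c *\<^sub>R x \<in> \<Union>\<C>" for c
        using CA real_vector.subspace_scale[of X x c] by (auto simp: \<A>_def)
      fix y assume "y \<in> \<Union>\<C>"
      then obtain Y where "Y \<in> \<C>" "y \<in> Y" by blast
      then obtain Z where "Z \<in> \<C>" "x \<in> Z" "y \<in> Z"
        using lin[of X Y] \<open>X \<in> \<C>\<close> \<open>x \<in> X\<close> by blast
      then show "x + y \<in> \<Union>\<C>"
        using CA real_vector.subspace_add[of Z x y] by (auto simp: \<A>_def)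
    qed
    then show "\<Union>\<C> \<in> \<A>" using C(1) CA unfolding \<A>_def by blast
  qed
  then obtain M where M: "Real_Vector_Spaces.subspace M" "G \<subseteq> M" "\<And>v r. (v, r) \<in> M \<Longrightarrow> v \<in> K \<Longrightarrow> 0 \<le> r"
    and max: "\<And>X. X \<in> \<A> \<Longrightarrow> M \<subseteq> X \<Longrightarrow> X = M" by (auto simp: \<A>_def)
  have Madd: "(v + w, r + s) \<in> M" if "(v, r) \<in> M" "(w, s) \<in> M" for v w r s
    using real_vector.subspace_add[OF M(1) that] by simp
  have Mscale: "(t *\<^sub>R v, t * r) \<in> M" if "(v, r) \<in> M" for t v r
    using real_vector.subspace_scale[OF M(1) that, of t] by simp
  have Mdiff: "(v - w, r - s) \<in> M" if "(v, r) \<in> M" "(w, s) \<in> M" for v w r s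
    using real_vector.subspace_diff[OF M(1) that] by simp
  have e: "(e, r0) \<in> M" using G(3) M(2) by blast
  have K0: "0 \<in> K" using unit[of 0] Kscale[of _ 0] by force
  have unique: "r = s" if "(v, r) \<in> M" "(v, s) \<in> M" for v r s
    using Mdiff[OF that] Mdiff[OF that(2,1)] M(3)[of 0 "r - s"] M(3)[of 0 "s - r"] K0 by simp
  have total: "\<exists>r. (v, r) \<in> M" for v
  proof (rule ccontr)
    assume no: "\<nexists>r. (v, r) \<in> M"
    \<comment> \<open>The bounds that positivity imposes on a value at \<open>v\<close>, from below
      and from above.\<close>
    define L where "L = {r. \<exists>y. (y, r) \<in> M \<and> v - y \<in> K}"
    define U where "U = {r. \<exists>y. (y, r) \<in> M \<and> y - v \<in> K}"
    have LU: "l \<le> w" if lw: "l \<in> L" "w \<in> U" for l w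
    proof -
      obtain y z where "(y, l) \<in> M" "v - y \<in> K" "(z, w) \<in> M" "z - v \<in> K"
        using lw by (auto simp: L_def U_def)
      then show ?thesis using Mdiff[of z w y l] Kadd[of "z - v" "v - y"] M(3)[of "z - y" "w - l"] by simp
    qed
    \<comment> \<open>Multiples of the order unit on both sides of \<open>v\<close> show that
      \<open>L\<close> and \<open>U\<close> are nonempty, so that the supremum of \<open>L\<close>
      is meaningful.\<close>
    obtain t1 t2 where "t1 *\<^sub>R e - v \<in> K" "t2 *\<^sub>R e - (- v) \<in> K" using unit by blast
    then have "v - (- t2) *\<^sub>R e \<in> K" by (simp add: add.commute)
    then have "t1 * r0 \<in> U" "(- t2) * r0 \<in> L"
      using Mscale[OF e, of t1] Mscale[OF e, of "- t2"] \<open>t1 *\<^sub>R e - v \<in> K\<close>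
      unfolding U_def L_def by blast+
    then have ne: "L \<noteq> {}" "bdd_above L" "U \<noteq> {}" using LU by (auto intro!: bdd_aboveI)
    define c where "c = Sup L"
    have cL: "l \<le> c" if "l \<in> L" for l using that ne by (simp add: c_def cSup_upper)
    have cU: "c \<le> w" if "w \<in> U" for w unfolding c_def using that ne LU by (intro cSup_least) auto
    define M' where "M' = {(y + a *\<^sub>R v, r + a * c) | y r a. (y, r) \<in> M}"
    have M'I: "(w, s) \<in> M'" if "(y, r) \<in> M" "w = y + a *\<^sub>R v" "s = r + a * c" for w s y r a
      using that unfolding M'_def by blast
    have "M \<subseteq> M'" by (auto intro: M'I[where a=0])
    have "(v, c) \<in> M'"
      by (rule M'I[of 0 0 _ 1]) (use real_vector.subspace_0[OF M(1)] in \<open>auto simp: zero_prod_def\<close>)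
    have "Real_Vector_Spaces.subspace M'"
      unfolding real_vector.subspace_def
    proof (intro conjI ballI allI)
      show "0 \<in> M'" using \<open>M \<subseteq> M'\<close> real_vector.subspace_0[OF M(1)] by blast
      fix x assume "x \<in> M'"
      then obtain y r a where x: "x = (y + a *\<^sub>R v, r + a * c)" "(y, r) \<in> M" by (auto simp: M'_def)
      show "k *\<^sub>R x \<in> M'" for k
        unfolding x scaleR_Pair
        by (rule M'I[OF Mscale[OF x(2), of k], of _ "k * a"]) (simp_all add: algebra_simps)
      fix x' assume "x' \<in> M'"
      then obtain y' r' a' where x': "x' = (y' + a' *\<^sub>R v, r' + a' * c)" "(y', r') \<in> M"
        by (auto simp: M'_def)
      show "x + x' \<in> M'"
        unfolding x x' add_Pair
        by (rule M'I[OF Madd[OF x(2) x'(2)], of _ "a + a'"]) (simp_all add: algebra_simps)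
    qed
    moreover have "0 \<le> s" if ws: "(w, s) \<in> M'" "w \<in> K" for w s
    proof -
      obtain y r a where x: "w = y + a *\<^sub>R v" "s = r + a * c" "(y, r) \<in> M"
        using ws(1) by (auto simp: M'_def)
      \<comment> \<open>For a \<noteq> 0, dividing y + a v by the absolute value of a places -r / a
        in \<open>L\<close> or in \<open>U\<close>, according to the sign of a.\<close>
      consider "a = 0" | "a > 0" | "a < 0" by linarith
      then show ?thesis
      proof cases
        case 1
        then show ?thesis using x ws M(3) by simp
      next
        case 2
        have "v - (- 1 / a) *\<^sub>R y = (1 / a) *\<^sub>R w" using 2 by (simp add: x algebra_simps)
        also have "\<dots> \<in> K" using 2 ws(2) Kscale by simp
        finally have "(- 1 / a) * r \<in> L" unfolding L_def using Mscale[OF x(3)] by blast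
        from cL[OF this] show ?thesis using 2 by (simp add: x field_simps)
      next
        case 3
        have "(- 1 / a) *\<^sub>R y - v = (- 1 / a) *\<^sub>R w" using 3 by (simp add: x algebra_simps)
        also have "\<dots> \<in> K" using 3 ws(2) Kscale[of w "-1/a"] by (simp add: zero_le_divide_iff)
        finally have "(- 1 / a) * r \<in> U" unfolding U_def using Mscale[OF x(3)] by blast
        from cU[OF this] show ?thesis using 3 by (simp add: x field_simps)
      qed
    qed
    ultimately have "M' \<in> \<A>" unfolding \<A>_def using \<open>M \<subseteq> M'\<close> M(2) by blast
    from max[OF this \<open>M \<subseteq> M'\<close>] show False using \<open>(v, c) \<in> M'\<close> no by blast
  qed
  define g where "g v = (THE r. (v, r) \<in> M)" for v
  have g: "(v, g v) \<in> M" for v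
    unfolding g_def by (rule theI') (use total unique in blast)
  have eq: "g v = r" if "(v, r) \<in> M" for v r using unique[OF g that] .
  have "linear g"
    by (rule linearI) (auto intro: eq Madd[OF g g] Mscale[OF g])
  then show ?thesis using eq M(2,3) g by blast
qed

section \<open>Matrix algebras linked to matrices over a commutative ring\<close>

definition unit_mat :: "nat \<Rightarrow> nat \<Rightarrow> nat \<Rightarrow> 'r::{zero,one} mat" where
  "unit_mat n i j = mat n n (\<lambda>(p, q). if p = i \<and> q = j then 1 else 0)"

lemma unit_mat_carrier [simp]: "unit_mat n i j \<in> carrier_mat n n"
  by (simp add: unit_mat_def)

lemma unit_mat_mult:
  "j < n \<Longrightarrow> unit_mat n i j * unit_mat n k l = (if j = k then unit_mat n i l else 0\<^sub>m n n :: 'r::semiring_1 mat)"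
  by (rule eq_matI) (auto simp: unit_mat_def scalar_prod_def if_distrib[of "\<lambda>x. x * _"] cong: if_cong)

text \<open>The monomial W 0 Y 0 W 1 Y 1 ...; its signed sum over the permutations of the W is the
  Capelli polynomial, with the Y as separators.\<close>

fun alternating_word :: "nat \<Rightarrow> (nat \<Rightarrow> 'r mat) \<Rightarrow> (nat \<Rightarrow> 'r mat) \<Rightarrow> nat \<Rightarrow> 'r::semiring_1 mat" where
  "alternating_word n W Y 0 = 1\<^sub>m n"
| "alternating_word n W Y (Suc k) = alternating_word n W Y k * (W k * Y k)"

lemma alternating_word_carrier:
  assumes "\<And>i. i < k \<Longrightarrow> W i \<in> carrier_mat n n" "\<And>i. i < k \<Longrightarrow> Y i \<in> carrier_mat n n"
  shows "alternating_word n W Y k \<in> carrier_mat n n"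
  using assms
proof (induction k)
  case (Suc k)
  then have "alternating_word n W Y k \<in> carrier_mat n n" "W k \<in> carrier_mat n n" "Y k \<in> carrier_mat n n"
    by auto
  then show ?case by simp
qed simp

text \<open>An entry of the word is multilinear in the matrices \<open>W i\<close>: \<kappa> selects
  one entry position for each factor. The coefficients \<open>c\<close> depend on \<open>Y\<close>
  alone, so one choice serves all permutations of the \<open>W i\<close>.\<close>

lemma alternating_word_expand:
  fixes Y :: "nat \<Rightarrow> 'r::comm_ring_1 mat"
  assumes "\<And>i. i < k \<Longrightarrow> Y i \<in> carrier_mat n n" "p < n" "q < n"
  shows "\<exists>c. \<forall>W. (\<forall>i<k. W i \<in> carrier_mat n n) \<longrightarrow>
    alternating_word n W Y k $$ (p, q) =
    (\<Sum>\<kappa>\<in>{..<k} \<rightarrow>\<^sub>E {..<n} \<times> {..<n}. c \<kappa> * (\<Prod>i<k. W i $$ \<kappa> i))"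
  using assms
proof (induction k arbitrary: q)
  case 0
  then show ?case by (intro exI[of _ "\<lambda>_. 1\<^sub>m n $$ (p, q)"]) auto
next
  case (Suc k)
  have "\<forall>r\<in>{..<n}. \<exists>c. \<forall>W. (\<forall>i<k. W i \<in> carrier_mat n n) \<longrightarrow>
    alternating_word n W Y k $$ (p, r) =
    (\<Sum>\<kappa>\<in>{..<k} \<rightarrow>\<^sub>E {..<n} \<times> {..<n}. c \<kappa> * (\<Prod>i<k. W i $$ \<kappa> i))"
    using Suc.prems by (intro ballI Suc.IH) auto
  from bchoice[OF this] obtain c where c: "\<And>r W. r < n \<Longrightarrow> (\<forall>i<k. W i \<in> carrier_mat n n) \<Longrightarrow>
    alternating_word n W Y k $$ (p, r) =
    (\<Sum>\<kappa>\<in>{..<k} \<rightarrow>\<^sub>E {..<n} \<times> {..<n}. c r \<kappa> * (\<Prod>i<k. W i $$ \<kappa> i))"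
    by auto
  \<comment> \<open>The position \<kappa> k belongs to the last factor \<open>W k\<close>: its row
    is the column at which the shorter word is read, its column is the row at which
    \<open>Y k\<close> is read.\<close>
  define c' where "c' \<kappa> = c (fst (\<kappa> k)) (restrict \<kappa> {..<k}) * Y k $$ (snd (\<kappa> k), q)" for \<kappa>
  let ?D = "{..<n} \<times> {..<n}"
  have "alternating_word n W Y (Suc k) $$ (p, q) =
    (\<Sum>\<kappa>\<in>{..<Suc k} \<rightarrow>\<^sub>E ?D. c' \<kappa> * (\<Prod>i<Suc k. W i $$ \<kappa> i))"
    if W: "\<forall>i<Suc k. W i \<in> carrier_mat n n" for W
  proof -
    have Wk: "W k \<in> carrier_mat n n" "Y k \<in> carrier_mat n n" using W Suc.prems by auto
    have A: "alternating_word n W Y k \<in> carrier_mat n n"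
      by (rule alternating_word_carrier) (use W Suc.prems in auto)
    have inj: "inj_on (\<lambda>(y, g). g(k := y)) (?D \<times> ({..<k} \<rightarrow>\<^sub>E ?D))"
      by (rule inj_combinator) simp
    have "(\<Sum>\<kappa>\<in>{..<Suc k} \<rightarrow>\<^sub>E ?D. c' \<kappa> * (\<Prod>i<Suc k. W i $$ \<kappa> i))
        = (\<Sum>(y, g)\<in>?D \<times> ({..<k} \<rightarrow>\<^sub>E ?D). c' (g(k := y)) * (\<Prod>i<Suc k. W i $$ (g(k := y)) i))"
      unfolding lessThan_Suc PiE_insert_eq
      by (subst sum.reindex[OF inj]) (simp add: comp_def case_prod_unfold)
    also have "\<dots> = (\<Sum>(y, g)\<in>?D \<times> ({..<k} \<rightarrow>\<^sub>E ?D).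
        c (fst y) g * (\<Prod>i<k. W i $$ g i) * (W k $$ y * Y k $$ (snd y, q)))"
    proof (intro sum.cong refl, clarify)
      fix r t g assume g: "g \<in> {..<k} \<rightarrow>\<^sub>E ?D"
      have "restrict (g(k := (r, t))) {..<k} = g"
        using g by (auto simp: fun_eq_iff PiE_def extensional_def)
      moreover have "(\<Prod>i<k. W i $$ (g(k := (r, t))) i) = (\<Prod>i<k. W i $$ g i)"
        by (intro prod.cong) auto
      ultimately show "c' (g(k := (r, t))) * (\<Prod>i<Suc k. W i $$ (g(k := (r, t))) i) =
          c (fst (r, t)) g * (\<Prod>i<k. W i $$ g i) * (W k $$ (r, t) * Y k $$ (snd (r, t), q))"
        by (simp add: c'_def mult_ac)
    qed
    also have "\<dots> = (\<Sum>y\<in>?D. (\<Sum>g\<in>{..<k} \<rightarrow>\<^sub>E ?D. c (fst y) g * (\<Prod>i<k. W i $$ g i)) * (W k $$ y * Y k $$ (snd y, q)))"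
      by (subst sum.cartesian_product[symmetric]) (simp add: sum_distrib_right)
    also have "\<dots> = (\<Sum>y\<in>?D. alternating_word n W Y k $$ (p, fst y) * (W k $$ y * Y k $$ (snd y, q)))"
      using W by (intro sum.cong) (auto simp: c)
    also have "\<dots> = (\<Sum>r<n. alternating_word n W Y k $$ (p, r) * (\<Sum>t<n. W k $$ (r, t) * Y k $$ (t, q)))"
      by (subst sum.cartesian_product') (simp add: sum_distrib_left)
    also have "\<dots> = alternating_word n W Y (Suc k) $$ (p, q)"
      using carrier_matD[OF Wk(1)] carrier_matD[OF Wk(2)] carrier_matD[OF A] Suc.prems(2,3)
      by (simp add: scalar_prod_def lessThan_atLeast0 index_mult_mat)
    finally show ?thesis by simp
  qed
  then show ?case by blast
qed

text \<open>The separators e(i, i + 1) force the path 0, 1, ..., k + 1 through the indices, and the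
  idempotent in place i survives only if its index is i. So a single permutation contributes to the
  Capelli polynomial.\<close>

lemma alternating_word_units:
  assumes "k < n"
  shows "alternating_word n (\<lambda>i. unit_mat n (\<sigma> i) (\<sigma> i)) (\<lambda>i. unit_mat n i (Suc i)) (Suc k)
    = (if \<forall>i\<le>k. \<sigma> i = i then unit_mat n 0 (Suc k) else 0\<^sub>m n n :: 'r::semiring_1 mat)"
proof -
  have f: "unit_mat n (\<sigma> i) (\<sigma> i) * unit_mat n i (Suc i) = (if \<sigma> i = i then unit_mat n i (Suc i) else 0\<^sub>m n n :: 'r mat)"
    if "i < n" for i
  proof (cases "\<sigma> i < n")
    case True
    then show ?thesis by (simp add: unit_mat_mult)
  next
    case False
    then have "unit_mat n (\<sigma> i) (\<sigma> i) = (0\<^sub>m n n :: 'r mat)" by (intro eq_matI) (auto simp: unit_mat_def)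
    then show ?thesis using False that by (auto simp: left_mult_zero_mat[of _ n n])
  qed
  show ?thesis
    using assms
  proof (induction k)
    case 0
    then show ?case by (simp add: f left_mult_one_mat[of _ n n])
  next
    case (Suc k)
    define A where "A \<longleftrightarrow> (\<forall>i\<le>k. \<sigma> i = i)"
    have s: "(\<forall>i\<le>Suc k. \<sigma> i = i) \<longleftrightarrow> A \<and> \<sigma> (Suc k) = Suc k"
      by (auto simp: le_Suc_eq A_def)
    have "alternating_word n (\<lambda>i. unit_mat n (\<sigma> i) (\<sigma> i)) (\<lambda>i. unit_mat n i (Suc i)) (Suc (Suc k))
      = (if A then unit_mat n 0 (Suc k) else 0\<^sub>m n n)
        * (if \<sigma> (Suc k) = Suc k then unit_mat n (Suc k) (Suc (Suc k)) else 0\<^sub>m n n :: 'r mat)"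
      using Suc.prems
      by (simp only: alternating_word.simps(2)[of _ _ _ "Suc k"] f Suc.IH[folded A_def] Suc_lessD)
    then show ?case
      unfolding s using Suc.prems
      by (cases A; cases "\<sigma> (Suc k) = Suc k")
        (simp_all add: unit_mat_mult left_mult_zero_mat[of _ n n] right_mult_zero_mat[of _ n n] del: alternating_word.simps)
  qed
qed

text \<open>A Capelli identity: an expression alternating in \<open>d\<^sup>2 + 1\<close> matrices of size \<open>d\<close> over a
  commutative ring vanishes, because their entries only have \<open>d\<^sup>2\<close> positions.\<close>

lemma linked_unit_mat:
  fixes L :: "('r::comm_ring_1 mat \<times> 'k::comm_ring_1 mat) set"
  assumes L: "L \<subseteq> carrier_mat d d \<times> carrier_mat s s"
    and one: "(1\<^sub>m d, 1\<^sub>m s) \<in> L"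
    and add: "\<And>a b a' b'. (a, b) \<in> L \<Longrightarrow> (a', b') \<in> L \<Longrightarrow> (a + a', b + b') \<in> L"
    and mult: "\<And>a b a' b'. (a, b) \<in> L \<Longrightarrow> (a', b') \<in> L \<Longrightarrow> (a * a', b * b') \<in> L"
    and neg: "\<And>a b. (a, b) \<in> L \<Longrightarrow> (- a, - b) \<in> L"
    and onto: "\<And>b. b \<in> carrier_mat s s \<Longrightarrow> \<exists>a. (a, b) \<in> L"
    and s: "d * d + 1 < s"
  shows "(0\<^sub>m d d, unit_mat s 0 (d * d + 1)) \<in> L"
proof -
  \<comment> \<open>One more than the number of entry positions of a \<open>d\<close> by
    \<open>d\<close> matrix.\<close>
  define N where "N = d * d + 1"
  have "\<forall>i. \<exists>a. (a, unit_mat s i i) \<in> L" "\<forall>i. \<exists>y. (y, unit_mat s i (Suc i)) \<in> L"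
    using onto by simp_all
  from choice[OF this(1)] choice[OF this(2)] obtain a y
    where a: "\<And>i. (a i, unit_mat s i i) \<in> L" and y: "\<And>i. (y i, unit_mat s i (Suc i)) \<in> L" by blast
  have ac: "a i \<in> carrier_mat d d" "y i \<in> carrier_mat d d" for i using a y L by blast+
  define P where "P = {\<sigma>. \<sigma> permutes {0..<N}}"
  have finP: "finite P" by (simp add: P_def finite_permutations)
  define TA where "TA \<sigma> = alternating_word d (\<lambda>i. a (\<sigma> i)) y N" for \<sigma>
  define TB :: "(nat \<Rightarrow> nat) \<Rightarrow> 'k mat"
    where "TB \<sigma> = alternating_word s (\<lambda>i. unit_mat s (\<sigma> i) (\<sigma> i)) (\<lambda>i. unit_mat s i (Suc i)) N" for \<sigma>
  have T: "(alternating_word d (\<lambda>i. a (\<sigma> i)) y k,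
      alternating_word s (\<lambda>i. unit_mat s (\<sigma> i) (\<sigma> i)) (\<lambda>i. unit_mat s i (Suc i)) k) \<in> L" for \<sigma> k
    by (induction k) (auto intro: one mult a y)
  have TL: "(TA \<sigma>, TB \<sigma>) \<in> L" for \<sigma> unfolding TA_def TB_def by (rule T)
  have Tc: "TA \<sigma> \<in> carrier_mat d d" "TB \<sigma> \<in> carrier_mat s s" for \<sigma> using TL L by blast+
  have zero: "(0\<^sub>m d d, 0\<^sub>m s s) \<in> L"
  proof -
    have "1\<^sub>m d + - 1\<^sub>m d = (0\<^sub>m d d :: 'r mat)" "1\<^sub>m s + - 1\<^sub>m s = (0\<^sub>m s s :: 'k mat)"
      by (auto intro!: eq_matI)
    then show ?thesis using add[OF one neg[OF one]] by simp
  qed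
  \<comment> \<open>The Capelli sums of both sides. Their coefficients are signs, so addition and
    negation in \<open>L\<close> keep the pair inside \<open>L\<close>.\<close>
  define SA where "SA F = mat d d (\<lambda>ij. \<Sum>\<sigma>\<in>F. signof \<sigma> * TA \<sigma> $$ ij)" for F
  define SB where "SB F = mat s s (\<lambda>ij. \<Sum>\<sigma>\<in>F. signof \<sigma> * TB \<sigma> $$ ij)" for F
  have "(SA F, SB F) \<in> L" if "finite F" for F
    using that
  proof (induction F)
    case empty
    have "SA {} = 0\<^sub>m d d" "SB {} = 0\<^sub>m s s" by (auto simp: SA_def SB_def)
    then show ?case using zero by simp
  next
    case (insert \<sigma> F)
    consider "signof \<sigma> = (1::'r)" "signof \<sigma> = (1::'k)" | "signof \<sigma> = (-1::'r)" "signof \<sigma> = (-1::'k)"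
      by (cases "sign \<sigma> = 1") (auto simp: sign_def split: if_splits)
    then show ?case
    proof cases
      case 1
      have "SA (insert \<sigma> F) = TA \<sigma> + SA F" "SB (insert \<sigma> F) = TB \<sigma> + SB F"
        using insert.hyps 1 Tc[of \<sigma>] by (auto simp: SA_def SB_def intro!: eq_matI)
      then show ?thesis using add[OF TL insert.IH] by simp
    next
      case 2
      have "SA (insert \<sigma> F) = - TA \<sigma> + SA F" "SB (insert \<sigma> F) = - TB \<sigma> + SB F"
        using insert.hyps 2 Tc[of \<sigma>] by (auto simp: SA_def SB_def intro!: eq_matI)
      then show ?thesis using add[OF neg[OF TL] insert.IH] by simp
    qed
  qed
  then have SL: "(SA P, SB P) \<in> L" using finP .
  have "SA P = 0\<^sub>m d d"
  proof (rule eq_matI)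
    fix p q assume "p < dim_row (0\<^sub>m d d :: 'r mat)" "q < dim_col (0\<^sub>m d d :: 'r mat)"
    then have pq: "p < d" "q < d" by auto
    obtain c where c: "\<And>W. (\<forall>i<N. W i \<in> carrier_mat d d) \<Longrightarrow> alternating_word d W y N $$ (p, q) =
        (\<Sum>\<kappa>\<in>{..<N} \<rightarrow>\<^sub>E {..<d} \<times> {..<d}. c \<kappa> * (\<Prod>i<N. W i $$ \<kappa> i))"
      using alternating_word_expand[of N y d p q] ac pq by blast
    have z: "(\<Sum>\<sigma>\<in>P. signof \<sigma> * (\<Prod>i<N. a (\<sigma> i) $$ \<kappa> i)) = 0"
      if \<kappa>: "\<kappa> \<in> {..<N} \<rightarrow>\<^sub>E {..<d} \<times> {..<d}" for \<kappa>
    proof -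
      \<comment> \<open>Pigeonhole: two factors use the same position, so the signed sum is a
        determinant with two equal rows.\<close>
      have "\<not> inj_on \<kappa> {..<N}"
        using card_inj_on_le[of \<kappa> "{..<N}" "{..<d} \<times> {..<d}"] \<kappa> by (auto simp: N_def)
      then obtain i j where ij: "i < N" "j < N" "i \<noteq> j" "\<kappa> i = \<kappa> j" by (auto simp: inj_on_def)
      define M where "M = mat N N (\<lambda>(i, j). a j $$ \<kappa> i)"
      have "det M = 0"
        by (rule Determinant.det_identical_rows[of _ N i j]) (use ij in \<open>auto simp: M_def row_def\<close>)
      moreover have "det M = (\<Sum>\<sigma>\<in>P. signof \<sigma> * (\<Prod>i<N. a (\<sigma> i) $$ \<kappa> i))"
        unfolding Determinant.det_def P_def
        by (auto simp: M_def lessThan_atLeast0 permutes_in_image[of _ "{0..<N}", simplified] intro!: sum.cong prod.cong)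
      ultimately show ?thesis by simp
    qed
    have "SA P $$ (p, q) = (\<Sum>\<sigma>\<in>P. signof \<sigma> * (\<Sum>\<kappa>\<in>{..<N} \<rightarrow>\<^sub>E {..<d} \<times> {..<d}. c \<kappa> * (\<Prod>i<N. a (\<sigma> i) $$ \<kappa> i)))"
      using pq c ac by (simp add: SA_def TA_def)
    also have "\<dots> = (\<Sum>\<kappa>\<in>{..<N} \<rightarrow>\<^sub>E {..<d} \<times> {..<d}. c \<kappa> * (\<Sum>\<sigma>\<in>P. signof \<sigma> * (\<Prod>i<N. a (\<sigma> i) $$ \<kappa> i)))"
      unfolding sum_distrib_left by (subst sum.swap) (simp add: mult_ac)
    also have "\<dots> = 0" by (intro sum.neutral) (simp add: z)
    finally show "SA P $$ (p, q) = 0\<^sub>m d d $$ (p, q)" using pq by simp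
  qed (simp_all add: SA_def)
  \<comment> \<open>On this side only the identity permutation survives, with sign 1.\<close>
  moreover have "SB P = unit_mat s 0 N"
  proof -
    have "TB \<sigma> = (if \<sigma> = id then unit_mat s 0 N else 0\<^sub>m s s)" if "\<sigma> \<in> P" for \<sigma>
    proof -
      have "(\<forall>i\<le>d * d. \<sigma> i = i) \<longleftrightarrow> \<sigma> = id"
      proof
        assume "\<forall>i\<le>d * d. \<sigma> i = i"
        then have "\<sigma> i = i" for i
          using that permutes_not_in[of \<sigma> "{0..<N}" i] by (cases "i < N") (auto simp: P_def N_def)
        then show "\<sigma> = id" by auto
      qed simp
      then show ?thesis using alternating_word_units[of "d * d" s \<sigma>] s
        by (simp only: TB_def N_def Suc_eq_plus1[symmetric]) auto
    qed
    then have "(\<Sum>\<sigma>\<in>P. signof \<sigma> * TB \<sigma> $$ ij) = (\<Sum>\<sigma>\<in>P. if \<sigma> = id then unit_mat s 0 N $$ ij else 0)"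
      if "ij \<in> {..<s} \<times> {..<s}" for ij
      using that by (intro sum.cong) (auto simp: sign_id)
    moreover have "id \<in> P" by (simp add: P_def permutes_id)
    ultimately show ?thesis using finP
      by (intro eq_matI) (auto simp: SB_def unit_mat_def)
  qed
  ultimately show ?thesis using SL by (simp add: N_def)
qed

section \<open>Generation of the full matrix algebra\<close>

definition subalgebra :: "nat \<Rightarrow> complex mat set \<Rightarrow> bool" where
  "subalgebra n B \<longleftrightarrow> B \<subseteq> carrier_mat n n \<and> 1\<^sub>m n \<in> B \<and>
     (\<forall>A\<in>B. \<forall>A'\<in>B. A + A' \<in> B \<and> A * A' \<in> B) \<and> (\<forall>z. \<forall>A\<in>B. z \<cdot>\<^sub>m A \<in> B)"

definition generating :: "nat \<Rightarrow> complex mat set \<Rightarrow> bool" where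
  "generating n F \<longleftrightarrow> (\<forall>B. subalgebra n B \<longrightarrow> F \<subseteq> B \<longrightarrow> carrier_mat n n \<subseteq> B)"

text \<open>The second components of \<open>L\<close> form a subalgebra that contains
  \<open>F\<close>, hence every \<open>s\<close> by \<open>s\<close> matrix has a partner and the
  Capelli identity applies. In the applications, a link between 0 and a matrix unit is the source of
  the contradiction.\<close>

lemma linked_generating:
  fixes L :: "('r::comm_ring_1 mat \<times> complex mat) set"
  assumes L: "L \<subseteq> carrier_mat d d \<times> carrier_mat s s"
    and one: "(1\<^sub>m d, 1\<^sub>m s) \<in> L"
    and add: "\<And>a b a' b'. (a, b) \<in> L \<Longrightarrow> (a', b') \<in> L \<Longrightarrow> (a + a', b + b') \<in> L"
    and mult: "\<And>a b a' b'. (a, b) \<in> L \<Longrightarrow> (a', b') \<in> L \<Longrightarrow> (a * a', b * b') \<in> L"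
    and neg: "\<And>a b. (a, b) \<in> L \<Longrightarrow> (- a, - b) \<in> L"
    and smult: "\<And>a b z. (a, b) \<in> L \<Longrightarrow> \<exists>a'. (a', z \<cdot>\<^sub>m b) \<in> L"
    and gen: "generating s F" "\<And>b. b \<in> F \<Longrightarrow> \<exists>a. (a, b) \<in> L"
    and s: "d * d + 1 < s"
  shows "(0\<^sub>m d d, unit_mat s 0 (d * d + 1)) \<in> L"
proof (rule linked_unit_mat[OF L one add mult neg _ s])
  have "subalgebra s (snd ` L)"
    unfolding subalgebra_def
  proof (intro conjI ballI allI)
    show "snd ` L \<subseteq> carrier_mat s s" using L by auto
    show "1\<^sub>m s \<in> snd ` L" using one by (rule rev_image_eqI) simp
    fix A assume "A \<in> snd ` L"
    then obtain a where a: "(a, A) \<in> L" by auto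
    show "z \<cdot>\<^sub>m A \<in> snd ` L" for z using smult[OF a, of z] by (auto intro: rev_image_eqI)
    fix A' assume "A' \<in> snd ` L"
    then obtain a' where a': "(a', A') \<in> L" by auto
    show "A + A' \<in> snd ` L" using add[OF a a'] by (rule rev_image_eqI) simp
    show "A * A' \<in> snd ` L" using mult[OF a a'] by (rule rev_image_eqI) simp
  qed
  moreover have "F \<subseteq> snd ` L"
  proof
    fix b assume "b \<in> F"
    with gen(2) obtain a where "(a, b) \<in> L" by blast
    then show "b \<in> snd ` L" by (rule rev_image_eqI) simp
  qed
  ultimately have "carrier_mat s s \<subseteq> snd ` L" using gen(1) unfolding generating_def by blast
  then show "\<exists>a. (a, b) \<in> L" if "b \<in> carrier_mat s s" for b
    using subsetD[OF _ that, of "snd ` L"] by auto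
qed

abbreviation entries :: "'b mat \<Rightarrow> nat \<Rightarrow> nat \<Rightarrow> 'b" where
  "entries M \<equiv> \<lambda>i j. M $$ (i, j)"

lemma mat_adjoint_index:
  "i < dim_col A \<Longrightarrow> j < dim_row A \<Longrightarrow> mat_adjoint A $$ (i, j) = conjugate (A $$ (j, i))"
  by (simp add: mat_adjoint_def mat_of_rows_def)

section \<open>Rigid points of the free polyhedron\<close>

lemma mat_adjoint_dim [simp]: "dim_row (mat_adjoint A) = dim_col A" "dim_col (mat_adjoint A) = dim_row A"
  by (simp_all add: mat_adjoint_def)

section \<open>Hermitian and positive semidefinite matrices in coordinates\<close>

lemma Her_iff:
  "A \<in> Her n \<longleftrightarrow> A \<in> carrier_mat n n \<and> (\<forall>i<n. \<forall>j<n. A $$ (j, i) = cnj (A $$ (i, j)))"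
proof
  assume "A \<in> Her n"
  then have A: "A \<in> carrier_mat n n" "mat_adjoint A = A" by (auto simp: Her_def)
  have "A $$ (j, i) = cnj (A $$ (i, j))" if "i < n" "j < n" for i j
    using mat_adjoint_index[of j A i] A that by simp
  then show "A \<in> carrier_mat n n \<and> (\<forall>i<n. \<forall>j<n. A $$ (j, i) = cnj (A $$ (i, j)))" using A by blast
next
  assume A: "A \<in> carrier_mat n n \<and> (\<forall>i<n. \<forall>j<n. A $$ (j, i) = cnj (A $$ (i, j)))"
  then have c: "A \<in> carrier_mat n n" by blast
  have "mat_adjoint A = A"
  proof (rule eq_matI)
    fix i j assume "i < dim_row A" "j < dim_col A"
    then have ij: "i < n" "j < n" using carrier_matD[OF c] by simp_all
    then have "A $$ (i, j) = cnj (A $$ (j, i))" using A by blast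
    then show "mat_adjoint A $$ (i, j) = A $$ (i, j)"
      using mat_adjoint_index[of i A j] ij carrier_matD[OF c] by simp
  qed (use carrier_matD[OF c] in simp_all)
  then show "A \<in> Her n" using c by (simp add: Her_def)
qed

lemma mult_vec_cscalar:
  assumes "A \<in> carrier_mat n n"
  shows "(A *\<^sub>v vec n v) \<bullet>c vec n v = quad_form n (entries A) (v :: nat \<Rightarrow> complex)"
  using assms
  by (simp add: scalar_prod_def quad_form_def lessThan_atLeast0 sum_distrib_right sum_distrib_left mult_ac)

lemma psd_iff:
  "psd n A \<longleftrightarrow> A \<in> Her n \<and> (\<forall>v. 0 \<le> quad_form n (entries A) v)"
proof -
  have "v = vec n (($) v)" if "v \<in> carrier_vec n" for v :: "complex vec" using that by auto
  then show ?thesis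
    unfolding psd_def
    by (metis (no_types, lifting) Her_iff mult_vec_cscalar vec_carrier)
qed

text \<open>Along a real line the form is a quadratic polynomial in t; its sign yields both the
  kernel lemma and the Cauchy-Schwarz estimates.\<close>

lemma quad_form_add_scaled:
  fixes M :: "nat \<Rightarrow> nat \<Rightarrow> complex"
  assumes "\<And>i j. i < n \<Longrightarrow> j < n \<Longrightarrow> M j i = cnj (M i j)"
  shows "quad_form n M (\<lambda>i. v i + of_real t * w i) = quad_form n M v
    + of_real (2 * t * Re (\<Sum>i<n. cnj (w i) * (\<Sum>j<n. M i j * v j))) + of_real (t\<^sup>2) * quad_form n M w"
proof -
  define S where "S = (\<Sum>i<n. \<Sum>j<n. cnj (w i) * M i j * v j)"
  define S' where "S' = (\<Sum>i<n. \<Sum>j<n. cnj (v i) * M i j * w j)"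
  have "cnj S = (\<Sum>i<n. \<Sum>j<n. cnj (v j) * M j i * w i)"
    unfolding S_def cnj_sum by (intro sum.cong refl) (simp add: assms[symmetric] mult_ac)
  also have "\<dots> = S'" unfolding S'_def by (rule sum.swap)
  finally have S: "S' = cnj S" ..
  have "quad_form n M (\<lambda>i. v i + of_real t * w i) = quad_form n M v + of_real t * (S + S')
      + of_real (t\<^sup>2) * quad_form n M w"
    unfolding S_def S'_def
    by (simp add: quad_form_def algebra_simps sum.distrib sum_distrib_left power2_eq_square)
  moreover have "S + cnj S = of_real (2 * Re S)" by (simp add: complex_eq_iff)
  ultimately have "quad_form n M (\<lambda>i. v i + of_real t * w i) = quad_form n M v + of_real t * of_real (2 * Re S)
      + of_real (t\<^sup>2) * quad_form n M w" by (simp only: S)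
  moreover have "S = (\<Sum>i<n. cnj (w i) * (\<Sum>j<n. M i j * v j))"
    by (simp add: S_def sum_distrib_left mult.assoc)
  ultimately show ?thesis by simp
qed

text \<open>For r = A v the form at v + t r equals 2 t R + t^2 Q, where R is the squared norm of r
  and Q the form at r. It is nonnegative for every real t, which forces R = 0.\<close>

lemma psd_kernel:
  assumes "psd n A" "quad_form n (entries A) v = 0" "i < n"
  shows "(\<Sum>j<n. A $$ (i, j) * v j) = 0"
proof -
  define r where "r i = (\<Sum>j<n. A $$ (i, j) * v j)" for i
  define R where "R = (\<Sum>i<n. (cmod (r i))\<^sup>2)"
  have A: "A \<in> Her n" and pos: "\<And>v. 0 \<le> quad_form n (entries A) v" using assms(1) by (auto simp: psd_iff)
  have herm: "\<And>i j. i < n \<Longrightarrow> j < n \<Longrightarrow> A $$ (j, i) = cnj (A $$ (i, j))"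
    using A unfolding Her_iff by blast
  have rr: "Re (\<Sum>i<n. cnj (r i) * r i) = R"
    unfolding R_def Re_sum by (intro sum.cong refl) (simp only: cmod_power2, simp add: power2_eq_square)
  define Q where "Q = Re (quad_form n (entries A) r)"
  have ineq: "0 \<le> 2 * t * R + t\<^sup>2 * Q" for t
  proof -
    have "0 \<le> Re (quad_form n (entries A) (\<lambda>i. v i + of_real t * r i))"
      using pos by (simp add: less_eq_complex_def)
    then show ?thesis
      using quad_form_add_scaled[where n=n and M="entries A" and v=v and w=r and t=t, OF herm] assms(2)
      unfolding r_def[symmetric] rr by (simp add: Q_def)
  qed
  have "Q \<ge> 0" using pos[of r] by (simp add: Q_def less_eq_complex_def)
  have "R \<ge> 0" by (simp add: R_def sum_nonneg)
  have "R = 0"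
  proof (rule ccontr)
    assume "R \<noteq> 0"
    then have "R > 0" using \<open>R \<ge> 0\<close> by simp
    \<comment> \<open>Small enough that s Q \<le> R, with Q + 1 to allow Q = 0; at t = - s the
      linear term wins.\<close>
    define s where "s = R / (Q + 1)"
    have "s > 0" "s * Q \<le> R" using \<open>Q \<ge> 0\<close> \<open>R > 0\<close> by (auto simp: s_def field_simps)
    have "0 \<le> s * (s * Q - 2 * R)" using ineq[of "- s"] by (simp add: algebra_simps power2_eq_square)
    then have "0 \<le> s * Q - 2 * R" using \<open>s > 0\<close> by (simp add: zero_le_mult_iff)
    then show False using \<open>s * Q \<le> R\<close> \<open>R > 0\<close> by simp
  qed
  then show ?thesis using assms(3)
    by (simp add: R_def sum_nonneg_eq_0_iff flip: r_def)
qed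

lemma eval_at_dim [simp]: "dim_row (eval_at X c) = dim_row X" "dim_col (eval_at X c) = dim_col X"
  by (simp_all add: eval_at_def)

lemma eval_at_index:
  "i < dim_row X \<Longrightarrow> j < dim_col X \<Longrightarrow> eval_at X c $$ (i, j) =
     Complex (blinfun_apply (fst (X $$ (i, j))) c) (blinfun_apply (snd (X $$ (i, j))) c)"
  by (simp add: eval_at_def)

lemma linear_Complex_blinfun:
  "linear (\<lambda>c. Complex (blinfun_apply x c) (blinfun_apply y c))"
  by (rule linearI) (simp_all add: blinfun.add_right blinfun.scaleR_right complex_eq_iff)

lemma linear_eval_at:
  "i < dim_row X \<Longrightarrow> j < dim_col X \<Longrightarrow> linear (\<lambda>c. eval_at X c $$ (i, j))"
  by (simp add: eval_at_index linear_Complex_blinfun)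

lemma Complex_blinfun_sum:
  fixes f :: "nat \<Rightarrow> 'a::real_normed_vector dual cplx"
  shows "Complex (blinfun_apply (fst (\<Sum>x\<in>S. f x)) c) (blinfun_apply (snd (\<Sum>x\<in>S. f x)) c)
      = (\<Sum>x\<in>S. Complex (blinfun_apply (fst (f x)) c) (blinfun_apply (snd (f x)) c))"
  by (induction S rule: infinite_finite_induct)
    (auto simp: blinfun.add_left zero_complex.ctr complex_eq_iff)

lemma eval_at_mat_sum:
  assumes "\<And>k. k < n \<Longrightarrow> F k \<in> carrier_mat s s" "i < s" "j < s"
  shows "eval_at (mat_sum s n F) c $$ (i, j) = (\<Sum>k<n. eval_at (F k) c $$ (i, j))"
proof -
  have "eval_at (mat_sum s n F) c $$ (i, j)
      = (\<Sum>k<n. Complex (blinfun_apply (fst (F k $$ (i, j))) c) (blinfun_apply (snd (F k $$ (i, j))) c))"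
    using assms by (simp add: eval_at_def mat_sum_def Complex_blinfun_sum)
  also have "\<dots> = (\<Sum>k<n. eval_at (F k) c $$ (i, j))"
  proof (intro sum.cong refl)
    fix k assume "k \<in> {..<n}"
    then have "dim_row (F k) = s" "dim_col (F k) = s" using assms(1)[of k] by auto
    then show "Complex (blinfun_apply (fst (F k $$ (i, j))) c) (blinfun_apply (snd (F k $$ (i, j))) c)
      = eval_at (F k) c $$ (i, j)" using assms(2,3) by (simp add: eval_at_index)
  qed
  finally show ?thesis .
qed

text \<open>The family \<open>b\<close> plays the role of a row of \<open>\<beta>\<^sup>*\<close> in a dilation of \<open>X\<close>: positivity of the dilation at
  \<open>c\<close> forces \<open>b c\<close> to vanish on the kernel of \<open>X(c)\<close>.\<close>

definition rigid :: "'a::euclidean_space set \<Rightarrow> 'a \<Rightarrow> nat \<Rightarrow> 'a dual cplx mat \<Rightarrow> bool" where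
  "rigid C u s X \<longleftrightarrow> (\<forall>b :: 'a \<Rightarrow> nat \<Rightarrow> complex.
     (\<forall>i<s. linear (\<lambda>c. b c i)) \<longrightarrow> (\<forall>i<s. b u i = 0) \<longrightarrow>
     (\<forall>c\<in>C. \<forall>\<xi>. (\<forall>i<s. (\<Sum>j<s. eval_at X c $$ (i, j) * \<xi> j) = 0) \<longrightarrow> (\<Sum>i<s. b c i * \<xi> i) = 0) \<longrightarrow>
     (\<forall>c. \<forall>i<s. b c i = 0))"

lemma rigidD:
  assumes "rigid C u s X"
    and "\<And>i. i < s \<Longrightarrow> linear (\<lambda>c. b c i)" "\<And>i. i < s \<Longrightarrow> b u i = 0"
    and "\<And>c \<xi>. c \<in> C \<Longrightarrow> (\<And>i. i < s \<Longrightarrow> (\<Sum>j<s. eval_at X c $$ (i, j) * \<xi> j) = 0) \<Longrightarrow> (\<Sum>i<s. b c i * \<xi> i) = 0"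
    and "i < s"
  shows "b c i = 0"
  using assms(1)[unfolded rigid_def, THEN spec, of b] assms(2-5) by blast

lemma free_polyhedron_carrier:
  "X \<in> free_polyhedron C u s \<Longrightarrow> X \<in> carrier_mat s s"
  by (auto simp: free_polyhedron_def Her_tensor_def mat_sum_def)

text \<open>For \<xi> in the kernel of X(c) the form of the dilation vanishes at (\<xi>, 0), so the
  dilation kills this vector, and its lower rows give \<beta>* \<xi> = 0. Unitality of the dilation
  gives \<beta>(u) = 0. Rigidity applies to each row of \<beta>* separately.\<close>

lemma rigid_imp_arveson_boundary_point:
  assumes "X \<in> free_polyhedron C u s" "rigid C u s X"
  shows "arveson_boundary_point C u s X"
  unfolding arveson_boundary_point_def
proof (intro conjI assms(1) allI impI ballI)
  fix r \<beta> \<gamma>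
  assume r: "1 \<le> r" and \<beta>: "\<beta> \<in> carrier_mat s r" and \<gamma>: "\<gamma> \<in> carrier_mat r r"
    and Z: "four_block_mat X \<beta> (map_mat cconj (transpose_mat \<beta>)) \<gamma> \<in> free_polyhedron C u (s + r)"
  define Z where "Z = four_block_mat X \<beta> (map_mat cconj (transpose_mat \<beta>)) \<gamma>"
  have X: "X \<in> carrier_mat s s" using assms(1) by (rule free_polyhedron_carrier)
  define b where "b q c i = cnj (eval_at \<beta> c $$ (i, q))" for q c i
  have low: "eval_at Z c $$ (s + q, i) = b q c i" if "q < r" "i < s" for q i c
    using that X \<beta> \<gamma> by (simp add: Z_def b_def eval_at_index cconj_def complex_eq_iff blinfun.minus_left)
  have up: "eval_at Z c $$ (p, i) = eval_at X c $$ (p, i)" if "p < s" "i < s" for p i c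
    using that X \<beta> \<gamma> by (simp add: Z_def eval_at_index)
  have b0: "b q c i = 0" if q: "q < r" and i: "i < s" for q c i
  proof (rule rigidD[OF assms(2), where b="b q", OF _ _ _ i])
    show "linear (\<lambda>c. b q c i)" if "i < s" for i
      unfolding b_def
      using linear_compose[OF linear_eval_at bounded_linear.linear[OF bounded_linear_cnj], of i \<beta> q] that q \<beta>
      by (simp add: comp_def)
    show "b q u i = 0" if "i < s" for i
      using Z low[OF q that, of u] that q by (simp add: free_polyhedron_def Z_def[symmetric])
    fix c \<xi> assume c: "c \<in> C" and \<xi>: "\<And>i. i < s \<Longrightarrow> (\<Sum>j<s. eval_at X c $$ (i, j) * \<xi> j) = 0"
    define v where "v i = (if i < s then \<xi> i else 0)" for i
    have psd: "psd (s + r) (eval_at Z c)" using Z c by (simp add: free_polyhedron_def Z_def)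
    have split: "(\<Sum>j<s + r. f j * v j) = (\<Sum>j<s. f j * \<xi> j)" for f
    proof -
      have "(\<Sum>j<s + r. f j * v j) = (\<Sum>j<s. f j * v j)"
        by (rule sum.mono_neutral_right) (auto simp: v_def)
      then show ?thesis by (simp add: v_def)
    qed
    have "quad_form (s + r) (entries (eval_at Z c)) v = 0"
      unfolding quad_form_def split
    proof (rule sum.neutral, rule ballI)
      fix i assume "i \<in> {..<s + r}"
      show "(\<Sum>j<s. conjugate (v i) * eval_at Z c $$ (i, j) * \<xi> j) = 0"
      proof (cases "i < s")
        case True
        have "(\<Sum>j<s. conjugate (v i) * eval_at Z c $$ (i, j) * \<xi> j)
            = conjugate (v i) * (\<Sum>j<s. eval_at X c $$ (i, j) * \<xi> j)"
          using True by (simp add: up sum_distrib_left mult.assoc)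
        then show ?thesis using True \<xi> by simp
      qed (simp add: v_def)
    qed
    from psd_kernel[OF psd this, of "s + q"] show "(\<Sum>i<s. b q c i * \<xi> i) = 0"
      using q by (simp add: split low)
  qed
  have "\<beta> $$ (i, q) = 0" if "i < s" "q < r" for i q
  proof -
    have "Complex (blinfun_apply (fst (\<beta> $$ (i, q))) c) (blinfun_apply (snd (\<beta> $$ (i, q))) c) = 0" for c
      using b0[OF that(2,1), of c] that \<beta> by (simp add: b_def eval_at_index)
    then have "fst (\<beta> $$ (i, q)) = 0" "snd (\<beta> $$ (i, q)) = 0"
      by (auto intro!: blinfun_eqI simp: complex_eq_iff)
    then show ?thesis by (simp add: prod_eq_iff)
  qed
  then show "\<beta> = 0\<^sub>m s r" using \<beta> by (intro eq_matI) auto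
qed

lemma mult_unit_mat_index:
  assumes "A \<in> carrier_mat m n" "i < n" "p < m" "q < n"
  shows "(A * unit_mat n i j) $$ (p, q) = (if q = j then A $$ (p, i) else 0 :: 'r::semiring_1)"
proof -
  have "(A * unit_mat n i j) $$ (p, q) = (\<Sum>k = 0..<n. A $$ (p, k) * unit_mat n i j $$ (k, q))"
    using assms by (simp add: scalar_prod_def unit_mat_def)
  also have "\<dots> = (\<Sum>k = 0..<n. if k = i then (if q = j then A $$ (p, i) else 0) else 0)"
    using assms by (intro sum.cong) (auto simp: unit_mat_def)
  finally show ?thesis using assms by simp
qed

lemma unit_mat_mult_index:
  assumes "A \<in> carrier_mat n m" "j < n" "p < n" "q < m"
  shows "(unit_mat n i j * A) $$ (p, q) = (if p = i then A $$ (j, q) else 0 :: 'r::semiring_1)"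
proof -
  have "(unit_mat n i j * A) $$ (p, q) = (\<Sum>k = 0..<n. unit_mat n i j $$ (p, k) * A $$ (k, q))"
    using assms by (simp add: scalar_prod_def unit_mat_def)
  also have "\<dots> = (\<Sum>k = 0..<n. if k = j then (if p = i then A $$ (j, q) else 0) else 0)"
    using assms by (intro sum.cong) (auto simp: unit_mat_def)
  finally show ?thesis using assms by simp
qed

text \<open>The matrices commuting with \<open>T\<close> form a subalgebra, so by generation
  \<open>T\<close> commutes with every matrix unit e(i, 0); comparing column 0 shows that
  \<open>T\<close> is scalar.\<close>

lemma generating_imp_irreducible_point:
  assumes X: "X \<in> carrier_mat s s" and s: "0 < s" and gen: "generating s (range (eval_at X))"
  shows "irreducible_point s X"
  unfolding irreducible_point_def
proof (intro ballI impI)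
  fix T assume T: "T \<in> carrier_mat s s" and comm: "\<forall>c. T * eval_at X c = eval_at X c * T"
  define B where "B = {M \<in> carrier_mat s s. T * M = M * T}"
  have "subalgebra s B"
    unfolding subalgebra_def
  proof (intro conjI ballI allI)
    show "B \<subseteq> carrier_mat s s" "1\<^sub>m s \<in> B" using T by (auto simp: B_def)
    fix A assume A: "A \<in> B"
    show "z \<cdot>\<^sub>m A \<in> B" for z
      using A T by (auto simp: B_def mult_smult_distrib[of _ s s _ s] mult_smult_assoc_mat[of _ s s _ s])
    fix A' assume A': "A' \<in> B"
    show "A + A' \<in> B"
      using A A' T by (auto simp: B_def mult_add_distrib_mat[of _ s s _ s] add_mult_distrib_mat[of _ s s _ _ s])
    have AT: "A \<in> carrier_mat s s" "A' \<in> carrier_mat s s" "T * A = A * T" "T * A' = A' * T"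
      using A A' by (auto simp: B_def)
    have "T * (A * A') = A * T * A'"
      using AT T by (simp flip: assoc_mult_mat[of T s s A s A' s])
    also have "\<dots> = A * (A' * T)"
      using AT T by (simp add: assoc_mult_mat[of A s s T s A' s])
    also have "\<dots> = A * A' * T"
      using AT T by (simp add: assoc_mult_mat[of A s s A' s T s])
    finally have "T * (A * A') = A * A' * T" .
    then show "A * A' \<in> B" using A A' by (auto simp: B_def)
  qed
  moreover have "range (eval_at X) \<subseteq> B" using comm X by (auto simp: B_def)
  ultimately have all: "T * M = M * T" if "M \<in> carrier_mat s s" for M
    using gen that unfolding generating_def B_def by blast
  have "T $$ (p, i) = (if p = i then T $$ (0, 0) else 0)" if "p < s" "i < s" for p i
  proof -
    have "(T * unit_mat s i 0) $$ (p, 0) = T $$ (p, i)"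
      using mult_unit_mat_index[OF T, of i p 0 0] s that by simp
    moreover have "(unit_mat s i 0 * T) $$ (p, 0) = (if p = i then T $$ (0, 0) else 0)"
      using unit_mat_mult_index[OF T, of 0 p 0 i] s that by simp
    ultimately show ?thesis using all[OF unit_mat_carrier, of i 0] by simp
  qed
  note entry = this
  have "T = T $$ (0, 0) \<cdot>\<^sub>m 1\<^sub>m s"
  proof (rule eq_matI)
    fix p i assume "p < dim_row (T $$ (0, 0) \<cdot>\<^sub>m 1\<^sub>m s)" "i < dim_col (T $$ (0, 0) \<cdot>\<^sub>m 1\<^sub>m s)"
    then show "T $$ (p, i) = (T $$ (0, 0) \<cdot>\<^sub>m 1\<^sub>m s) $$ (p, i)"
      using entry[of p i] by simp
  qed (use carrier_matD[OF T] in simp_all)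
  then show "\<exists>z. T = z \<cdot>\<^sub>m 1\<^sub>m s" by blast
qed

lemma quad_form_compress:
  fixes V Y :: "complex mat"
  assumes "V \<in> carrier_mat d s" "Y \<in> carrier_mat d d"
  shows "quad_form s (entries (mat_adjoint V * Y * V)) \<xi> = quad_form d (entries Y) (\<lambda>i. \<Sum>j<s. V $$ (i, j) * \<xi> j)"
proof -
  define F where "F p q b a = cnj (V $$ (a, p) * \<xi> p) * Y $$ (a, b) * (V $$ (b, q) * \<xi> q)" for p q b a
  have "quad_form s (entries (mat_adjoint V * Y * V)) \<xi> = (\<Sum>p<s. \<Sum>q<s. \<Sum>b<d. \<Sum>a<d. F p q b a)"
    using assms
    by (simp add: F_def quad_form_def scalar_prod_def mat_adjoint_index lessThan_atLeast0
        sum_distrib_left sum_distrib_right mult_ac)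
  also have "\<dots> = (\<Sum>p<s. \<Sum>q<s. \<Sum>a<d. \<Sum>b<d. F p q b a)" by (intro sum.cong refl sum.swap)
  also have "\<dots> = (\<Sum>p<s. \<Sum>a<d. \<Sum>q<s. \<Sum>b<d. F p q b a)" by (rule sum.cong[OF refl], rule sum.swap)
  also have "\<dots> = (\<Sum>a<d. \<Sum>p<s. \<Sum>q<s. \<Sum>b<d. F p q b a)" by (rule sum.swap)
  also have "\<dots> = (\<Sum>a<d. \<Sum>p<s. \<Sum>b<d. \<Sum>q<s. F p q b a)"
    by (rule sum.cong[OF refl], rule sum.cong[OF refl], rule sum.swap)
  also have "\<dots> = (\<Sum>a<d. \<Sum>b<d. \<Sum>p<s. \<Sum>q<s. F p q b a)" by (rule sum.cong[OF refl], rule sum.swap)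
  also have "\<dots> = quad_form d (entries Y) (\<lambda>i. \<Sum>j<s. V $$ (i, j) * \<xi> j)"
  proof -
    have "cnj (\<Sum>p<s. \<alpha> p) * y * (\<Sum>q<s. \<beta> q) = (\<Sum>p<s. \<Sum>q<s. cnj (\<alpha> p) * y * \<beta> q)" for \<alpha> \<beta> y
      by (simp only: cnj_sum sum_product sum_distrib_right[where r=y])
    then show ?thesis by (simp only: quad_form_def F_def conjugate_complex_def)
  qed
  finally show ?thesis .
qed

lemma compress_carrier: "V \<in> carrier_mat d s \<Longrightarrow> compress V Y \<in> carrier_mat s s"
  by (simp add: compress_def)

text \<open>The pairs (a, b) with a V = V b satisfy the closure conditions of
  \<open>linked_generating\<close>. The resulting pair of 0 and the unit in position (0, d * d + 1)
  says that column 0 of \<open>V\<close> vanishes.\<close>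

lemma intertwiner_entry_zero:
  fixes V :: "complex mat"
  assumes V: "V \<in> carrier_mat d s" and gen: "generating s F"
    and F: "\<And>b. b \<in> F \<Longrightarrow> b \<in> carrier_mat s s \<and> (\<exists>a\<in>carrier_mat d d. a * V = V * b)"
    and s: "d * d + 1 < s" and i: "i < d"
  shows "V $$ (i, 0) = 0"
proof -
  define L where "L = {(a, b). a \<in> carrier_mat d d \<and> b \<in> carrier_mat s s \<and> a * V = V * b}"
  have LD: "a \<in> carrier_mat d d" "b \<in> carrier_mat s s" "a * V = V * b" if "(a, b) \<in> L" for a b
    using that by (auto simp: L_def)
  have LI: "(a, b) \<in> L" if "a \<in> carrier_mat d d" "b \<in> carrier_mat s s" "a * V = V * b" for a b
    using that by (simp add: L_def)
  have "(0\<^sub>m d d, unit_mat s 0 (d * d + 1)) \<in> L"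
  proof (rule linked_generating[OF _ _ _ _ _ _ gen _ s])
    show "L \<subseteq> carrier_mat d d \<times> carrier_mat s s" by (auto simp: L_def)
    show "(1\<^sub>m d, 1\<^sub>m s) \<in> L" using V by (intro LI) simp_all
    show "\<exists>a. (a, b) \<in> L" if "b \<in> F" for b using F[OF that] by (blast intro: LI)
    fix a b assume "(a, b) \<in> L"
    note ab = LD[OF this]
    show "\<exists>a'. (a', z \<cdot>\<^sub>m b) \<in> L" for z
      by (intro exI[of _ "z \<cdot>\<^sub>m a"] LI)
        (use ab in \<open>simp_all add: mult_smult_distrib[OF V] mult_smult_assoc_mat[OF _ V]\<close>)
    show "(- a, - b) \<in> L"
      by (rule LI) (use ab V in simp_all)
    fix a' b' assume "(a', b') \<in> L"
    note ab' = LD[OF this]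
    show "(a + a', b + b') \<in> L"
      by (rule LI) (use ab ab' in \<open>simp_all add: mult_add_distrib_mat[OF V] add_mult_distrib_mat[OF _ _ V]\<close>)
    have "a * a' * V = a * (V * b')" using ab ab' V by (simp add: assoc_mult_mat[of a d d a' d V s])
    also have "\<dots> = V * b * b'" using ab ab' V by (simp flip: assoc_mult_mat[of a d d V s b' s])
    also have "\<dots> = V * (b * b')" using ab ab' V by (simp add: assoc_mult_mat[of V d s b s b' s])
    finally show "(a * a', b * b') \<in> L"
      by (intro LI) (use ab ab' in simp_all)
  qed
  from LD(3)[OF this] have "V * unit_mat s 0 (d * d + 1) = 0\<^sub>m d s"
    using V by (simp add: left_mult_zero_mat[of _ d s])
  moreover have "(V * unit_mat s 0 (d * d + 1)) $$ (i, d * d + 1) = V $$ (i, 0)"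
    using mult_unit_mat_index[OF V, of 0 i "d * d + 1"] i s by simp
  ultimately show ?thesis using i s by simp
qed

text \<open>If X(c) \<xi> = 0, the forms of the Y_j(c) at V_j \<xi> are nonnegative with sum 0, so
  Y_j(c) V_j \<xi> = 0. Rigidity then makes each V_j an intertwiner, and as d * d + 1 < s its column
  0 is zero, against the sum of the V_j* V_j being the identity.\<close>

lemma not_in_mconv:
  fixes C :: "'a::euclidean_space set"
  assumes X: "X \<in> free_polyhedron C u s" and rig: "rigid C u s X"
    and gen: "generating s (range (eval_at X))" and s: "d * d + 1 < s"
  shows "X \<notin> mconv d (free_polyhedron C u d) s"
proof
  assume "X \<in> mconv d (free_polyhedron C u d) s"
  then obtain n V Y where XVY: "X = mat_sum s n (\<lambda>j. compress (V j) (Y j))"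
    and Y: "\<And>j. j < n \<Longrightarrow> Y j \<in> free_polyhedron C u d" and V: "\<And>j. j < n \<Longrightarrow> V j \<in> carrier_mat d s"
    and VV: "mat_sum s n (\<lambda>j. mat_adjoint (V j) * V j) = 1\<^sub>m s"
    unfolding mconv_def by auto
  have Xc: "X \<in> carrier_mat s s" using X by (rule free_polyhedron_carrier)
  have Yc: "Y j \<in> carrier_mat d d" if "j < n" for j using Y[OF that] by (rule free_polyhedron_carrier)
  have ev: "eval_at X c $$ (p, q) = (\<Sum>j<n. (mat_adjoint (V j) * eval_at (Y j) c * V j) $$ (p, q))"
    if "p < s" "q < s" for c p q
  proof -
    have "eval_at X c $$ (p, q) = (\<Sum>j<n. eval_at (compress (V j) (Y j)) c $$ (p, q))"
      unfolding XVY using V that by (intro eval_at_mat_sum compress_carrier) auto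
    also have "\<dots> = (\<Sum>j<n. (mat_adjoint (V j) * eval_at (Y j) c * V j) $$ (p, q))"
      by (intro sum.cong refl) (simp add: eval_at_compress[OF V Yc])
    finally show ?thesis .
  qed
  have int: "eval_at (Y j) c * V j = V j * eval_at X c" if j: "j < n" for j c
  proof -
    \<comment> \<open>The defect of intertwining; each of its rows is a family to which rigidity
      applies.\<close>
    define b where "b i c q = (eval_at (Y j) c * V j) $$ (i, q) - (V j * eval_at X c) $$ (i, q)" for i c q
    have be: "b i c q = (\<Sum>k<d. eval_at (Y j) c $$ (i, k) * V j $$ (k, q)) - (\<Sum>k<s. V j $$ (i, k) * eval_at X c $$ (k, q))"
      if "i < d" "q < s" for i c q
      using that V[OF j] Yc[OF j] Xc by (simp add: b_def scalar_prod_def lessThan_atLeast0)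
    have b0: "b i c q = 0" if i: "i < d" and q: "q < s" for i c q
    proof (rule rigidD[OF rig, where b="b i", OF _ _ _ q])
      have l1: "linear (\<lambda>c. eval_at (Y j) c $$ (i, k))" if "k < d" for k
        using linear_eval_at[of i "Y j" k] Yc[OF j] i that by simp
      have l2: "linear (\<lambda>c. eval_at X c $$ (k, q))" if "k < s" "q < s" for k q
        using linear_eval_at[of k X q] Xc that by simp
      show "linear (\<lambda>c. b i c q)" if q: "q < s" for q
      proof (rule linearI)
        fix x y :: 'a and t :: real
        show "b i (x + y) q = b i x q + b i y q"
          by (simp add: be[OF i q] linear_add[OF l1] linear_add[OF l2] q sum.distrib algebra_simps)
        show "b i (t *\<^sub>R x) q = t *\<^sub>R b i x q"
          by (simp add: be[OF i q] linear_scale[OF l1] linear_scale[OF l2] q scaleR_sum_right scaleR_right_diff_distrib)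
      qed
      show "b i u q = 0" if q: "q < s" for q
        using Y[OF j] X V[OF j] i q by (simp add: free_polyhedron_def b_def)
      fix c \<xi> assume c: "c \<in> C" and \<xi>: "\<And>i. i < s \<Longrightarrow> (\<Sum>j<s. eval_at X c $$ (i, j) * \<xi> j) = 0"
      define w where "w j i = (\<Sum>q<s. V j $$ (i, q) * \<xi> q)" for j i
      have Ypsd: "psd d (eval_at (Y j) c)" if "j < n" for j
        using Y[OF that] c by (simp add: free_polyhedron_def)
      have "(\<Sum>j<n. quad_form d (entries (eval_at (Y j) c)) (w j)) = quad_form s (entries (eval_at X c)) \<xi>"
      proof -
        have "(\<Sum>j<n. quad_form d (entries (eval_at (Y j) c)) (w j))
            = (\<Sum>j<n. quad_form s (entries (mat_adjoint (V j) * eval_at (Y j) c * V j)) \<xi>)"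
          unfolding w_def
          by (intro sum.cong refl quad_form_compress[symmetric]) (use V Yc in \<open>auto simp: eval_at_def\<close>)
        also have "\<dots> = quad_form s (entries (eval_at X c)) \<xi>"
          unfolding quad_form_def
        proof -
          let ?f = "\<lambda>j p q. conjugate (\<xi> p) * (mat_adjoint (V j) * eval_at (Y j) c * V j) $$ (p, q) * \<xi> q"
          have "(\<Sum>j<n. \<Sum>p<s. \<Sum>q<s. ?f j p q) = (\<Sum>p<s. \<Sum>j<n. \<Sum>q<s. ?f j p q)" by (rule sum.swap)
          also have "\<dots> = (\<Sum>p<s. \<Sum>q<s. \<Sum>j<n. ?f j p q)" by (intro sum.cong refl sum.swap)
          also have "\<dots> = (\<Sum>p<s. \<Sum>q<s. conjugate (\<xi> p) * eval_at X c $$ (p, q) * \<xi> q)"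
            by (simp add: ev sum_distrib_left sum_distrib_right)
          finally show "(\<Sum>j<n. \<Sum>p<s. \<Sum>q<s. ?f j p q) = (\<Sum>p<s. \<Sum>q<s. conjugate (\<xi> p) * eval_at X c $$ (p, q) * \<xi> q)" .
        qed
        finally show ?thesis .
      qed
      also have "\<dots> = (\<Sum>i<s. conjugate (\<xi> i) * (\<Sum>j<s. eval_at X c $$ (i, j) * \<xi> j))"
        by (simp add: quad_form_def sum_distrib_left mult.assoc)
      also have "\<dots> = 0" using \<xi> by simp
      finally have "(\<Sum>j<n. quad_form d (entries (eval_at (Y j) c)) (w j)) = 0" .
      then have "quad_form d (entries (eval_at (Y j) c)) (w j) = 0"
        using Ypsd j by (subst (asm) sum_nonneg_eq_0_iff) (auto simp: psd_iff)
      from psd_kernel[OF Ypsd[OF j] this i]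
      have 1: "(\<Sum>k<d. eval_at (Y j) c $$ (i, k) * w j k) = 0" .
      have "(\<Sum>q<s. b i c q * \<xi> q) = (\<Sum>q<s. \<Sum>k<d. eval_at (Y j) c $$ (i, k) * (V j $$ (k, q) * \<xi> q))
          - (\<Sum>q<s. \<Sum>k<s. V j $$ (i, k) * (eval_at X c $$ (k, q) * \<xi> q))"
        by (simp add: be[OF i] left_diff_distrib sum_subtractf sum_distrib_right mult.assoc)
      also have "\<dots> = (\<Sum>k<d. eval_at (Y j) c $$ (i, k) * w j k)
          - (\<Sum>k<s. V j $$ (i, k) * (\<Sum>q<s. eval_at X c $$ (k, q) * \<xi> q))"
      proof -
        have "(\<Sum>q<s. \<Sum>k<d. eval_at (Y j) c $$ (i, k) * (V j $$ (k, q) * \<xi> q))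
            = (\<Sum>k<d. eval_at (Y j) c $$ (i, k) * w j k)"
          by (subst sum.swap) (simp add: w_def sum_distrib_left)
        moreover have "(\<Sum>q<s. \<Sum>k<s. V j $$ (i, k) * (eval_at X c $$ (k, q) * \<xi> q))
            = (\<Sum>k<s. V j $$ (i, k) * (\<Sum>q<s. eval_at X c $$ (k, q) * \<xi> q))"
          by (subst sum.swap) (simp add: sum_distrib_left)
        ultimately show ?thesis by simp
      qed
      also have "\<dots> = 0" using 1 \<xi> by simp
      finally show "(\<Sum>q<s. b i c q * \<xi> q) = 0" .
    qed
    have "(eval_at (Y j) c * V j) $$ (i, q) = (V j * eval_at X c) $$ (i, q)" if "i < d" "q < s" for i q
      using b0[OF that, of c] by (simp add: b_def)
    then show ?thesis
      using V[OF j] Yc[OF j] Xc by (intro eq_matI) auto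
  qed
  have V0: "V j $$ (i, 0) = 0" if j: "j < n" and i: "i < d" for j i
  proof (rule intertwiner_entry_zero[OF V[OF j] gen _ s i])
    fix b assume "b \<in> range (eval_at X)"
    then obtain c where "b = eval_at X c" by blast
    then show "b \<in> carrier_mat s s \<and> (\<exists>a\<in>carrier_mat d d. a * V j = V j * b)"
      using int[OF j, of c] Yc[OF j] Xc by (intro conjI bexI[of _ "eval_at (Y j) c"]) (simp_all add: eval_at_def)
  qed
  have "mat_sum s n (\<lambda>j. mat_adjoint (V j) * V j) $$ (0, 0) = (\<Sum>j<n. (mat_adjoint (V j) * V j) $$ (0, 0))"
    using s by (simp add: mat_sum_def)
  also have "\<dots> = 0"
  proof (rule sum.neutral, rule ballI)
    fix j assume "j \<in> {..<n}"
    then show "(mat_adjoint (V j) * V j) $$ (0, 0) = 0"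
      using V[of j] V0[of j] s by (simp add: scalar_prod_def)
  qed
  finally show False using VV s by simp
qed

section \<open>Complete order embeddings\<close>

text \<open>Matrices over the algebra become functions of two indices, and vectors functions of one,
  so that they form types of class \<open>real_vector\<close>; \<open>riesz_extension\<close> and
  \<open>linear\<close> then apply to them.\<close>

instantiation "fun" :: (type, real_vector) real_vector
begin

definition "scaleR r f = (\<lambda>x. r *\<^sub>R f x)"

instance
  by standard (simp_all add: scaleR_fun_def fun_eq_iff scaleR_add_right scaleR_add_left)

end

lemma scaleR_fun_apply [simp]: "(r *\<^sub>R f) x = r *\<^sub>R f x"
  by (simp add: scaleR_fun_def)

lemma sum_fun_apply: "(\<Sum>i\<in>A. f i) x = (\<Sum>i\<in>A. f i x)"
  by (induction A rule: infinite_finite_induct) simp_all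

section \<open>Complex-linear extensions and Hermitian tensors\<close>

definition cplx_extend :: "('w \<Rightarrow> 'b) \<Rightarrow> 'w cplx \<Rightarrow> 'b::comm_cstar_algebra" where
  "cplx_extend f p = f (fst p) + scaleC \<i> (f (snd p))"

lemma scaleC_scaleR_commute: "scaleC z (r *\<^sub>R a) = r *\<^sub>R scaleC z (a::'b::comm_cstar_algebra)"
  by (simp add: scaleC_scaleC mult.commute flip: scaleC_of_real)

lemma scaleC_scaleR_left: "scaleC (r *\<^sub>R z) a = r *\<^sub>R scaleC z (a::'b::comm_cstar_algebra)"
  by (simp only: scaleR_conv_of_real[of r z] scaleC_scaleC[symmetric] scaleC_of_real)

lemma scaleC_minus_right: "scaleC z (- a) = - scaleC z (a::'b::comm_cstar_algebra)"
  using scaleC_scaleR_commute[of z "-1" a] by simp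

lemma scaleC_sum_right: "scaleC z (sum f A) = (\<Sum>i\<in>A. scaleC z (f i :: 'b::comm_cstar_algebra))"
proof -
  have "scaleC z (0::'b) = 0" using scaleC_scaleR_commute[of z 0 0] by simp
  then show ?thesis by (induction A rule: infinite_finite_induct) (auto simp: scaleC_add_right)
qed

lemma scaleC_zero_right: "scaleC z (0::'b::comm_cstar_algebra) = 0"
  using scaleC_sum_right[of z _ "{}"] by simp

lemma scaleC_complex [simp]: "scaleC z (a::complex) = z * a"
  by (simp add: scaleC_complex_def)

lemma cplx_extend_linear:
  assumes "linear f"
  shows "cplx_extend f (p + q) = cplx_extend f p + cplx_extend f q"
    "cplx_extend f (r *\<^sub>R p) = r *\<^sub>R cplx_extend f p"
    "cplx_extend f 0 = 0"
  using linear_add[OF assms] linear_scale[OF assms] linear_0[OF assms]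
  by (simp_all add: cplx_extend_def scaleC_add_right scaleC_scaleR_commute scaleR_add_right scaleC_zero_right algebra_simps)

lemma cplx_extend_sum:
  assumes "linear f"
  shows "cplx_extend f (\<Sum>k\<in>A. p k) = (\<Sum>k\<in>A. cplx_extend f (p k))"
  by (induction A rule: infinite_finite_induct) (simp_all add: cplx_extend_linear[OF assms])

lemma cplx_extend_cmult:
  assumes "linear f"
  shows "cplx_extend f (cmult z (w, 0)) = scaleC z (f w)"
proof -
  have "cplx_extend f (cmult z (w, 0)) = scaleC (of_real (Re z)) (f w) + scaleC (\<i> * of_real (Im z)) (f w)"
    by (simp add: cplx_extend_def cmult_def linear_scale[OF assms] scaleC_of_real flip: scaleC_scaleC)
  also have "\<dots> = scaleC z (f w)"
    by (simp only: complex_eq[of z, symmetric] flip: scaleC_add_left)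
  finally show ?thesis .
qed

lemma cplx_extend_cconj:
  fixes f h :: "'w::real_vector \<Rightarrow> 'a::comm_cstar_algebra"
  assumes "linear f" "\<And>x. h x = conjugate (f x)"
  shows "cplx_extend h (cconj p) = conjugate (cplx_extend f p)"
proof -
  have "scaleC (- \<i>) a = - scaleC \<i> a" for a :: 'a
    by (simp add: eq_neg_iff_add_eq_0 scaleC_zero flip: scaleC_add_left)
  then show ?thesis
    by (simp add: cplx_extend_def cconj_def assms(2) linear_neg[OF assms(1)] conjugate_dist_add
        conjugate_scaleC conjugate_neg scaleC_minus_right)
qed

lemma Her_tensor_carrier: "Z \<in> Her_tensor s \<Longrightarrow> Z \<in> carrier_mat s s"
  by (auto simp: Her_tensor_def mat_sum_def)

lemma elem_tensor_index:
  "i < dim_row A \<Longrightarrow> j < dim_col A \<Longrightarrow> (A \<otimes>\<^sub>t w) $$ (i, j) = cmult (A $$ (i, j)) (w, 0)"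
  by (simp add: elem_tensor_def)

lemma Her_tensor_elem: "A \<in> Her s \<Longrightarrow> A \<otimes>\<^sub>t w \<in> Her_tensor s"
proof -
  assume A: "A \<in> Her s"
  then have "dim_row A = s" "dim_col A = s" by (auto simp: Her_def)
  then have "A \<otimes>\<^sub>t w = mat_sum s 1 (\<lambda>_. A \<otimes>\<^sub>t w)"
    by (intro eq_matI) (simp_all add: mat_sum_def elem_tensor_def)
  then show "A \<otimes>\<^sub>t w \<in> Her_tensor s"
    unfolding Her_tensor_def mem_Collect_eq using A
    by (intro exI[of _ 1] exI[of _ "\<lambda>_. A"] exI[of _ "\<lambda>_. w"]) simp
qed

lemma Her_tensor_add:
  assumes "Z \<in> Her_tensor s" "Z' \<in> Her_tensor s"
  shows "Z + Z' \<in> Her_tensor s"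
proof -
  obtain n A w n' A' w' where Z: "Z = mat_sum s n (\<lambda>k. A k \<otimes>\<^sub>t w k)" "\<And>k. k < n \<Longrightarrow> A k \<in> Her s"
    "Z' = mat_sum s n' (\<lambda>k. A' k \<otimes>\<^sub>t w' k)" "\<And>k. k < n' \<Longrightarrow> A' k \<in> Her s"
    using assms unfolding Her_tensor_def by blast
  define B where "B k = (if k < n then A k else A' (k - n))" for k
  define v where "v k = (if k < n then w k else w' (k - n))" for k
  have "(\<Sum>k<n + n'. f k) = (\<Sum>k<n. f k) + (\<Sum>k<n'. f (n + k))" for f :: "nat \<Rightarrow> 'a cplx"
    by (induction n') (simp_all add: add.assoc)
  then have "Z + Z' = mat_sum s (n + n') (\<lambda>k. B k \<otimes>\<^sub>t v k)"
    unfolding Z by (intro eq_matI) (simp_all add: mat_sum_def B_def v_def)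
  moreover have "\<forall>k<n + n'. B k \<in> Her s" using Z by (auto simp: B_def)
  ultimately show ?thesis unfolding Her_tensor_def by blast
qed

lemma Her_tensor_scale:
  assumes "Z \<in> Her_tensor s"
  shows "map_mat (scaleR r) Z \<in> Her_tensor s"
proof -
  obtain n A w where Z: "Z = mat_sum s n (\<lambda>k. A k \<otimes>\<^sub>t w k)" "\<And>k. k < n \<Longrightarrow> A k \<in> Her s"
    using assms unfolding Her_tensor_def by blast
  have A: "dim_row (A k) = s" "dim_col (A k) = s" if "k < n" for k using Z(2)[OF that] by (auto simp: Her_def)
  have "map_mat (scaleR r) Z = mat_sum s n (\<lambda>k. A k \<otimes>\<^sub>t (r *\<^sub>R w k))"
    unfolding Z(1)
    by (rule eq_matI)
      (auto simp: mat_sum_def scaleR_sum_right elem_tensor_def A cmult_def algebra_simps intro!: sum.cong)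
  then show ?thesis using Z(2) unfolding Her_tensor_def mem_Collect_eq
    by (intro exI[of _ n] exI[of _ A] exI[of _ "\<lambda>k. r *\<^sub>R w k"]) simp
qed

lemma Her_tensor_hermitian:
  assumes "Z \<in> Her_tensor s" "i < s" "j < s"
  shows "Z $$ (j, i) = cconj (Z $$ (i, j))"
proof -
  obtain n A w where Z: "Z = mat_sum s n (\<lambda>k. A k \<otimes>\<^sub>t w k)" "\<And>k. k < n \<Longrightarrow> A k \<in> Her s"
    using assms unfolding Her_tensor_def by blast
  have "(A k \<otimes>\<^sub>t w k) $$ (j, i) = cconj ((A k \<otimes>\<^sub>t w k) $$ (i, j))" if k: "k < n" for k
  proof -
    have d: "dim_row (A k) = s" "dim_col (A k) = s" using Z(2)[OF k] by (auto simp: Her_def)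
    have "A k $$ (j, i) = cnj (A k $$ (i, j))" using Z(2)[OF k] assms unfolding Her_iff by blast
    then show ?thesis using d assms by (simp add: elem_tensor_index cmult_def cconj_def)
  qed
  moreover have "(\<Sum>k<n. cconj (f k)) = cconj (\<Sum>k<n. f k)" for f :: "nat \<Rightarrow> 'a cplx"
    by (induction n) (auto simp: cconj_def prod_eq_iff)
  ultimately show ?thesis unfolding Z(1) using assms by (simp add: mat_sum_def)
qed

lemma amplify_index:
  assumes "Z \<in> carrier_mat s s" "p < s * d" "q < s * d"
  shows "amplify d \<Phi> Z $$ (p, q) = cplx_extend (\<lambda>x. \<Phi> x $$ (p mod d, q mod d)) (Z $$ (p div d, q div d))"
  using assms by (simp add: amplify_def cplx_extend_def Let_def)

lemma sos_complex: "0 \<le> (z::complex) \<Longrightarrow> sos z"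
proof -
  assume "0 \<le> z"
  then have "z = conjugate (complex_of_real (sqrt (Re z))) * complex_of_real (sqrt (Re z))"
    by (simp add: less_eq_complex_def complex_eq_iff)
  then show "sos z" using sos_square[of "complex_of_real (sqrt (Re z))"] by argo
qed

lemma linear_eval_at':
  assumes "X \<in> carrier_mat s s" "i < s" "j < s"
  shows "linear (\<lambda>c. eval_at X c $$ (i, j))"
  using linear_eval_at[of i X j] assms by simp

text \<open>The sum is the trace of A times the transpose of B. With A + \<epsilon> = W* W by
  Cholesky it becomes a sum of values of the form of B at the rows of W, up to \<epsilon> times the
  trace of B, and \<epsilon> is arbitrary.\<close>

lemma psd_pairing_nonneg:
  assumes "psd s A" "psd s B"
  shows "0 \<le> Re (\<Sum>i<s. \<Sum>j<s. A $$ (i, j) * B $$ (i, j))"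
proof -
  have "- (\<epsilon> * (\<Sum>i<s. Re (B $$ (i, i)))) \<le> Re (\<Sum>i<s. \<Sum>j<s. A $$ (i, j) * B $$ (i, j))" if \<epsilon>: "\<epsilon> > 0" for \<epsilon>
  proof -
    define M where "M i j = A $$ (i, j) + (if i = j then of_real \<epsilon> else 0)" for i j
    have quad: "quad_form s M v = quad_form s (entries A) v + \<epsilon> *\<^sub>R (\<Sum>i<s. conjugate (v i) * v i)" for v
    proof -
      have "quad_form s M v = (\<Sum>i<s. (\<Sum>j<s. conjugate (v i) * A $$ (i, j) * v j)
          + (\<Sum>j<s. if j = i then of_real \<epsilon> * (conjugate (v i) * v i) else 0))"
        unfolding quad_form_def sum.distrib[symmetric]
        by (intro sum.cong refl) (auto simp: M_def algebra_simps)
      then show ?thesis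
        by (simp add: quad_form_def sum.distrib sum_distrib_left scaleR_conv_of_real)
    qed
    have "\<exists>W. \<forall>i<s. \<forall>j<s. M i j = (\<Sum>k<s. conjugate (W k i) * W k j)"
    proof (rule cholesky[OF _ \<epsilon>])
      show "M j i = conjugate (M i j)" if "i < s" "j < s" for i j
      proof -
        have "A $$ (j, i) = cnj (A $$ (i, j))" using assms(1) that unfolding psd_iff Her_iff by blast
        then show ?thesis by (simp add: M_def)
      qed
      show "sos (quad_form s M v - \<epsilon> *\<^sub>R (\<Sum>i<s. conjugate (v i) * v i))" for v
        using assms(1) sos_complex unfolding quad psd_iff by simp
    qed
    then obtain W where W: "\<And>i j. i < s \<Longrightarrow> j < s \<Longrightarrow> M i j = (\<Sum>k<s. cnj (W k i) * W k j)" by auto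
    have "(\<Sum>i<s. \<Sum>j<s. M i j * B $$ (i, j)) = (\<Sum>i<s. \<Sum>j<s. \<Sum>k<s. cnj (W k i) * B $$ (i, j) * W k j)"
      by (intro sum.cong refl) (simp add: W sum_distrib_right sum_distrib_left mult_ac)
    also have "\<dots> = (\<Sum>i<s. \<Sum>k<s. \<Sum>j<s. cnj (W k i) * B $$ (i, j) * W k j)"
      by (intro sum.cong refl sum.swap)
    also have "\<dots> = (\<Sum>k<s. quad_form s (entries B) (W k))"
      unfolding quad_form_def conjugate_complex_def by (rule sum.swap)
    finally have "0 \<le> Re (\<Sum>i<s. \<Sum>j<s. M i j * B $$ (i, j))"
      using assms(2) by (auto simp: psd_iff less_eq_complex_def intro!: sum_nonneg)
    also have "(\<Sum>i<s. \<Sum>j<s. M i j * B $$ (i, j)) = (\<Sum>i<s. (\<Sum>j<s. A $$ (i, j) * B $$ (i, j))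
        + (\<Sum>j<s. if j = i then of_real \<epsilon> * B $$ (i, i) else 0))"
      unfolding sum.distrib[symmetric] by (intro sum.cong refl) (auto simp: M_def algebra_simps)
    finally show ?thesis by (simp add: sum.distrib sum_distrib_left)
  qed
  note le = this
  define T where "T = \<bar>\<Sum>i<s. Re (B $$ (i, i))\<bar>"
  define R where "R = Re (\<Sum>i<s. \<Sum>j<s. A $$ (i, j) * B $$ (i, j))"
  show ?thesis
  proof (rule ccontr)
    assume "\<not> ?thesis"
    then have "R < 0" by (simp add: R_def)
    \<comment> \<open>For this \<epsilon> the correction stays below the absolute value of
      R.\<close>
    then have "0 < - R / (T + 1)" by (simp add: T_def divide_neg_pos)
    from le[OF this] have "- ((- R / (T + 1)) * T) \<le> R"
      by (smt (verit, ccfv_SIG) R_def T_def \<open>0 < - R / (T + 1)\<close> mult_left_mono)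
    moreover have "(- R / (T + 1)) * T < - R"
      using \<open>R < 0\<close> by (simp add: T_def field_simps)
    ultimately show False by simp
  qed
qed

text \<open>The extended functional is only real-linear, whereas rigidity speaks of complex rows: f
  is the real part of the complex-linear functional with coefficients f(e_i) - i f(i e_i). The
  second hypothesis restricts f to the first \<open>s\<close> coordinates of a function on all
  natural numbers.\<close>

lemma real_linear_functional_complex:
  fixes f :: "(nat \<Rightarrow> complex) \<Rightarrow> real"
  assumes "linear f" "\<And>\<xi> \<eta>. (\<And>i. i < s \<Longrightarrow> \<xi> i = \<eta> i) \<Longrightarrow> f \<xi> = f \<eta>"
  shows "f \<xi> = Re (\<Sum>i<s. Complex (f (\<lambda>j. if j = i then 1 else 0)) (- f (\<lambda>j. if j = i then \<i> else 0)) * \<xi> i)"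
proof -
  define e where "e z i = (\<lambda>j. if j = i then z else (0::complex))" for z and i :: nat
  have "f \<xi> = f (\<Sum>i<s. Re (\<xi> i) *\<^sub>R e 1 i + Im (\<xi> i) *\<^sub>R e \<i> i)"
  proof (rule assms(2))
    fix j assume "j < s"
    have "(\<Sum>i<s. Re (\<xi> i) *\<^sub>R e 1 i + Im (\<xi> i) *\<^sub>R e \<i> i) j
        = (\<Sum>i<s. if i = j then \<xi> j else 0)"
      unfolding sum_fun_apply by (intro sum.cong) (auto simp: e_def complex_eq_iff)
    then show "\<xi> j = (\<Sum>i<s. Re (\<xi> i) *\<^sub>R e 1 i + Im (\<xi> i) *\<^sub>R e \<i> i) j" using \<open>j < s\<close> by simp
  qed
  also have "\<dots> = (\<Sum>i<s. Re (\<xi> i) * f (e 1 i) + Im (\<xi> i) * f (e \<i> i))"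
    by (simp add: linear_sum[OF assms(1)] linear_add[OF assms(1)] linear_scale[OF assms(1)])
  finally show ?thesis by (simp add: e_def mult.commute)
qed


text \<open>The matrix w* Y for Y and w with \<open>d\<close> rows; a positive functional turns it
  into the semi-inner product of the GNS construction.\<close>

definition cross :: "nat \<Rightarrow> (nat \<Rightarrow> nat \<Rightarrow> 'b) \<Rightarrow> (nat \<Rightarrow> nat \<Rightarrow> 'b) \<Rightarrow> nat \<Rightarrow> nat \<Rightarrow> 'b::{conjugate,semiring_0}" where
  "cross d Y w p q = (\<Sum>k<d. conjugate (w k p) * Y k q)"

lemma linear_cross: "linear (\<lambda>Y. cross d Y w :: nat \<Rightarrow> nat \<Rightarrow> 'b::comm_cstar_algebra)"
  by (rule linearI) (simp_all add: cross_def fun_eq_iff algebra_simps sum.distrib scaleR_sum_right)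

text \<open>Positivity of the Hermitian part. The cone thus lives in the full function space, and a
  functional that is nonnegative on it vanishes on matrices with zero Hermitian part and ignores
  entries outside the first \<open>n\<close> indices.\<close>

definition cstar_cone :: "nat \<Rightarrow> (nat \<Rightarrow> nat \<Rightarrow> 'b::comm_cstar_algebra) set" where
  "cstar_cone n = {M. \<forall>v. sos (quad_form n M v + conjugate (quad_form n M v))}"

lemma quad_form_linear:
  fixes M :: "nat \<Rightarrow> nat \<Rightarrow> 'b::comm_cstar_algebra"
  shows "quad_form n (M + M') v = quad_form n M v + quad_form n M' v"
    "quad_form n (M - M') v = quad_form n M v - quad_form n M' v"
    "quad_form n (t *\<^sub>R M) v = t *\<^sub>R quad_form n M v"
  by (simp_all add: quad_form_def algebra_simps sum.distrib sum_subtractf scaleR_sum_right)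

lemma cstar_cone_add: "M \<in> cstar_cone n \<Longrightarrow> M' \<in> cstar_cone n \<Longrightarrow> M + M' \<in> cstar_cone n"
proof -
  assume "M \<in> cstar_cone n" "M' \<in> cstar_cone n"
  note M = this
  have "sos ((quad_form n M v + conjugate (quad_form n M v)) + (quad_form n M' v + conjugate (quad_form n M' v)))" for v
    by (rule sos_add) (use M in \<open>auto simp: cstar_cone_def\<close>)
  then show ?thesis by (simp add: cstar_cone_def quad_form_linear conjugate_dist_add algebra_simps)
qed

lemma cstar_cone_scale:
  assumes "M \<in> cstar_cone n" "0 \<le> t"
  shows "t *\<^sub>R M \<in> cstar_cone n"
proof -
  have "sos (t *\<^sub>R (quad_form n M v + conjugate (quad_form n M v)))" for v
    by (rule sos_scaleR) (use assms in \<open>auto simp: cstar_cone_def\<close>)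
  then show ?thesis by (simp add: cstar_cone_def quad_form_linear conjugate_scaleR scaleR_add_right)
qed

lemma quad_form_cong:
  "(\<And>i j. i < n \<Longrightarrow> j < n \<Longrightarrow> M i j = M' i j) \<Longrightarrow> quad_form n M v = quad_form n M' v"
  by (simp add: quad_form_def)

lemma quad_form_adjoint:
  fixes M :: "nat \<Rightarrow> nat \<Rightarrow> 'b::comm_cstar_algebra"
  shows "quad_form n (\<lambda>i j. conjugate (M j i)) v = conjugate (quad_form n M v)"
proof -
  have "conjugate (quad_form n M v) = (\<Sum>i<n. \<Sum>j<n. v i * conjugate (M i j) * conjugate (v j))"
    by (simp add: quad_form_def sum_conjugate conjugate_dist_mul)
  also have "\<dots> = (\<Sum>j<n. \<Sum>i<n. v i * conjugate (M i j) * conjugate (v j))" by (rule sum.swap)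
  finally show ?thesis by (simp add: quad_form_def mult_ac)
qed

lemma quad_form_cross_self:
  fixes Y :: "nat \<Rightarrow> nat \<Rightarrow> 'b::comm_cstar_algebra"
  shows "quad_form n (cross d Y Y) v = (\<Sum>k<d. conjugate (\<Sum>q<n. Y k q * v q) * (\<Sum>q<n. Y k q * v q))"
proof -
  have "quad_form n (cross d Y Y) v = (\<Sum>p<n. \<Sum>q<n. \<Sum>k<d. conjugate (Y k p * v p) * (Y k q * v q))"
    by (simp add: quad_form_def cross_def sum_distrib_left sum_distrib_right conjugate_dist_mul mult_ac)
  also have "\<dots> = (\<Sum>p<n. \<Sum>k<d. \<Sum>q<n. conjugate (Y k p * v p) * (Y k q * v q))"
    by (intro sum.cong refl sum.swap)
  also have "\<dots> = (\<Sum>k<d. \<Sum>p<n. \<Sum>q<n. conjugate (Y k p * v p) * (Y k q * v q))" by (rule sum.swap)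
  also have "\<dots> = (\<Sum>k<d. conjugate (\<Sum>q<n. Y k q * v q) * (\<Sum>q<n. Y k q * v q))"
    by (simp only: sum_conjugate[OF finite_lessThan] sum_product)
  finally show ?thesis .
qed

lemma cross_self_in_cone: "cross d Y Y \<in> cstar_cone n"
proof -
  have "sos (quad_form n (cross d Y Y) v)" for v
    unfolding quad_form_cross_self by (intro sos_sum sos_square)
  then show ?thesis unfolding cstar_cone_def mem_Collect_eq
    by (intro allI) (simp only: conjugate_sos sos_add)
qed

text \<open>For each pair (i, j), the square of v_i - M_ij v_j plus v_j* (T - M_ij* M_ij) v_j is a
  sum of squares; it equals v_i* v_i + T v_j* v_j minus v_i* M_ij v_j and its conjugate. Summation
  over all pairs bounds \<open>M\<close> by a multiple of the identity.\<close>

lemma cstar_cone_order_unit: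
  fixes M :: "nat \<Rightarrow> nat \<Rightarrow> 'b::comm_cstar_algebra"
  shows "\<exists>t. t *\<^sub>R (\<lambda>i j. if i = j then 1 else 0) - M \<in> cstar_cone n"
proof -
  define T where "T = 1 + (\<Sum>i<n. \<Sum>j<n. (norm (M i j))\<^sup>2)"
  have T: "(norm (M i j))\<^sup>2 < T" if "i < n" "j < n" for i j
  proof -
    have "(norm (M i j))\<^sup>2 \<le> (\<Sum>j<n. (norm (M i j))\<^sup>2)"
      by (rule member_le_sum) (use that in auto)
    also have "\<dots> \<le> (\<Sum>i<n. \<Sum>j<n. (norm (M i j))\<^sup>2)"
      by (rule member_le_sum[of i _ "\<lambda>i. \<Sum>j<n. (norm (M i j))\<^sup>2"]) (use that in \<open>auto intro: sum_nonneg\<close>)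
    finally show ?thesis by (simp add: T_def)
  qed
  \<comment> \<open>Half of the coefficient n + n T found by summation, since the cone adds the form
    and its conjugate.\<close>
  define t where "t = (real n + real n * T) / 2"
  define e :: "nat \<Rightarrow> nat \<Rightarrow> 'b" where "e = (\<lambda>i j. if i = j then 1 else 0)"
  have "sos (quad_form n (t *\<^sub>R e - M) v + conjugate (quad_form n (t *\<^sub>R e - M) v))" for v
  proof -
    define N where "N = (\<Sum>i<n. conjugate (v i) * v i)"
    have qe: "quad_form n e v = N"
    proof -
      have "quad_form n e v = (\<Sum>i<n. \<Sum>j<n. if j = i then conjugate (v i) * v i else 0)"
        unfolding quad_form_def e_def by (intro sum.cong refl) auto
      then show ?thesis by (simp add: N_def)
    qed
    have N: "conjugate N = N" by (simp add: N_def sum_conjugate conjugate_dist_mul mult.commute)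
    have ij: "sos (conjugate (v i) * v i + T *\<^sub>R (conjugate (v j) * v j)
        - (conjugate (v i) * M i j * v j + conjugate (conjugate (v i) * M i j * v j)))"
      if "i < n" "j < n" for i j
    proof -
      have "sos (conjugate (v i - M i j * v j) * (v i - M i j * v j)
          + conjugate (v j) * (T *\<^sub>R 1 - conjugate (M i j) * M i j) * v j)"
        by (intro sos_add sos_square sos_conjugate_mult sos_bound T that)
      also have "conjugate (v i - M i j * v j) * (v i - M i j * v j)
          + conjugate (v j) * (T *\<^sub>R 1 - conjugate (M i j) * M i j) * v j
        = conjugate (v i) * v i + T *\<^sub>R (conjugate (v j) * v j)
        - (conjugate (v i) * M i j * v j + conjugate (conjugate (v i) * M i j * v j))"
        by (simp add: conjugate_diff conjugate_dist_mul algebra_simps)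
      finally show ?thesis .
    qed
    have "sos (\<Sum>i<n. \<Sum>j<n. (conjugate (v i) * v i + T *\<^sub>R (conjugate (v j) * v j)
        - (conjugate (v i) * M i j * v j + conjugate (conjugate (v i) * M i j * v j))))"
      by (intro sos_sum ij) auto
    also have "(\<Sum>i<n. \<Sum>j<n. (conjugate (v i) * v i + T *\<^sub>R (conjugate (v j) * v j)
        - (conjugate (v i) * M i j * v j + conjugate (conjugate (v i) * M i j * v j))))
      = real n *\<^sub>R N + real n *\<^sub>R (T *\<^sub>R N) - (quad_form n M v + conjugate (quad_form n M v))"
      by (simp add: sum.distrib sum_subtractf N_def quad_form_def sum_conjugate scaleR_sum_right sum_constant_scaleR del: sum_constant)
    also have "\<dots> = quad_form n (t *\<^sub>R e - M) v + conjugate (quad_form n (t *\<^sub>R e - M) v)"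
    proof -
      have "t *\<^sub>R N + t *\<^sub>R N = real n *\<^sub>R N + real n *\<^sub>R (T *\<^sub>R N)"
        by (simp add: t_def flip: scaleR_left_distrib)
      then show ?thesis
        by (simp add: quad_form_linear qe conjugate_diff conjugate_scaleR N algebra_simps)
    qed
    finally show ?thesis .
  qed
  then show ?thesis unfolding cstar_cone_def e_def by blast
qed

definition mv :: "nat \<Rightarrow> complex mat \<Rightarrow> (nat \<Rightarrow> complex) \<Rightarrow> nat \<Rightarrow> complex" where
  "mv m A v i = (\<Sum>j<m. A $$ (i, j) * v j)"

section \<open>The embedded system, its amplification and the pairing with X\<close>

locale embedded_system =
  fixes C :: "'a::euclidean_space set" and u :: 'a and d s :: nat
    and \<Phi> :: "'a \<Rightarrow> 'b::comm_cstar_algebra mat" and X :: "'a dual cplx mat"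
  assumes d: "1 \<le> d" and s: "1 \<le> s"
    and embedding: "unital_complete_order_embedding C u d \<Phi>"
    and X: "X \<in> free_polyhedron C u s"
begin

abbreviation "n \<equiv> s * d"

text \<open>On A \<otimes> c this is the real part of the trace of A times the transpose of
  X(c).\<close>

definition pairing :: "'a cplx mat \<Rightarrow> real" where
  "pairing Z = Re (\<Sum>i<s. \<Sum>j<s. cplx_extend (\<lambda>c. eval_at X c $$ (i, j)) (Z $$ (i, j)))"

text \<open>Set to 0 outside the block, so that additivity and homogeneity hold as equalities of
  functions.\<close>

definition amplification :: "'a cplx mat \<Rightarrow> nat \<Rightarrow> nat \<Rightarrow> 'b" where
  "amplification Z p q = (if p < n \<and> q < n then amplify d \<Phi> Z $$ (p, q) else 0)"

lemma X_carrier: "X \<in> carrier_mat s s"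
  using X by (rule free_polyhedron_carrier)

lemma linear_X: "i < s \<Longrightarrow> j < s \<Longrightarrow> linear (\<lambda>c. eval_at X c $$ (i, j))"
  by (rule linear_eval_at'[OF X_carrier])

lemma psd_X: "c \<in> C \<Longrightarrow> psd s (eval_at X c)"
  using X by (simp add: free_polyhedron_def)

lemma X_u: "eval_at X u = 1\<^sub>m s"
  using X by (simp add: free_polyhedron_def)

lemma \<Phi>_carrier: "\<Phi> x \<in> carrier_mat d d"
  using embedding by (simp add: unital_complete_order_embedding_def)

lemma linear_\<Phi>: "k < d \<Longrightarrow> l < d \<Longrightarrow> linear (\<lambda>x. \<Phi> x $$ (k, l))"
  using embedding by (simp add: unital_complete_order_embedding_def)

lemma \<Phi>_u: "\<Phi> u = 1\<^sub>m d"
  using embedding by (simp add: unital_complete_order_embedding_def)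

lemma \<Phi>_hermitian:
  assumes "k < d" "l < d"
  shows "\<Phi> x $$ (l, k) = conjugate (\<Phi> x $$ (k, l))"
proof -
  have "map_mat conjugate (transpose_mat (\<Phi> x)) $$ (l, k) = \<Phi> x $$ (l, k)"
    using embedding by (simp add: unital_complete_order_embedding_def)
  then show ?thesis using \<Phi>_carrier[of x] assms by simp
qed

lemma Cmin_iff: "t \<ge> 1 \<Longrightarrow> Z \<in> Her_tensor t \<Longrightarrow> Z \<in> Cmin C t \<longleftrightarrow> cstar_mat_pos (t * d) (amplify d \<Phi> Z)"
  using embedding by (simp add: unital_complete_order_embedding_def)

lemma amplification_eq:
  "Z \<in> carrier_mat s s \<Longrightarrow> p < n \<Longrightarrow> q < n \<Longrightarrow>
   amplification Z p q = cplx_extend (\<lambda>x. \<Phi> x $$ (p mod d, q mod d)) (Z $$ (p div d, q div d))"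
  by (simp add: amplification_def amplify_index)

lemma index_bounds:
  assumes "p < n"
  shows "p div d < s" "p mod d < d"
  using assms d by (simp_all add: less_mult_imp_div_less)

lemma amplification_add:
  assumes "Z \<in> carrier_mat s s" "Z' \<in> carrier_mat s s"
  shows "amplification (Z + Z') = amplification Z + amplification Z'"
proof (intro ext)
  fix p q
  show "amplification (Z + Z') p q = (amplification Z + amplification Z') p q"
  proof (cases "p < n \<and> q < n")
    case True
    then show ?thesis
      using assms index_bounds[of p] index_bounds[of q]
      by (simp add: amplification_eq cplx_extend_linear[OF linear_\<Phi>])
  qed (auto simp: amplification_def)
qed

lemma amplification_scale:
  assumes "Z \<in> carrier_mat s s"
  shows "amplification (map_mat (scaleR r) Z) = r *\<^sub>R amplification Z"
proof (intro ext)
  fix p q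
  show "amplification (map_mat (scaleR r) Z) p q = (r *\<^sub>R amplification Z) p q"
  proof (cases "p < n \<and> q < n")
    case True
    then show ?thesis
      using assms index_bounds[of p] index_bounds[of q]
      by (simp add: amplification_eq cplx_extend_linear[OF linear_\<Phi>])
  qed (auto simp: amplification_def)
qed

lemma pairing_add:
  "Z \<in> carrier_mat s s \<Longrightarrow> Z' \<in> carrier_mat s s \<Longrightarrow> pairing (Z + Z') = pairing Z + pairing Z'"
  by (simp add: pairing_def cplx_extend_linear[OF linear_X] sum.distrib del: Re_sum)

lemma pairing_scale:
  "Z \<in> carrier_mat s s \<Longrightarrow> pairing (map_mat (scaleR r) Z) = r * pairing Z"
  by (simp add: pairing_def cplx_extend_linear[OF linear_X] flip: scaleR_sum_right)

lemma pairing_elem: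
  assumes "A \<in> carrier_mat s s"
  shows "pairing (A \<otimes>\<^sub>t c) = Re (\<Sum>i<s. \<Sum>j<s. A $$ (i, j) * eval_at X c $$ (i, j))"
  using assms by (simp add: pairing_def elem_tensor_index cplx_extend_cmult[OF linear_X] del: Re_sum)

lemma amplification_elem:
  assumes "A \<in> carrier_mat s s" "p < n" "q < n"
  shows "amplification (A \<otimes>\<^sub>t c) p q = scaleC (A $$ (p div d, q div d)) (\<Phi> c $$ (p mod d, q mod d))"
proof -
  have "A \<otimes>\<^sub>t c \<in> carrier_mat s s" using assms by (simp add: elem_tensor_def)
  then show ?thesis
    using assms index_bounds[of p] index_bounds[of q]
    by (simp add: amplification_eq elem_tensor_index cplx_extend_cmult[OF linear_\<Phi>])
qed

lemma amplification_hermitian: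
  assumes "Z \<in> Her_tensor s"
  shows "amplification Z q p = conjugate (amplification Z p q)"
proof (cases "p < n \<and> q < n")
  case True
  then have pq: "p < n" "q < n" by auto
  note b = index_bounds[OF pq(1)] index_bounds[OF pq(2)]
  have "cplx_extend (\<lambda>x. \<Phi> x $$ (q mod d, p mod d)) (Z $$ (q div d, p div d))
      = conjugate (cplx_extend (\<lambda>x. \<Phi> x $$ (p mod d, q mod d)) (Z $$ (p div d, q div d)))"
    unfolding Her_tensor_hermitian[OF assms b(1,3)]
    by (rule cplx_extend_cconj[OF linear_\<Phi>[OF b(2,4)] \<Phi>_hermitian[OF b(2,4)]])
  then show ?thesis
    using True Her_tensor_carrier[OF assms] by (simp add: amplification_eq)
qed (auto simp: amplification_def)

lemma pairing_Cmin_nonneg: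
  assumes "Z \<in> Cmin C s"
  shows "0 \<le> pairing Z"
proof -
  obtain m A c where Z: "Z = mat_sum s m (\<lambda>k. A k \<otimes>\<^sub>t c k)" "\<And>k. k < m \<Longrightarrow> psd s (A k)" "\<And>k. k < m \<Longrightarrow> c k \<in> C"
    using assms unfolding Cmin_def by auto
  have A: "A k \<in> carrier_mat s s" if "k < m" for k using Z(2)[OF that] by (auto simp: psd_iff Her_def)
  have "pairing Z = Re (\<Sum>i<s. \<Sum>j<s. \<Sum>k<m. A k $$ (i, j) * eval_at X (c k) $$ (i, j))"
  proof -
    have "cplx_extend (\<lambda>c. eval_at X c $$ (i, j)) (Z $$ (i, j)) = (\<Sum>k<m. A k $$ (i, j) * eval_at X (c k) $$ (i, j))"
      if ij: "i < s" "j < s" for i j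
    proof -
      have "cplx_extend (\<lambda>c. eval_at X c $$ (i, j)) (Z $$ (i, j))
          = (\<Sum>k<m. cplx_extend (\<lambda>c. eval_at X c $$ (i, j)) ((A k \<otimes>\<^sub>t c k) $$ (i, j)))"
        using ij by (simp add: Z(1) mat_sum_def cplx_extend_sum[OF linear_X])
      also have "\<dots> = (\<Sum>k<m. A k $$ (i, j) * eval_at X (c k) $$ (i, j))"
      proof (intro sum.cong refl)
        fix k assume "k \<in> {..<m}"
        then have "A k \<in> carrier_mat s s" using A by simp
        then show "cplx_extend (\<lambda>c. eval_at X c $$ (i, j)) ((A k \<otimes>\<^sub>t c k) $$ (i, j))
            = A k $$ (i, j) * eval_at X (c k) $$ (i, j)"
          using ij by (simp add: elem_tensor_index cplx_extend_cmult[OF linear_X])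
      qed
      finally show ?thesis .
    qed
    then show ?thesis by (simp add: pairing_def del: Re_sum)
  qed
  also have "(\<Sum>i<s. \<Sum>j<s. \<Sum>k<m. A k $$ (i, j) * eval_at X (c k) $$ (i, j))
      = (\<Sum>i<s. \<Sum>k<m. \<Sum>j<s. A k $$ (i, j) * eval_at X (c k) $$ (i, j))"
    by (intro sum.cong refl sum.swap)
  also have "\<dots> = (\<Sum>k<m. \<Sum>i<s. \<Sum>j<s. A k $$ (i, j) * eval_at X (c k) $$ (i, j))"
    by (rule sum.swap)
  also have "Re \<dots> \<ge> 0"
    unfolding Re_sum[of _ "{..<m}"]
    by (intro sum_nonneg psd_pairing_nonneg) (use Z psd_X in auto)
  finally show ?thesis .
qed

text \<open>Adding \<epsilon> (1 \<otimes> u) to Z adds \<epsilon> times the identity to the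
  amplification, which Cholesky then writes as Y* Y. By the embedding the sum lies in
  \<open>Cmin C s\<close>, where the pairing is nonnegative. The unit contributes \<epsilon> s, with
  \<epsilon> arbitrarily small.\<close>

lemma pairing_nonneg:
  assumes Z: "Z \<in> Her_tensor s" and pos: "amplification Z \<in> cstar_cone n"
  shows "0 \<le> pairing Z"
proof -
  have Zc: "Z \<in> carrier_mat s s" using Z by (rule Her_tensor_carrier)
  have one: "1\<^sub>m s \<in> Her s" by (auto simp: Her_iff)
  define E :: "'a cplx mat" where "E = 1\<^sub>m s \<otimes>\<^sub>t u"
  have E: "E \<in> Her_tensor s" "E \<in> carrier_mat s s"
    unfolding E_def using Her_tensor_elem[OF one] by (auto simp: elem_tensor_def)
  have pE: "pairing E = real s"
  proof -
    have "(\<Sum>i<s. \<Sum>j<s. 1\<^sub>m s $$ (i, j) * eval_at X u $$ (i, j)) = (\<Sum>i<s. \<Sum>j<s. if j = i then 1 else 0 :: complex)"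
      unfolding X_u by (intro sum.cong refl) auto
    then show ?thesis unfolding E_def by (subst pairing_elem) simp_all
  qed
  have aE: "amplification E p q = (if p = q then 1 else 0)" if "p < n" "q < n" for p q
  proof -
    note b = index_bounds[OF that(1)] index_bounds[OF that(2)]
    have "p = q" if "p div d = q div d" "p mod d = q mod d" using that by (metis div_mult_mod_eq)
    then show ?thesis
      unfolding E_def using that b by (subst amplification_elem) (auto simp: \<Phi>_u scaleC_zero scaleC_one scaleC_zero_right)
  qed
  have "- (\<epsilon> * real s) \<le> pairing Z" if \<epsilon>: "\<epsilon> > 0" for \<epsilon>
  proof -
    define Z' where "Z' = Z + map_mat (scaleR \<epsilon>) E"
    have Z': "Z' \<in> Her_tensor s" unfolding Z'_def by (intro Her_tensor_add Her_tensor_scale Z E)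
    have aZ': "amplification Z' = amplification Z + \<epsilon> *\<^sub>R amplification E"
      unfolding Z'_def using Zc E by (subst amplification_add) (auto simp: amplification_scale)
    have "\<exists>W. \<forall>i<n. \<forall>j<n. amplification Z' i j = (\<Sum>k<n. conjugate (W k i) * W k j)"
    proof (rule cholesky[OF amplification_hermitian[OF Z'] \<epsilon>])
      fix v :: "nat \<Rightarrow> 'b"
      have "quad_form n (amplification E) v = (\<Sum>i<n. \<Sum>j<n. if j = i then conjugate (v i) * v i else 0)"
        unfolding quad_form_def by (intro sum.cong refl) (auto simp: aE)
      then have "quad_form n (amplification Z') v - \<epsilon> *\<^sub>R (\<Sum>i<n. conjugate (v i) * v i) = quad_form n (amplification Z) v"
        by (simp add: aZ' quad_form_linear)
      moreover have "sos (quad_form n (amplification Z) v)"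
      proof -
        have "(\<lambda>i j. conjugate (amplification Z j i)) = amplification Z"
          by (intro ext) (rule amplification_hermitian[OF Z, symmetric])
        then have "conjugate (quad_form n (amplification Z) v) = quad_form n (amplification Z) v"
          using quad_form_adjoint[of n "amplification Z" v] by simp
        then have "sos (quad_form n (amplification Z) v + quad_form n (amplification Z) v)"
          using pos[unfolded cstar_cone_def mem_Collect_eq, THEN spec, of v] by (simp only:)
        from sos_scaleR[OF this, of "1/2"] show ?thesis by (simp flip: scaleR_2)
      qed
      ultimately show "sos (quad_form n (amplification Z') v - \<epsilon> *\<^sub>R (\<Sum>i<n. conjugate (v i) * v i))" by simp
    qed
    then obtain W where W: "\<And>i j. i < n \<Longrightarrow> j < n \<Longrightarrow> amplification Z' i j = (\<Sum>k<n. conjugate (W k i) * W k j)"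
      by blast
    have "cstar_mat_pos n (amplify d \<Phi> Z')"
      unfolding cstar_mat_pos_def
    proof (intro bexI[of _ "mat n n (\<lambda>(k, j). W k j)"])
      have dim: "dim_row (amplify d \<Phi> Z') = n" "dim_col (amplify d \<Phi> Z') = n"
        using Her_tensor_carrier[OF Z'] by (auto simp: amplify_def)
      show "amplify d \<Phi> Z' = map_mat conjugate (transpose_mat (mat n n (\<lambda>(k, j). W k j))) * mat n n (\<lambda>(k, j). W k j)"
        by (rule eq_matI) (use W in \<open>auto simp: dim amplification_def scalar_prod_def lessThan_atLeast0\<close>)
    qed simp
    then have "Z' \<in> Cmin C s" using Cmin_iff[OF s Z'] by simp
    then have "0 \<le> pairing Z'" by (rule pairing_Cmin_nonneg)
    also have "pairing Z' = pairing Z + \<epsilon> * real s"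
      unfolding Z'_def using Zc E by (subst pairing_add) (auto simp: pairing_scale pE)
    finally show ?thesis by simp
  qed
  note le = this
  show ?thesis
  proof (rule ccontr)
    assume "\<not> 0 \<le> pairing Z"
    then have "0 < - pairing Z / (2 * real s)" using s by (simp add: divide_neg_pos)
    from le[OF this] show False using s \<open>\<not> 0 \<le> pairing Z\<close> by (simp add: field_simps)
  qed
qed

text \<open>The graph sends the amplification of Z to the pairing of Z, and is positive by
  \<open>pairing_nonneg\<close>; the amplified unit is the identity and hence an order unit. The
  graph form of the extension lemma also yields that the pairing depends on the amplification
  alone.\<close>

lemma exists_positive_extension:
  "\<exists>g. linear g \<and> (\<forall>M\<in>cstar_cone n. 0 \<le> g M) \<and> (\<forall>Z\<in>Her_tensor s. g (amplification Z) = pairing Z)"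
proof -
  define G where "G = {(amplification Z, pairing Z) | Z. Z \<in> Her_tensor s}"
  have sub: "Real_Vector_Spaces.subspace G"
    unfolding real_vector.subspace_def
  proof (intro conjI ballI allI)
    have GI: "(amplification Z, pairing Z) \<in> G" if "Z \<in> Her_tensor s" for Z
      using that unfolding G_def by blast
    have sc: "r *\<^sub>R x \<in> G" if "x \<in> G" for r x
    proof -
      obtain Z where "x = (amplification Z, pairing Z)" "Z \<in> Her_tensor s" using \<open>x \<in> G\<close> unfolding G_def by blast
      then show ?thesis
        using GI[OF Her_tensor_scale[of Z s r]] Her_tensor_carrier[of Z s]
        by (simp add: amplification_scale pairing_scale)
    qed
    have "1\<^sub>m s \<in> Her s" by (auto simp: Her_iff)
    then have "(amplification (1\<^sub>m s \<otimes>\<^sub>t u), pairing (1\<^sub>m s \<otimes>\<^sub>t u)) \<in> G"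
      unfolding G_def using Her_tensor_elem by blast
    from sc[OF this, of 0] show "0 \<in> G" by (simp add: zero_prod_def)
    fix x assume x: "x \<in> G"
    then show "r *\<^sub>R x \<in> G" for r by (rule sc)
    fix y assume "y \<in> G"
    then obtain Z Z' where "x = (amplification Z, pairing Z)" "Z \<in> Her_tensor s"
      "y = (amplification Z', pairing Z')" "Z' \<in> Her_tensor s" using x unfolding G_def by blast
    then show "x + y \<in> G"
      using GI[OF Her_tensor_add[of Z s Z']] Her_tensor_carrier[of Z s] Her_tensor_carrier[of Z' s]
      by (simp add: amplification_add pairing_add)
  qed
  define e :: "nat \<Rightarrow> nat \<Rightarrow> 'b" where "e = amplification (1\<^sub>m s \<otimes>\<^sub>t u)"
  have one: "1\<^sub>m s \<in> Her s" by (auto simp: Her_iff)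
  have "\<exists>t. t *\<^sub>R e - M \<in> cstar_cone n" for M
  proof -
    obtain t where t: "t *\<^sub>R (\<lambda>i j. if i = j then 1 else 0) - M \<in> cstar_cone n"
      using cstar_cone_order_unit by blast
    have "e p q = (if p = q then 1 else 0)" if "p < n" "q < n" for p q
    proof -
      note b = index_bounds[OF that(1)] index_bounds[OF that(2)]
      have "p = q" if "p div d = q div d" "p mod d = q mod d" using that by (metis div_mult_mod_eq)
      then show ?thesis
        unfolding e_def using that b by (subst amplification_elem) (auto simp: \<Phi>_u scaleC_zero scaleC_one scaleC_zero_right)
    qed
    then have "quad_form n (t *\<^sub>R e - M) v = quad_form n (t *\<^sub>R (\<lambda>i j. if i = j then 1 else 0) - M) v" for v
      by (intro quad_form_cong) simp
    then show ?thesis using t unfolding cstar_cone_def by (intro exI[of _ t]) simp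
  qed
  from riesz_extension[of "cstar_cone n" e G "pairing (1\<^sub>m s \<otimes>\<^sub>t u)", OF cstar_cone_add cstar_cone_scale this sub]
  have "\<exists>g. linear g \<and> (\<forall>v\<in>cstar_cone n. 0 \<le> g v) \<and> (\<forall>v r. (v, r) \<in> G \<longrightarrow> g v = r)"
    using pairing_nonneg Her_tensor_elem[OF one, of u] by (auto simp: G_def e_def)
  then show ?thesis unfolding G_def by blast
qed

text \<open>The \<open>d\<close> by \<open>s * d\<close> matrix whose block i is \<xi>_i a. In the
  GNS space \<open>dilated (1\<^sub>m d) \<xi>\<close> is the copy of \<xi>, and
  \<open>dilated a \<xi>\<close> is the result of letting \<open>a\<close> act on it.\<close>

definition dilated :: "'b mat \<Rightarrow> (nat \<Rightarrow> complex) \<Rightarrow> nat \<Rightarrow> nat \<Rightarrow> 'b" where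
  "dilated a \<xi> k q = (if k < d then scaleC (\<xi> (q div d)) (a $$ (k, q mod d)) else 0)"

lemma linear_dilated: "linear (dilated a)"
  by (rule linearI)
    (auto simp: dilated_def fun_eq_iff scaleC_add_left scaleC_scaleR_left)

lemma linear_dilated_\<Phi>: "linear (\<lambda>c. dilated (\<Phi> c) \<xi>)"
proof (rule linearI)
  have m: "q mod d < d" for q using d by simp
  fix x y :: 'a and r :: real
  show "dilated (\<Phi> (x + y)) \<xi> = dilated (\<Phi> x) \<xi> + dilated (\<Phi> y) \<xi>"
    by (auto simp: dilated_def fun_eq_iff linear_add[OF linear_\<Phi>] m scaleC_add_right)
  show "dilated (\<Phi> (r *\<^sub>R x)) \<xi> = r *\<^sub>R dilated (\<Phi> x) \<xi>"
    by (auto simp: dilated_def fun_eq_iff linear_scale[OF linear_\<Phi>] m scaleC_scaleR_commute)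
qed

end

section \<open>The GNS form of the extended functional\<close>

locale extended_system = embedded_system +
  fixes g :: "(nat \<Rightarrow> nat \<Rightarrow> 'b) \<Rightarrow> real"
  assumes linear_g: "linear g" and g_pos: "\<And>M. M \<in> cstar_cone n \<Longrightarrow> 0 \<le> g M"
    and g_amplification: "\<And>Z. Z \<in> Her_tensor s \<Longrightarrow> g (amplification Z) = pairing Z"
begin

lemma g_zero_if:
  assumes "\<And>v. quad_form n M v + conjugate (quad_form n M v) = 0"
  shows "g M = 0"
proof -
  have "M \<in> cstar_cone n" using assms by (simp add: cstar_cone_def sos_zero)
  moreover have "- 1 *\<^sub>R M \<in> cstar_cone n"
  proof -
    have "quad_form n (- 1 *\<^sub>R M) v + conjugate (quad_form n (- 1 *\<^sub>R M) v)
      = - (quad_form n M v + conjugate (quad_form n M v))" for v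
      unfolding quad_form_linear by (simp add: conjugate_neg)
    then show ?thesis using assms by (simp add: cstar_cone_def sos_zero)
  qed
  ultimately show ?thesis using g_pos[of M] g_pos[of "- 1 *\<^sub>R M"] linear_scale[OF linear_g, of "-1" M] by simp
qed

lemma g_cong:
  assumes "\<And>p q. p < n \<Longrightarrow> q < n \<Longrightarrow> M p q = M' p q"
  shows "g M = g M'"
proof -
  have "quad_form n (M - M') v = 0" for v
    using quad_form_cong[of n M M'] assms by (simp add: quad_form_linear)
  then have "g (M - M') = 0" by (intro g_zero_if) simp
  then show ?thesis by (simp add: linear_diff[OF linear_g])
qed

text \<open>The difference of a matrix and its adjoint has zero Hermitian part. This makes the GNS
  form symmetric.\<close>

lemma g_adjoint: "g (\<lambda>p q. conjugate (M q p)) = g M"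
proof -
  have "g ((\<lambda>p q. conjugate (M q p)) - M) = 0"
    by (rule g_zero_if) (simp add: quad_form_linear quad_form_adjoint conjugate_diff)
  then show ?thesis by (simp add: linear_diff[OF linear_g])
qed

lemma linear_g_cross: "linear (\<lambda>Y. g (cross d Y w))"
  using linear_compose[OF linear_cross linear_g, of d w] by (simp add: comp_def)

text \<open>Degenerate case of the Cauchy-Schwarz inequality: along t Y + w the form is affine in t,
  and an affine function that stays nonnegative has slope 0.\<close>

lemma g_cross_zero:
  assumes "g (cross d Y Y) = 0"
  shows "g (cross d Y w) = 0"
proof -
  have expand: "cross d (t *\<^sub>R Y + w) (t *\<^sub>R Y + w)
      = t\<^sup>2 *\<^sub>R cross d Y Y + t *\<^sub>R cross d Y w + t *\<^sub>R (\<lambda>p q. conjugate (cross d Y w q p)) + cross d w w" for t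
    by (simp add: fun_eq_iff cross_def conjugate_dist_add conjugate_scaleR conjugate_dist_mul sum_conjugate
        algebra_simps sum.distrib scaleR_sum_right power2_eq_square)
  have ineq: "0 \<le> 2 * t * g (cross d Y w) + g (cross d w w)" for t
  proof -
    have "0 \<le> g (cross d (t *\<^sub>R Y + w) (t *\<^sub>R Y + w))" by (rule g_pos[OF cross_self_in_cone])
    then show ?thesis
      unfolding expand by (simp add: linear_add[OF linear_g] linear_scale[OF linear_g] g_adjoint assms)
  qed
  show ?thesis
  proof (rule ccontr)
    assume nz: "g (cross d Y w) \<noteq> 0"
    have "2 * (- (g (cross d w w) + 1) / (2 * g (cross d Y w))) * g (cross d Y w) = - (g (cross d w w) + 1)"
      using nz by (simp add: field_simps)
    with ineq[of "- (g (cross d w w) + 1) / (2 * g (cross d Y w))"] show False by simp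
  qed
qed

text \<open>The tensor behind this matrix has the rank-one factor with entries cnj(\<xi>_i) \<xi>_j;
  on it the extension property of \<open>g\<close> reads off the form of X(c) at \<xi>.\<close>

lemma g_rank_one:
  "g (\<lambda>p q. scaleC (cnj (\<xi> (p div d)) * \<xi> (q div d)) (\<Phi> c $$ (p mod d, q mod d)))
    = Re (quad_form s (entries (eval_at X c)) \<xi>)"
proof -
  define A where "A = mat s s (\<lambda>(i, j). cnj (\<xi> i) * \<xi> j)"
  have A: "A \<in> Her s" "A \<in> carrier_mat s s" by (auto simp: A_def Her_iff)
  have "g (amplification (A \<otimes>\<^sub>t c)) = pairing (A \<otimes>\<^sub>t c)"
    by (rule g_amplification[OF Her_tensor_elem[OF A(1)]])
  also have "\<dots> = Re (quad_form s (entries (eval_at X c)) \<xi>)"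
    unfolding pairing_elem[OF A(2)] by (simp add: A_def quad_form_def mult_ac del: Re_sum)
  also have "g (amplification (A \<otimes>\<^sub>t c))
      = g (\<lambda>p q. scaleC (cnj (\<xi> (p div d)) * \<xi> (q div d)) (\<Phi> c $$ (p mod d, q mod d)))"
    by (rule g_cong) (subst amplification_elem[OF A(2)], auto simp: A_def index_bounds)
  finally show ?thesis .
qed

text \<open>The map from \<complex>^s to the GNS space is isometric because \<Phi> and X are both
  unital.\<close>

lemma g_cross_one: "g (cross d (dilated (1\<^sub>m d) \<xi>) (dilated (1\<^sub>m d) \<xi>)) = (\<Sum>i<s. (cmod (\<xi> i))\<^sup>2)"
proof -
  have "g (cross d (dilated (1\<^sub>m d) \<xi>) (dilated (1\<^sub>m d) \<xi>))
      = g (\<lambda>p q. scaleC (cnj (\<xi> (p div d)) * \<xi> (q div d)) (\<Phi> u $$ (p mod d, q mod d)))"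
  proof (rule g_cong)
    fix p q assume "p < n" "q < n"
    note b = index_bounds[OF \<open>p < n\<close>] index_bounds[OF \<open>q < n\<close>]
    have "cross d (dilated (1\<^sub>m d) \<xi>) (dilated (1\<^sub>m d) \<xi>) p q
      = (\<Sum>k<d. if k = p mod d then scaleC (cnj (\<xi> (p div d)) * \<xi> (q div d)) (1\<^sub>m d $$ (p mod d, q mod d)) else 0)"
      unfolding cross_def using b
      by (intro sum.cong refl) (auto simp: dilated_def conjugate_scaleC conjugate_one scaleC_zero_right
          mult_scaleC_left mult_scaleC_right scaleC_scaleC mult.commute)
    then show "cross d (dilated (1\<^sub>m d) \<xi>) (dilated (1\<^sub>m d) \<xi>) p q
      = scaleC (cnj (\<xi> (p div d)) * \<xi> (q div d)) (\<Phi> u $$ (p mod d, q mod d))"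
      using b by (simp add: \<Phi>_u)
  qed
  also have "\<dots> = Re (quad_form s (entries (1\<^sub>m s)) \<xi>)" unfolding g_rank_one X_u ..
  also have "quad_form s (entries (1\<^sub>m s)) \<xi> = (\<Sum>i<s. \<Sum>j<s. if j = i then cnj (\<xi> i) * \<xi> i else 0)"
    unfolding quad_form_def by (intro sum.cong refl) auto
  also have "Re \<dots> = (\<Sum>i<s. (cmod (\<xi> i))\<^sup>2)"
    by (simp add: cmod_power2) (simp add: power2_eq_square sum.distrib)
  finally show ?thesis .
qed

text \<open>The embedding at level one: 1 \<otimes> c lies in the cone, so \<Phi>(c) = Y* Y.\<close>

lemma \<Phi>_factorization:
  assumes "c \<in> C"
  obtains Y where "\<And>k l. k < d \<Longrightarrow> l < d \<Longrightarrow> \<Phi> c $$ (k, l) = (\<Sum>m<d. conjugate (Y m k) * Y m l)"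
proof -
  have one: "1\<^sub>m 1 \<in> Her 1" by (auto simp: Her_iff)
  have "1\<^sub>m 1 \<otimes>\<^sub>t c \<in> Cmin C 1"
    unfolding Cmin_def mem_Collect_eq
  proof (intro exI conjI)
    show "1\<^sub>m 1 \<otimes>\<^sub>t c = mat_sum 1 1 (\<lambda>k. (\<lambda>_. 1\<^sub>m 1) k \<otimes>\<^sub>t (\<lambda>_. c) k)"
      by (intro eq_matI) (auto simp: mat_sum_def elem_tensor_def)
    show "\<forall>k<1. psd 1 ((\<lambda>_. 1\<^sub>m 1) k) \<and> (\<lambda>_. c) k \<in> C"
      using assms one by (auto simp: psd_iff quad_form_def less_eq_complex_def)
  qed
  then have "cstar_mat_pos d (amplify d \<Phi> (1\<^sub>m 1 \<otimes>\<^sub>t c))"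
    using Cmin_iff[of 1 "1\<^sub>m 1 \<otimes>\<^sub>t c"] Her_tensor_elem[OF one, of c] by simp
  then obtain Y where Y: "Y \<in> carrier_mat d d"
    "amplify d \<Phi> (1\<^sub>m 1 \<otimes>\<^sub>t c) = map_mat conjugate (transpose_mat Y) * Y" unfolding cstar_mat_pos_def by blast
  show ?thesis
  proof (rule that[of "\<lambda>m k. Y $$ (m, k)"])
    fix k l assume kl: "k < d" "l < d"
    have "amplify d \<Phi> (1\<^sub>m 1 \<otimes>\<^sub>t c) $$ (k, l) = cplx_extend (\<lambda>x. \<Phi> x $$ (k, l)) (cmult 1 (c, 0))"
      using kl by (subst amplify_index[of _ 1]) (auto simp: elem_tensor_def)
    also have "\<dots> = \<Phi> c $$ (k, l)"
      using kl by (simp add: cplx_extend_cmult[OF linear_\<Phi>] scaleC_one)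
    finally show "\<Phi> c $$ (k, l) = (\<Sum>m<d. conjugate (Y $$ (m, k)) * Y $$ (m, l))"
      unfolding Y(2) using Y(1) kl by (simp add: scalar_prod_def lessThan_atLeast0)
  qed
qed

text \<open>Vectors in the kernel of \<open>X(c)\<close> are killed by \<open>\<Phi>(c)\<close> in the GNS space of \<open>g\<close>.\<close>

lemma g_cross_kernel:
  assumes c: "c \<in> C" and \<xi>: "quad_form s (entries (eval_at X c)) \<xi> = 0"
  shows "g (cross d (dilated (\<Phi> c) \<xi>) w) = 0"
proof -
  obtain Y where Y: "\<And>k l. k < d \<Longrightarrow> l < d \<Longrightarrow> \<Phi> c $$ (k, l) = (\<Sum>m<d. conjugate (Y m k) * Y m l)"
    using \<Phi>_factorization[OF c] by blast
  define y where "y m q = scaleC (\<xi> (q div d)) (Y m (q mod d))" for m q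
  have m: "q mod d < d" for q using d by simp
  have "cross d y y p q = scaleC (cnj (\<xi> (p div d)) * \<xi> (q div d)) (\<Phi> c $$ (p mod d, q mod d))" for p q
    by (simp add: cross_def y_def Y m conjugate_scaleC mult_scaleC_left mult_scaleC_right scaleC_scaleC
        scaleC_sum_right mult.commute)
  then have "cross d y y = (\<lambda>p q. scaleC (cnj (\<xi> (p div d)) * \<xi> (q div d)) (\<Phi> c $$ (p mod d, q mod d)))"
    by (intro ext)
  then have "g (cross d y y) = 0" using g_rank_one[of \<xi> c] \<xi> by simp
  \<comment> \<open>Pairing Y \<xi> with Y w in place of w restores the product Y* Y =
    \<Phi>(c).\<close>
  then have "g (cross d y (\<lambda>m p. \<Sum>k<d. Y m k * w k p)) = 0" by (rule g_cross_zero)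
  also have "cross d y (\<lambda>m p. \<Sum>k<d. Y m k * w k p) = cross d (dilated (\<Phi> c) \<xi>) w"
  proof (intro ext)
    fix p q
    have "cross d y (\<lambda>m p. \<Sum>k<d. Y m k * w k p) p q
        = (\<Sum>m<d. \<Sum>k<d. scaleC (\<xi> (q div d)) (conjugate (w k p) * (conjugate (Y m k) * Y m (q mod d))))"
      by (simp add: cross_def y_def sum_conjugate conjugate_dist_mul sum_distrib_left sum_distrib_right
          mult_scaleC_left mult_scaleC_right mult_ac)
    also have "\<dots> = (\<Sum>k<d. \<Sum>m<d. scaleC (\<xi> (q div d)) (conjugate (w k p) * (conjugate (Y m k) * Y m (q mod d))))"
      by (rule sum.swap)
    also have "\<dots> = cross d (dilated (\<Phi> c) \<xi>) w p q"
      by (simp add: cross_def dilated_def Y m mult_scaleC_right sum_distrib_left scaleC_sum_right)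
    finally show "cross d y (\<lambda>m p. \<Sum>k<d. Y m k * w k p) p q = cross d (dilated (\<Phi> c) \<xi>) w p q" .
  qed
  finally show ?thesis .
qed

lemma g_dilated_cong:
  assumes "\<And>i. i < s \<Longrightarrow> \<xi> i = \<eta> i"
  shows "g (cross d (dilated a \<xi>) w) = g (cross d (dilated a \<eta>) w)"
  by (rule g_cong) (simp add: cross_def dilated_def index_bounds assms)

text \<open>The difference of the two sides is real-linear in \<xi> and in c, hence the real part of
  a row b(c) applied to \<xi>. It vanishes at u, where both matrices are identities, and on the
  kernel of X(c) by \<open>g_cross_kernel\<close>; rigidity makes it vanish identically.\<close>

lemma \<Phi>_intertwined:
  assumes "rigid C u s X"
  shows "g (cross d (dilated (\<Phi> c) \<xi>) w) = g (cross d (dilated (1\<^sub>m d) (mv s (eval_at X c) \<xi>)) w)"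
proof -
  define \<phi> where "\<phi> c \<xi> = g (cross d (dilated (\<Phi> c) \<xi>) w)
      - g (cross d (dilated (1\<^sub>m d) (mv s (eval_at X c) \<xi>)) w)" for c \<xi>
  have lin_apply: "linear (mv s M)" for M
    by (rule linearI) (auto simp: mv_def fun_eq_iff algebra_simps sum.distrib scaleR_sum_right)
  have l1: "linear (\<lambda>\<xi>. g (cross d (dilated a \<xi>) w))" for a
    using linear_compose[OF linear_dilated linear_g_cross] by (simp add: comp_def)
  have l2: "linear (\<lambda>\<xi>. g (cross d (dilated a (mv s M \<xi>)) w))" for a M
    using linear_compose[OF lin_apply l1] by (simp add: comp_def)
  have lin\<xi>: "linear (\<phi> c)" for c
    unfolding \<phi>_def by (intro linear_compose_sub l1 l2)
  have linc: "linear (\<lambda>c. \<phi> c \<xi>)" for \<xi>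
  proof -
    have "linear (\<lambda>c. g (cross d (dilated (\<Phi> c) \<xi>) w))"
      using linear_compose[OF linear_dilated_\<Phi> linear_g_cross] by (simp add: comp_def)
    moreover have "linear (\<lambda>c. g (cross d (dilated (1\<^sub>m d) (mv s (eval_at X c) \<xi>)) w))"
    proof -
      \<comment> \<open>Cut off beyond \<open>s\<close>, where entries of X are out of range and
        linearity in c cannot be asserted.\<close>
      define Xs where "Xs c i = (if i < s then mv s (eval_at X c) \<xi> i else 0)" for c i
      have "linear Xs"
        by (rule linearI)
          (auto simp: Xs_def mv_def fun_eq_iff linear_add[OF linear_X] linear_scale[OF linear_X]
            algebra_simps sum.distrib scaleR_sum_right)
      from linear_compose[OF this l1] have "linear (\<lambda>c. g (cross d (dilated (1\<^sub>m d) (Xs c)) w))" by (simp add: comp_def)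
      then show ?thesis
        using g_dilated_cong[of "Xs _" "mv s (eval_at X _) \<xi>"] by (simp add: Xs_def)
    qed
    ultimately show ?thesis unfolding \<phi>_def by (rule linear_compose_sub)
  qed
  define b where "b c i = Complex (\<phi> c (\<lambda>j. if j = i then 1 else 0)) (- \<phi> c (\<lambda>j. if j = i then \<i> else 0))" for c i
  have \<phi>_eq: "\<phi> c \<xi> = Re (\<Sum>i<s. b c i * \<xi> i)" for c \<xi>
    unfolding b_def
  proof (rule real_linear_functional_complex[OF lin\<xi>])
    fix \<xi> \<eta> :: "nat \<Rightarrow> complex" assume eq: "\<And>i. i < s \<Longrightarrow> \<xi> i = \<eta> i"
    have "mv s M \<xi> = mv s M \<eta>" for M using eq by (simp add: mv_def fun_eq_iff)
    then show "\<phi> c \<xi> = \<phi> c \<eta>" using g_dilated_cong[OF eq] by (simp add: \<phi>_def)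
  qed
  have "b c i = 0" if "i < s" for c i
  proof (rule rigidD[OF assms, where b=b, OF _ _ _ that])
    show "linear (\<lambda>c. b c i)" for i
      unfolding b_def by (rule linearI)
        (auto simp: complex_eq_iff linear_add[OF linc] linear_scale[OF linc])
    show "b u i = 0" if "i < s" for i
    proof -
      have "mv s (1\<^sub>m s) \<xi> j = \<xi> j" if "j < s" for \<xi> j
      proof -
        have "mv s (1\<^sub>m s) \<xi> j = (\<Sum>i<s. if i = j then \<xi> j else 0)"
          unfolding mv_def using that by (intro sum.cong) auto
        then show ?thesis using that by simp
      qed
      then have "\<phi> u \<xi> = 0" for \<xi>
        unfolding \<phi>_def \<Phi>_u X_u using g_dilated_cong[of "mv s (1\<^sub>m s) \<xi>" \<xi>] by simp
      then show ?thesis by (simp add: b_def complex_eq_iff)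
    qed
    fix c \<xi> assume c: "c \<in> C" and \<xi>: "\<And>i. i < s \<Longrightarrow> (\<Sum>j<s. eval_at X c $$ (i, j) * \<xi> j) = 0"
    \<comment> \<open>Kernels are complex subspaces, so z = 1 and z = \<i> give the real and the
      imaginary part of the pairing with b(c).\<close>
    have zero: "\<phi> c (\<lambda>i. z * \<xi> i) = 0" for z
    proof -
      have a0: "(\<Sum>j<s. eval_at X c $$ (i, j) * (z * \<xi> j)) = 0" if "i < s" for i
      proof -
        have "(\<Sum>j<s. eval_at X c $$ (i, j) * (z * \<xi> j)) = z * (\<Sum>j<s. eval_at X c $$ (i, j) * \<xi> j)"
          by (simp add: sum_distrib_left mult_ac)
        then show ?thesis using \<xi>[OF that] by simp
      qed
      have "quad_form s (entries (eval_at X c)) (\<lambda>i. z * \<xi> i)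
          = (\<Sum>i<s. conjugate (z * \<xi> i) * (\<Sum>j<s. eval_at X c $$ (i, j) * (z * \<xi> j)))"
        by (simp add: quad_form_def sum_distrib_left mult.assoc)
      also have "\<dots> = 0" using a0 by simp
      finally have "g (cross d (dilated (\<Phi> c) (\<lambda>i. z * \<xi> i)) w) = 0" by (rule g_cross_kernel[OF c])
      moreover have "g (cross d (dilated (1\<^sub>m d) (mv s (eval_at X c) (\<lambda>i. z * \<xi> i))) w)
          = g (cross d (dilated (1\<^sub>m d) 0) w)"
        by (rule g_dilated_cong) (simp add: mv_def a0)
      ultimately show ?thesis by (simp add: \<phi>_def linear_0[OF l1])
    qed
    have "Re (\<Sum>i<s. b c i * \<xi> i) = 0" using zero[of 1] by (simp add: \<phi>_eq del: Re_sum)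
    moreover have "Im (\<Sum>i<s. b c i * \<xi> i) = 0"
    proof -
      have "(\<Sum>i<s. b c i * (\<i> * \<xi> i)) = \<i> * (\<Sum>i<s. b c i * \<xi> i)" by (simp add: sum_distrib_left mult_ac)
      then show ?thesis using zero[of \<i>] by (simp add: \<phi>_eq del: Re_sum Im_sum)
    qed
    ultimately show "(\<Sum>i<s. b c i * \<xi> i) = 0" by (simp add: complex_eq_iff del: Re_sum Im_sum)
  qed
  then have "\<phi> c \<xi> = 0" by (simp add: \<phi>_eq)
  then show ?thesis by (simp add: \<phi>_def)
qed

text \<open>Link a to b if a acts on the GNS copy of \<complex>^s like b. The links of \<Phi>(c)
  with X(c) reach all matrices by generation, so for s > d * d + 1 the zero matrix is linked to the
  unit that sends the basis vector d * d + 1 to the basis vector 0. The latter has norm 1 in the GNS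
  space.\<close>

lemma level_bound:
  assumes rig: "rigid C u s X" and gen: "generating s (range (eval_at X))"
  shows "s \<le> d * d + 1"
proof (rule ccontr)
  assume "\<not> s \<le> d * d + 1"
  then have ds: "d * d + 1 < s" by simp
  define L where "L = {(a, b). a \<in> carrier_mat d d \<and> b \<in> carrier_mat s s \<and>
    (\<forall>\<xi> w. g (cross d (dilated a \<xi>) w) = g (cross d (dilated (1\<^sub>m d) (mv s b \<xi>)) w))}"
  have LD: "a \<in> carrier_mat d d" "b \<in> carrier_mat s s"
    "g (cross d (dilated a \<xi>) w) = g (cross d (dilated (1\<^sub>m d) (mv s b \<xi>)) w)" if "(a, b) \<in> L" for a b \<xi> w
    using that by (auto simp: L_def)
  have LI: "(a, b) \<in> L" if "a \<in> carrier_mat d d" "b \<in> carrier_mat s s"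
    "\<And>\<xi> w. g (cross d (dilated a \<xi>) w) = g (cross d (dilated (1\<^sub>m d) (mv s b \<xi>)) w)" for a b
    using that by (simp add: L_def)
  have m: "q mod d < d" for q using d by simp
  have gl: "g (cross d (Y + Y') w) = g (cross d Y w) + g (cross d Y' w)"
    "g (cross d (- Y) w) = - g (cross d Y w)" for Y Y' w
    using linear_add[OF linear_g_cross] linear_neg[OF linear_g_cross] by auto
  have app1: "mv s (1\<^sub>m s) \<xi> j = \<xi> j" if "j < s" for \<xi> j
  proof -
    have "mv s (1\<^sub>m s) \<xi> j = (\<Sum>i<s. if i = j then \<xi> j else 0)"
      unfolding mv_def using that by (intro sum.cong) auto
    then show ?thesis using that by simp
  qed
  have "(0\<^sub>m d d, unit_mat s 0 (d * d + 1)) \<in> L"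
  proof (rule linked_generating[OF _ _ _ _ _ _ gen _ ds])
    show "L \<subseteq> carrier_mat d d \<times> carrier_mat s s" by (auto simp: L_def)
    show "(1\<^sub>m d, 1\<^sub>m s) \<in> L"
      by (rule LI) (auto intro!: g_dilated_cong simp: app1)
    show "\<exists>a. (a, b) \<in> L" if "b \<in> range (eval_at X)" for b
    proof -
      obtain c where "b = eval_at X c" using \<open>b \<in> range (eval_at X)\<close> by blast
      then have "(\<Phi> c, b) \<in> L"
        using X_carrier \<Phi>_carrier[of c] \<Phi>_intertwined[OF rig] by (intro LI) (simp_all add: eval_at_def)
      then show ?thesis ..
    qed
    fix a b assume "(a, b) \<in> L"
    note ab = LD[OF this]
    show "\<exists>a'. (a', z \<cdot>\<^sub>m b) \<in> L" for z
    proof (intro exI LI)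
      show "map_mat (scaleC z) a \<in> carrier_mat d d" "z \<cdot>\<^sub>m b \<in> carrier_mat s s" using ab by simp_all
      fix \<xi> w
      have "dilated (map_mat (scaleC z) a) \<xi> = dilated a (\<lambda>i. z * \<xi> i)"
        using ab(1) m by (auto simp: dilated_def fun_eq_iff scaleC_scaleC mult.commute)
      then have "g (cross d (dilated (map_mat (scaleC z) a) \<xi>) w)
          = g (cross d (dilated (1\<^sub>m d) (mv s b (\<lambda>i. z * \<xi> i))) w)" using ab(3) by simp
      also have "\<dots> = g (cross d (dilated (1\<^sub>m d) (mv s (z \<cdot>\<^sub>m b) \<xi>)) w)"
        by (rule g_dilated_cong) (use ab(2) in \<open>simp add: mv_def mult_ac\<close>)
      finally show "g (cross d (dilated (map_mat (scaleC z) a) \<xi>) w)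
          = g (cross d (dilated (1\<^sub>m d) (mv s (z \<cdot>\<^sub>m b) \<xi>)) w)" .
    qed
    show "(- a, - b) \<in> L"
    proof (rule LI)
      fix \<xi> w
      have "dilated (- a) \<xi> = - dilated a \<xi>"
        using ab(1) m by (auto simp: dilated_def fun_eq_iff scaleC_minus_right)
      then have "g (cross d (dilated (- a) \<xi>) w) = g (cross d (- dilated (1\<^sub>m d) (mv s b \<xi>)) w)"
        by (simp add: gl ab(3))
      also have "- dilated (1\<^sub>m d) (mv s b \<xi>) = dilated (1\<^sub>m d) (- mv s b \<xi>)"
        by (simp add: linear_neg[OF linear_dilated])
      also have "g (cross d (dilated (1\<^sub>m d) (- mv s b \<xi>)) w) = g (cross d (dilated (1\<^sub>m d) (mv s (- b) \<xi>)) w)"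
        by (rule g_dilated_cong) (use ab(2) in \<open>simp add: mv_def sum_negf\<close>)
      finally show "g (cross d (dilated (- a) \<xi>) w) = g (cross d (dilated (1\<^sub>m d) (mv s (- b) \<xi>)) w)" .
    qed (use ab in simp_all)
    fix a' b' assume "(a', b') \<in> L"
    note ab' = LD[OF this]
    show "(a + a', b + b') \<in> L"
    proof (rule LI)
      fix \<xi> w
      have "dilated (a + a') \<xi> = dilated a \<xi> + dilated a' \<xi>"
        using ab(1) ab'(1) m by (auto simp: dilated_def fun_eq_iff scaleC_add_right)
      then have "g (cross d (dilated (a + a') \<xi>) w)
          = g (cross d (dilated (1\<^sub>m d) (mv s b \<xi>) + dilated (1\<^sub>m d) (mv s b' \<xi>)) w)"
        by (simp add: gl ab(3) ab'(3))
      also have "dilated (1\<^sub>m d) (mv s b \<xi>) + dilated (1\<^sub>m d) (mv s b' \<xi>)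
          = dilated (1\<^sub>m d) (mv s b \<xi> + mv s b' \<xi>)"
        by (simp add: linear_add[OF linear_dilated])
      also have "g (cross d (dilated (1\<^sub>m d) (mv s b \<xi> + mv s b' \<xi>)) w)
          = g (cross d (dilated (1\<^sub>m d) (mv s (b + b') \<xi>)) w)"
        by (rule g_dilated_cong) (use ab(2) ab'(2) in \<open>simp add: mv_def sum.distrib algebra_simps\<close>)
      finally show "g (cross d (dilated (a + a') \<xi>) w) = g (cross d (dilated (1\<^sub>m d) (mv s (b + b') \<xi>)) w)" .
    qed (use ab ab' in simp_all)
    show "(a * a', b * b') \<in> L"
    proof (rule LI)
      fix \<xi> w
      \<comment> \<open>Left multiplication by \<open>a\<close> moves to the second argument as its
        adjoint. As \<open>w\<close> is arbitrary in \<open>L\<close>, this makes links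
        multiplicative.\<close>
      have move: "cross d (dilated (a * f) \<xi>) w = cross d (dilated f \<xi>) (\<lambda>l p. \<Sum>k<d. conjugate (a $$ (k, l)) * w k p)"
        if f: "f \<in> carrier_mat d d" for f \<xi>
      proof (intro ext)
        fix p q
        have "cross d (dilated (a * f) \<xi>) w p q
            = (\<Sum>k<d. \<Sum>l<d. conjugate (w k p) * (a $$ (k, l) * scaleC (\<xi> (q div d)) (f $$ (l, q mod d))))"
          using ab(1) f m[of q]
          by (simp add: cross_def dilated_def scalar_prod_def lessThan_atLeast0 scaleC_sum_right
              mult_scaleC_right sum_distrib_left)
        also have "\<dots> = (\<Sum>l<d. \<Sum>k<d. conjugate (w k p) * (a $$ (k, l) * scaleC (\<xi> (q div d)) (f $$ (l, q mod d))))"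
          by (rule sum.swap)
        also have "\<dots> = cross d (dilated f \<xi>) (\<lambda>l p. \<Sum>k<d. conjugate (a $$ (k, l)) * w k p) p q"
          by (simp add: cross_def dilated_def sum_conjugate conjugate_dist_mul sum_distrib_left sum_distrib_right mult_ac)
        finally show "cross d (dilated (a * f) \<xi>) w p q
            = cross d (dilated f \<xi>) (\<lambda>l p. \<Sum>k<d. conjugate (a $$ (k, l)) * w k p) p q" .
      qed
      have "g (cross d (dilated (a * a') \<xi>) w) = g (cross d (dilated (a * 1\<^sub>m d) (mv s b' \<xi>)) w)"
        unfolding move[OF ab'(1)] move[OF one_carrier_mat] by (rule ab'(3))
      also have "\<dots> = g (cross d (dilated (1\<^sub>m d) (mv s b (mv s b' \<xi>))) w)"
        using ab by simp
      also have "\<dots> = g (cross d (dilated (1\<^sub>m d) (mv s (b * b') \<xi>)) w)"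
      proof (rule g_dilated_cong)
        fix i assume i: "i < s"
        have "mv s b (mv s b' \<xi>) i = (\<Sum>k<s. \<Sum>j<s. b $$ (i, k) * b' $$ (k, j) * \<xi> j)"
          by (simp add: mv_def sum_distrib_left mult.assoc)
        also have "\<dots> = (\<Sum>j<s. \<Sum>k<s. b $$ (i, k) * b' $$ (k, j) * \<xi> j)" by (rule sum.swap)
        also have "\<dots> = mv s (b * b') \<xi> i"
          using ab(2) ab'(2) i by (simp add: mv_def scalar_prod_def lessThan_atLeast0 sum_distrib_right)
        finally show "mv s b (mv s b' \<xi>) i = mv s (b * b') \<xi> i" .
      qed
      finally show "g (cross d (dilated (a * a') \<xi>) w) = g (cross d (dilated (1\<^sub>m d) (mv s (b * b') \<xi>)) w)" .
    qed (use ab ab' in simp_all)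
  qed
  note L0 = LD(3)[OF this]
  define \<xi> where "\<xi> j = (if j = d * d + 1 then 1 else (0::complex))" for j
  define \<eta> where "\<eta> = mv s (unit_mat s 0 (d * d + 1)) \<xi>"
  have "g (cross d (dilated (1\<^sub>m d) \<eta>) (dilated (1\<^sub>m d) \<eta>)) = g (cross d (dilated (0\<^sub>m d d) \<xi>) (dilated (1\<^sub>m d) \<eta>))"
    unfolding \<eta>_def L0 ..
  also have "dilated (0\<^sub>m d d) \<xi> = 0" using m by (auto simp: dilated_def fun_eq_iff scaleC_zero_right)
  also have "g (cross d 0 (dilated (1\<^sub>m d) \<eta>)) = 0" by (rule linear_0[OF linear_g_cross])
  finally have "(\<Sum>i<s. (cmod (\<eta> i))\<^sup>2) = 0" unfolding g_cross_one .
  then have "\<eta> 0 = 0" using ds by (simp add: sum_nonneg_eq_0_iff)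
  moreover have "\<eta> 0 = (\<Sum>j<s. if j = d * d + 1 then 1 else 0)"
    unfolding \<eta>_def mv_def using ds by (intro sum.cong) (auto simp: unit_mat_def \<xi>_def)
  ultimately show False using ds by simp
qed

end

lemma embedding_level_bound:
  fixes \<Phi> :: "'a::euclidean_space \<Rightarrow> 'b::comm_cstar_algebra mat"
  assumes "1 \<le> d" "1 \<le> s" "unital_complete_order_embedding C u d \<Phi>" "X \<in> free_polyhedron C u s"
    "rigid C u s X" "generating s (range (eval_at X))"
  shows "s \<le> d * d + 1"
proof -
  interpret embedded_system C u d s \<Phi> X by unfold_locales (use assms in auto)
  obtain g where "linear g" "\<forall>M\<in>cstar_cone (s * d). 0 \<le> g M" "\<forall>Z\<in>Her_tensor s. g (amplification Z) = pairing Z"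
    using exists_positive_extension by blast
  then interpret extended_system C u d s \<Phi> X g
    by (intro extended_system.intro embedded_system_axioms extended_system_axioms.intro) blast+
  show ?thesis by (rule level_bound) (use assms in auto)
qed

section \<open>Normalization of a pencil\<close>

lemma mat_adjoint_carrier: "A \<in> carrier_mat n m \<Longrightarrow> mat_adjoint A \<in> carrier_mat m n"
  by (intro carrier_matI) simp_all

lemma adjoint_mult_mult_index:
  assumes "T \<in> carrier_mat n n" "M \<in> carrier_mat n n" "p < n" "q < n"
  shows "(mat_adjoint T * M * T) $$ (p, q) = (\<Sum>a<n. \<Sum>b<n. cnj (T $$ (a, p)) * M $$ (a, b) * T $$ (b, q))"
proof -
  have "(mat_adjoint T * M * T) $$ (p, q) = (\<Sum>b<n. \<Sum>a<n. cnj (T $$ (a, p)) * M $$ (a, b) * T $$ (b, q))"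
    using assms by (simp add: scalar_prod_def mat_adjoint_index lessThan_atLeast0 sum_distrib_right)
  also have "\<dots> = (\<Sum>a<n. \<Sum>b<n. cnj (T $$ (a, p)) * M $$ (a, b) * T $$ (b, q))" by (rule sum.swap)
  finally show ?thesis .
qed

lemma adjoint_mult_mult_Her:
  assumes "T \<in> carrier_mat n n" "M \<in> Her n"
  shows "mat_adjoint T * M * T \<in> Her n"
proof -
  have M: "M \<in> carrier_mat n n" using assms(2) by (simp add: Her_def)
  have h: "cnj (M $$ (a, b)) = M $$ (b, a)" if "a < n" "b < n" for a b
  proof -
    have "M $$ (b, a) = cnj (M $$ (a, b))" using assms(2) that unfolding Her_iff by blast
    then show ?thesis by (rule sym)
  qed
  have "(mat_adjoint T * M * T) $$ (q, p) = cnj ((mat_adjoint T * M * T) $$ (p, q))" if "p < n" "q < n" for p q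
  proof -
    have "cnj ((mat_adjoint T * M * T) $$ (p, q))
        = (\<Sum>a<n. \<Sum>b<n. cnj (T $$ (b, q)) * M $$ (b, a) * T $$ (a, p))"
      unfolding adjoint_mult_mult_index[OF assms(1) M that] cnj_sum
      by (intro sum.cong refl) (simp add: h mult_ac)
    also have "\<dots> = (\<Sum>b<n. \<Sum>a<n. cnj (T $$ (b, q)) * M $$ (b, a) * T $$ (a, p))" by (rule sum.swap)
    also have "\<dots> = (mat_adjoint T * M * T) $$ (q, p)"
      by (rule adjoint_mult_mult_index[OF assms(1) M that(2,1), symmetric])
    finally show ?thesis ..
  qed
  moreover have "mat_adjoint T * M * T \<in> carrier_mat n n"
    by (rule mult_carrier_mat[OF mult_carrier_mat[OF mat_adjoint_carrier[OF assms(1)] M] assms(1)])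
  ultimately show ?thesis unfolding Her_iff by blast
qed

lemma exists_inverse_if_kernel_trivial:
  fixes W :: "complex mat"
  assumes "W \<in> carrier_mat n n" "\<And>v. v \<in> carrier_vec n \<Longrightarrow> W *\<^sub>v v = 0\<^sub>v n \<Longrightarrow> v = 0\<^sub>v n"
  shows "\<exists>T\<in>carrier_mat n n. W * T = 1\<^sub>m n \<and> T * W = 1\<^sub>m n"
proof -
  have "Determinant.det W \<noteq> 0"
    using det_0_iff_vec_prod_zero[OF assms(1)] assms(2) by blast
  then have "W \<in> Units (ring_mat TYPE(complex) n ())" by (rule det_non_zero_imp_unit[OF assms(1)])
  then show ?thesis by (auto simp: Units_def ring_mat_def)
qed

text \<open>A pencil that is positive on \<open>C\<close> and positive definite at \<open>u\<close> becomes unital after a congruence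
  \<open>T\<^sup>* X(c) T\<close>. The last two assumptions are rigidity and generation in a form that is invariant
  under congruence.\<close>

lemma normalized_pencil:
  fixes C :: "'a::euclidean_space set" and M :: "nat \<Rightarrow> complex mat" and \<psi> :: "nat \<Rightarrow> 'a dual"
    and n K :: nat
  defines "Xt \<equiv> \<lambda>c. mat n n (\<lambda>(i, j). \<Sum>k<K. of_real (blinfun_apply (\<psi> k) c) * M k $$ (i, j))"
  assumes M: "\<And>k. k < K \<Longrightarrow> M k \<in> Her n"
    and pos: "\<And>c v. c \<in> C \<Longrightarrow> 0 \<le> quad_form n (entries (Xt c)) v"
    and eps: "0 < \<epsilon>" "\<And>v. of_real \<epsilon> * (\<Sum>i<n. cnj (v i) * v i) \<le> quad_form n (entries (Xt u)) v"
    and rows: "\<And>b. (\<And>i. i < n \<Longrightarrow> linear (\<lambda>c. b c i)) \<Longrightarrow>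
      (\<And>c v. c \<in> C \<Longrightarrow> (\<And>i. i < n \<Longrightarrow> (\<Sum>j<n. Xt c $$ (i, j) * v j) = 0) \<Longrightarrow> (\<Sum>i<n. b c i * v i) = 0) \<Longrightarrow>
      \<exists>y. \<forall>c. \<forall>j<n. b c j = (\<Sum>i<n. y i * Xt c $$ (i, j))"
    and alg: "\<And>B N. subalgebra n B \<Longrightarrow> N \<in> carrier_mat n n \<Longrightarrow> N * Xt u = 1\<^sub>m n \<Longrightarrow>
      (\<And>c. N * Xt c \<in> B) \<Longrightarrow> carrier_mat n n \<subseteq> B"
  shows "\<exists>X\<in>free_polyhedron C u n. rigid C u n X \<and> generating n (range (eval_at X))"
proof -
  have Mc: "M k \<in> carrier_mat n n" if "k < K" for k using M[OF that] by (simp add: Her_def)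
  have Xc: "Xt c \<in> carrier_mat n n" for c by (simp add: Xt_def)
  have Xi: "Xt c $$ (i, j) = (\<Sum>k<K. of_real (blinfun_apply (\<psi> k) c) * M k $$ (i, j))" if "i < n" "j < n" for c i j
    using that by (simp add: Xt_def)
  have Xh: "Xt c $$ (j, i) = conjugate (Xt c $$ (i, j))" if "i < n" "j < n" for c i j
  proof -
    have "M k $$ (j, i) = cnj (M k $$ (i, j))" if "k < K" for k
      using M[OF that] \<open>i < n\<close> \<open>j < n\<close> unfolding Her_iff by blast
    then show ?thesis using that by (simp add: Xi)
  qed
  \<comment> \<open>The Cholesky factor W of the value at u; its inverse T is the normalizing
    congruence.\<close>
  have "\<exists>W. \<forall>i<n. \<forall>j<n. Xt u $$ (i, j) = (\<Sum>k<n. conjugate (W k i) * W k j)"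
  proof (rule cholesky[OF Xh eps(1)])
    fix v
    show "sos (quad_form n (entries (Xt u)) v - \<epsilon> *\<^sub>R (\<Sum>i<n. conjugate (v i) * v i))"
      by (rule sos_complex) (use eps(2)[of v] in \<open>simp add: scaleR_conv_of_real\<close>)
  qed
  then obtain W0 where W0: "\<And>i j. i < n \<Longrightarrow> j < n \<Longrightarrow> Xt u $$ (i, j) = (\<Sum>k<n. cnj (W0 k i) * W0 k j)" by auto
  define W where "W = mat n n (\<lambda>(i, j). W0 i j)"
  have W: "W \<in> carrier_mat n n" by (simp add: W_def)
  have WW: "mat_adjoint W * W = Xt u"
    by (rule eq_matI) (use W Xc[of u] W0 in \<open>auto simp: W_def scalar_prod_def mat_adjoint_index lessThan_atLeast0\<close>)
  have definite: "v i = 0" if v: "\<And>i. i < n \<Longrightarrow> (\<Sum>j<n. Xt u $$ (i, j) * v j) = 0" and i: "i < n" for v i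
  proof -
    have "quad_form n (entries (Xt u)) v = (\<Sum>i<n. conjugate (v i) * (\<Sum>j<n. Xt u $$ (i, j) * v j))"
      by (simp add: quad_form_def sum_distrib_left mult.assoc)
    also have "\<dots> = 0" using v by simp
    finally have "of_real \<epsilon> * (\<Sum>i<n. cnj (v i) * v i) \<le> 0" using eps(2)[of v] by simp
    then have "\<epsilon> * (\<Sum>i<n. (cmod (v i))\<^sup>2) \<le> 0"
      by (simp add: less_eq_complex_def cmod_power2) (simp add: power2_eq_square)
    then have "(\<Sum>i<n. (cmod (v i))\<^sup>2) \<le> 0" using eps(1) by (simp add: mult_le_0_iff)
    then have "(\<Sum>i<n. (cmod (v i))\<^sup>2) = 0" by (meson antisym sum_nonneg zero_le_power2)
    then show ?thesis using i by (simp add: sum_nonneg_eq_0_iff)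
  qed
  have "\<exists>T\<in>carrier_mat n n. W * T = 1\<^sub>m n \<and> T * W = 1\<^sub>m n"
  proof (rule exists_inverse_if_kernel_trivial[OF W])
    fix v assume v: "v \<in> carrier_vec n" "W *\<^sub>v v = 0\<^sub>v n"
    have "Xt u *\<^sub>v v = mat_adjoint W *\<^sub>v (W *\<^sub>v v)"
      unfolding WW[symmetric] by (rule assoc_mult_mat_vec[OF mat_adjoint_carrier[OF W] W v(1)])
    also have "\<dots> = 0\<^sub>v n" unfolding v(2) using W by (intro eq_vecI) (auto simp: scalar_prod_def)
    finally have "(Xt u *\<^sub>v v) $ i = 0" if "i < n" for i using that by simp
    then have "(\<Sum>j<n. Xt u $$ (i, j) * v $ j) = 0" if "i < n" for i
      using that Xc[of u] v(1) by (simp add: scalar_prod_def lessThan_atLeast0)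
    from definite[OF this] show "v = 0\<^sub>v n" using v(1) by (intro eq_vecI) auto
  qed
  then obtain T where T: "T \<in> carrier_mat n n" and WT: "W * T = 1\<^sub>m n" and TW: "T * W = 1\<^sub>m n" by blast
  define A where "A k = mat_adjoint T * M k * T" for k
  define X where "X = mat_sum n K (\<lambda>k. A k \<otimes>\<^sub>t \<psi> k)"
  have A: "A k \<in> Her n" "A k \<in> carrier_mat n n" if "k < K" for k
    using adjoint_mult_mult_Her[OF T M[OF that]] by (auto simp: A_def Her_def)
  have ev: "eval_at X c = mat_adjoint T * Xt c * T" for c
  proof (rule eq_matI)
    fix p q assume "p < dim_row (mat_adjoint T * Xt c * T)" "q < dim_col (mat_adjoint T * Xt c * T)"
    then have pq: "p < n" "q < n" using T by auto
    have "eval_at X c $$ (p, q) = (\<Sum>k<K. eval_at (A k \<otimes>\<^sub>t \<psi> k) c $$ (p, q))"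
      unfolding X_def by (rule eval_at_mat_sum) (use A pq in \<open>auto simp: elem_tensor_def\<close>)
    also have "\<dots> = (\<Sum>k<K. A k $$ (p, q) * of_real (blinfun_apply (\<psi> k) c))"
    proof (rule sum.cong[OF refl])
      fix k assume "k \<in> {..<K}"
      then have "A k \<in> carrier_mat n n" using A by simp
      then show "eval_at (A k \<otimes>\<^sub>t \<psi> k) c $$ (p, q) = A k $$ (p, q) * of_real (blinfun_apply (\<psi> k) c)"
        using pq by (simp add: eval_at_def elem_tensor_def cmult_def complex_eq_iff blinfun.scaleR_left)
    qed
    also have "\<dots> = (\<Sum>k<K. \<Sum>a<n. \<Sum>b<n. cnj (T $$ (a, p)) * (of_real (blinfun_apply (\<psi> k) c) * M k $$ (a, b)) * T $$ (b, q))"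
    proof (rule sum.cong[OF refl])
      fix k assume "k \<in> {..<K}"
      then have "M k \<in> carrier_mat n n" using Mc by simp
      from adjoint_mult_mult_index[OF T this pq]
      show "A k $$ (p, q) * of_real (blinfun_apply (\<psi> k) c)
        = (\<Sum>a<n. \<Sum>b<n. cnj (T $$ (a, p)) * (of_real (blinfun_apply (\<psi> k) c) * M k $$ (a, b)) * T $$ (b, q))"
        by (simp add: A_def sum_distrib_right sum_distrib_left mult_ac)
    qed
    also have "\<dots> = (\<Sum>a<n. \<Sum>k<K. \<Sum>b<n. cnj (T $$ (a, p)) * (of_real (blinfun_apply (\<psi> k) c) * M k $$ (a, b)) * T $$ (b, q))"
      by (rule sum.swap)
    also have "\<dots> = (\<Sum>a<n. \<Sum>b<n. \<Sum>k<K. cnj (T $$ (a, p)) * (of_real (blinfun_apply (\<psi> k) c) * M k $$ (a, b)) * T $$ (b, q))"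
      by (rule sum.cong[OF refl], rule sum.swap)
    also have "\<dots> = (\<Sum>a<n. \<Sum>b<n. cnj (T $$ (a, p)) * Xt c $$ (a, b) * T $$ (b, q))"
      by (intro sum.cong refl) (simp add: Xi sum_distrib_left sum_distrib_right)
    also have "\<dots> = (mat_adjoint T * Xt c * T) $$ (p, q)"
      by (rule adjoint_mult_mult_index[OF T Xc pq, symmetric])
    finally show "eval_at X c $$ (p, q) = (mat_adjoint T * Xt c * T) $$ (p, q)" .
  qed (use T in \<open>simp_all add: X_def mat_sum_def\<close>)
  have TA: "mat_adjoint T \<in> carrier_mat n n" "mat_adjoint W \<in> carrier_mat n n" by (intro mat_adjoint_carrier T W)+
  have TAWA: "mat_adjoint T * mat_adjoint W = 1\<^sub>m n"
  proof (rule eq_matI)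
    fix p q assume "p < dim_row (1\<^sub>m n :: complex mat)" "q < dim_col (1\<^sub>m n :: complex mat)"
    then have pq: "p < n" "q < n" by auto
    have "(mat_adjoint T * mat_adjoint W) $$ (p, q) = cnj ((W * T) $$ (q, p))"
      using T W pq by (simp add: scalar_prod_def mat_adjoint_index mult.commute)
    then show "(mat_adjoint T * mat_adjoint W) $$ (p, q) = 1\<^sub>m n $$ (p, q)" using pq by (simp add: WT)
  qed (use T W in auto)
  have X_u: "eval_at X u = 1\<^sub>m n"
  proof -
    have "mat_adjoint T * Xt u * T = mat_adjoint T * mat_adjoint W * W * T"
      unfolding WW[symmetric] using TA W by (simp add: assoc_mult_mat[of "mat_adjoint T" n n "mat_adjoint W" n W n])
    then show ?thesis using W T by (simp add: ev TAWA WT)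
  qed
  have X: "X \<in> free_polyhedron C u n"
    unfolding free_polyhedron_def mem_Collect_eq
  proof (intro conjI ballI)
    show "X \<in> Her_tensor n" unfolding Her_tensor_def X_def using A(1) by blast
    show "eval_at X u = 1\<^sub>m n" by (rule X_u)
    fix c assume c: "c \<in> C"
    have "Xt c \<in> Her n" unfolding Her_iff using Xc[of c] Xh[of _ _ c] unfolding conjugate_complex_def by blast
    then have "eval_at X c \<in> Her n" unfolding ev by (rule adjoint_mult_mult_Her[OF T])
    then show "psd n (eval_at X c)"
      unfolding psd_iff ev using pos[OF c] by (simp add: quad_form_compress[OF T Xc])
  qed
  have "rigid C u n X"
    unfolding rigid_def
  proof (intro allI impI)
    fix b :: "'a \<Rightarrow> nat \<Rightarrow> complex" and c i
    assume lin: "\<forall>i<n. linear (\<lambda>c. b c i)" and bu: "\<forall>i<n. b u i = 0"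
      and ker: "\<forall>c\<in>C. \<forall>\<xi>. (\<forall>i<n. (\<Sum>j<n. eval_at X c $$ (i, j) * \<xi> j) = 0) \<longrightarrow> (\<Sum>i<n. b c i * \<xi> i) = 0"
      and i: "i < n"
    \<comment> \<open>Undoing the congruence turns a row family for X into one for the original
      pencil.\<close>
    define b' where "b' c j = (\<Sum>i<n. b c i * W $$ (i, j))" for c j
    have "\<exists>y. \<forall>c. \<forall>j<n. b' c j = (\<Sum>i<n. y i * Xt c $$ (i, j))"
    proof (rule rows)
      show "linear (\<lambda>c. b' c j)" for j
      proof -
        have "b (x + z) i = b x i + b z i" "b (r *\<^sub>R x) i = r *\<^sub>R b x i" if "i < n" for x z r i
          using linear_add[OF lin[rule_format, OF that], of x z] linear_scale[OF lin[rule_format, OF that], of r x] by simp_all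
        then show ?thesis
          by (intro linearI) (simp_all add: b'_def sum.distrib distrib_right scaleR_sum_right)
      qed
      fix c v assume c: "c \<in> C" and v: "\<And>i. i < n \<Longrightarrow> (\<Sum>j<n. Xt c $$ (i, j) * v j) = 0"
      define x where "x = vec n v"
      have x: "x \<in> carrier_vec n" by (simp add: x_def)
      have "Xt c *\<^sub>v x = 0\<^sub>v n"
        using Xc[of c] v by (intro eq_vecI) (auto simp: x_def scalar_prod_def lessThan_atLeast0)
      have "eval_at X c *\<^sub>v (W *\<^sub>v x) = mat_adjoint T *\<^sub>v (Xt c *\<^sub>v (T *\<^sub>v (W *\<^sub>v x)))"
        unfolding ev using TA T W Xc[of c] x
        by (simp add: assoc_mult_mat_vec[of _ n n _ n])
      also have "T *\<^sub>v (W *\<^sub>v x) = x"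
        using T W x by (simp add: TW flip: assoc_mult_mat_vec[of _ n n _ n])
      also have "mat_adjoint T *\<^sub>v (Xt c *\<^sub>v x) = 0\<^sub>v n"
        unfolding \<open>Xt c *\<^sub>v x = 0\<^sub>v n\<close> using T by (intro eq_vecI) (auto simp: scalar_prod_def)
      finally have z: "eval_at X c *\<^sub>v (W *\<^sub>v x) = 0\<^sub>v n" .
      have "(\<Sum>j<n. eval_at X c $$ (i, j) * (W *\<^sub>v x) $ j) = 0" if "i < n" for i
      proof -
        have "(eval_at X c *\<^sub>v (W *\<^sub>v x)) $ i = 0" using z that by simp
        moreover have "dim_row X = n" "dim_col X = n" by (auto simp: X_def mat_sum_def)
        ultimately show ?thesis using that W by (simp add: scalar_prod_def lessThan_atLeast0)
      qed
      then have "(\<Sum>i<n. b c i * (W *\<^sub>v x) $ i) = 0" using ker c by blast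
      also have "(\<Sum>i<n. b c i * (W *\<^sub>v x) $ i) = (\<Sum>i<n. \<Sum>j<n. b c i * W $$ (i, j) * v j)"
        using W by (intro sum.cong) (auto simp: x_def scalar_prod_def lessThan_atLeast0 sum_distrib_left mult.assoc)
      also have "\<dots> = (\<Sum>j<n. b' c j * v j)"
        unfolding b'_def sum_distrib_right by (rule sum.swap)
      finally show "(\<Sum>j<n. b' c j * v j) = 0" .
    qed
    then obtain y where y: "\<And>c j. j < n \<Longrightarrow> b' c j = (\<Sum>i<n. y i * Xt c $$ (i, j))" by blast
    \<comment> \<open>b(u) = 0 says that y annihilates \<open>Xt u\<close> from the left;
      conjugation and definiteness give y = 0.\<close>
    have "(\<Sum>j<n. Xt u $$ (k, j) * cnj (y j)) = 0" if k: "k < n" for k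
    proof -
      have "(\<Sum>j<n. Xt u $$ (k, j) * cnj (y j)) = cnj (b' u k)"
        unfolding y[OF k] cnj_sum
      proof (intro sum.cong refl)
        fix j assume "j \<in> {..<n}"
        then have "Xt u $$ (k, j) = conjugate (Xt u $$ (j, k))" by (intro Xh k) simp
        then show "Xt u $$ (k, j) * cnj (y j) = cnj (y j * Xt u $$ (j, k))" by (simp add: mult.commute)
      qed
      also have "b' u k = 0" using bu by (simp add: b'_def)
      finally show ?thesis by simp
    qed
    from definite[OF this] have y0: "y j = 0" if "j < n" for j using that by fastforce
    have "b c i = (\<Sum>k<n. b c k * (W * T) $$ (k, i))"
    proof -
      have "(\<Sum>k<n. b c k * (W * T) $$ (k, i)) = (\<Sum>k<n. if k = i then b c i else 0)"
        unfolding WT using i by (intro sum.cong) auto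
      then show ?thesis using i by simp
    qed
    also have "\<dots> = (\<Sum>k<n. \<Sum>j<n. b c k * W $$ (k, j) * T $$ (j, i))"
      using W T i by (intro sum.cong) (auto simp: scalar_prod_def lessThan_atLeast0 sum_distrib_left mult.assoc)
    also have "\<dots> = (\<Sum>j<n. b' c j * T $$ (j, i))"
      unfolding b'_def sum_distrib_right by (rule sum.swap)
    also have "\<dots> = 0" using y y0 by simp
    finally show "b c i = 0" .
  qed
  moreover have "generating n (range (eval_at X))"
    unfolding generating_def
  proof (intro allI impI)
    fix B assume B: "subalgebra n B" and XB: "range (eval_at X) \<subseteq> B"
    \<comment> \<open>Conjugation by W carries the question back to the original pencil: this is
      again a subalgebra, and it contains N times every value of the pencil, where N = T T* is the
      inverse of \<open>Xt u\<close>.\<close>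
    define B' where "B' = {M \<in> carrier_mat n n. W * M * T \<in> B}"
    have B'I: "M \<in> B'" if "M \<in> carrier_mat n n" "W * M * T \<in> B" for M using that by (simp add: B'_def)
    have B'D: "M \<in> carrier_mat n n" "W * M * T \<in> B" if "M \<in> B'" for M using that by (auto simp: B'_def)
    note Bs = B[unfolded subalgebra_def]
    have sub: "subalgebra n B'"
      unfolding subalgebra_def
    proof (intro conjI ballI allI)
      show "B' \<subseteq> carrier_mat n n" by (auto simp: B'_def)
      show "1\<^sub>m n \<in> B'" using Bs W by (intro B'I) (simp_all add: WT)
      fix M assume M: "M \<in> B'"
      note M = B'D[OF M]
      show "z \<cdot>\<^sub>m M \<in> B'" for z
      proof (rule B'I)
        have "W * (z \<cdot>\<^sub>m M) * T = z \<cdot>\<^sub>m (W * M * T)"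
          using W M T by (simp add: mult_smult_distrib[OF W M(1)] mult_smult_assoc_mat[of "W * M" n n T n])
        then show "W * (z \<cdot>\<^sub>m M) * T \<in> B" using Bs M by simp
      qed (use M in simp)
      fix M' assume M': "M' \<in> B'"
      note M' = B'D[OF M']
      show "M + M' \<in> B'"
      proof (rule B'I)
        have "W * (M + M') * T = W * M * T + W * M' * T"
          using W M M' T by (simp add: mult_add_distrib_mat[OF W M(1) M'(1)] add_mult_distrib_mat[of "W * M" n n "W * M'" T n])
        then show "W * (M + M') * T \<in> B" using Bs M M' by simp
      qed (use M M' in simp)
      show "M * M' \<in> B'"
      proof (rule B'I)
        have "W * M * T * (W * M' * T) = W * M * (T * (W * (M' * T)))"
          using W M M' T by (simp add: assoc_mult_mat[of _ n n _ n _ n])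
        also have "T * (W * (M' * T)) = M' * T"
          using W M' T by (simp add: TW flip: assoc_mult_mat[of T n n W n "M' * T" n])
        also have "W * M * (M' * T) = W * (M * M') * T"
          using W M M' T by (simp add: assoc_mult_mat[of _ n n _ n _ n])
        finally have "W * (M * M') * T = W * M * T * (W * M' * T)" ..
        then show "W * (M * M') * T \<in> B" using Bs M M' by simp
      qed (use M M' in simp)
    qed
    define N where "N = T * mat_adjoint T"
    have N: "N \<in> carrier_mat n n" using T TA by (simp add: N_def)
    have WN: "W * (N * Xt c) * T = eval_at X c" for c
    proof -
      have "W * (N * Xt c) * T = W * (T * (mat_adjoint T * (Xt c * T)))"
        unfolding N_def using W T TA Xc[of c] by (simp add: assoc_mult_mat[of _ n n _ n _ n])
      also have "\<dots> = mat_adjoint T * (Xt c * T)"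
        using W T TA Xc[of c] by (simp add: WT flip: assoc_mult_mat[of W n n T n _ n])
      also have "\<dots> = eval_at X c"
        unfolding ev using T TA Xc[of c] by (simp add: assoc_mult_mat[of _ n n _ n _ n])
      finally show ?thesis .
    qed
    have all: "carrier_mat n n \<subseteq> B'"
    proof (rule alg[OF sub N])
      have "N * Xt u = T * (mat_adjoint T * mat_adjoint W * W)"
        unfolding N_def WW[symmetric] using T TA W by (simp add: assoc_mult_mat[of _ n n _ n _ n])
      then show "N * Xt u = 1\<^sub>m n" using W by (simp add: TAWA TW)
      show "N * Xt c \<in> B'" for c
        by (rule B'I) (use N Xc[of c] XB WN[of c] in auto)
    qed
    show "carrier_mat n n \<subseteq> B"
    proof
      fix M :: "complex mat" assume M: "M \<in> carrier_mat n n"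
      have "T * M * W \<in> carrier_mat n n" using T M W by simp
      then have "W * (T * M * W) * T \<in> B" using all by (auto simp: B'_def)
      also have "W * (T * M * W) * T = W * (T * (M * (W * T)))"
        using W T M by (simp add: assoc_mult_mat[of _ n n _ n _ n])
      also have "\<dots> = M"
        using W T M by (simp add: WT flip: assoc_mult_mat[of W n n T n M n])
      finally show "M \<in> B" .
    qed
  qed
  ultimately show ?thesis using X by blast
qed

text \<open>\<open>a\<close> has the largest first coordinate, and by the antichain condition all
  other points lie strictly to the left of it and above it. \<open>b\<close> is the far end of the
  upper right hull edge that starts at \<open>a\<close>. In the basis a, b every point has
  coordinate sum at most 1, and sum 1 means lying on this edge, that is, on the segment from
  \<open>a\<close> to \<open>b\<close>.\<close>

lemma planar_edge:
  fixes Q :: "(real \<times> real) set"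
  assumes fin: "finite Q" and pos: "\<And>r. r \<in> Q \<Longrightarrow> 0 < fst r \<and> 0 < snd r" and card: "2 \<le> card Q"
    and antichain: "\<And>r r'. r \<in> Q \<Longrightarrow> r' \<in> Q \<Longrightarrow> fst r \<le> fst r' \<Longrightarrow> snd r \<le> snd r' \<Longrightarrow> r = r'"
  shows "\<exists>a\<in>Q. \<exists>b\<in>Q. \<exists>\<alpha> \<gamma>. fst b < fst a \<and> snd a < snd b \<and>
    (\<forall>r\<in>Q. fst r = \<alpha> r * fst a + \<gamma> r * fst b \<and> snd r = \<alpha> r * snd a + \<gamma> r * snd b \<and>
      (0 \<le> \<alpha> r \<and> 0 \<le> \<gamma> r \<and> \<alpha> r + \<gamma> r = 1 \<or> \<alpha> r + \<gamma> r < 1))"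
proof -
  have "Q \<noteq> {}" using card by auto
  have "Max (fst ` Q) \<in> fst ` Q" using fin \<open>Q \<noteq> {}\<close> by simp
  then obtain a where a: "a \<in> Q" "fst a = Max (fst ` Q)" by force
  have a2: "fst r \<le> fst a" if "r \<in> Q" for r using fin that by (simp add: a(2))
  have lt: "fst r < fst a \<and> snd a < snd r" if "r \<in> Q - {a}" for r
  proof -
    have r: "r \<in> Q" "r \<noteq> a" using that by auto
    have "snd a < snd r"
      using antichain[OF r(1) a(1) a2[OF r(1)]] r(2) by (cases "snd r \<le> snd a") auto
    moreover have "fst r \<noteq> fst a" using antichain[OF a(1) r(1)] r(2) \<open>snd a < snd r\<close> by auto
    ultimately show ?thesis using a2[OF r(1)] by simp
  qed
  define Q' where "Q' = Q - {a}"
  have Q': "finite Q'" "Q' \<noteq> {}"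
  proof -
    show "finite Q'" using fin by (simp add: Q'_def)
    have "card Q' = card Q - 1" using a(1) by (simp add: Q'_def)
    then show "Q' \<noteq> {}" using card by auto
  qed
  \<comment> \<open>Leftward displacement per unit of height above \<open>a\<close>; the minimum
    belongs to the hull edge.\<close>
  define slope where "slope r = (fst a - fst r) / (snd r - snd a)" for r
  define \<mu> where "\<mu> = Min (slope ` Q')"
  have \<mu>_le: "\<mu> \<le> slope r" if "r \<in> Q'" for r using Q' that by (simp add: \<mu>_def)
  define S where "S = {r \<in> Q'. slope r = \<mu>}"
  have "\<mu> \<in> slope ` Q'" unfolding \<mu>_def using Q' by (intro Min_in) auto
  then have S: "finite S" "S \<noteq> {}" using Q' by (auto simp: S_def)
  have "Max (snd ` S) \<in> snd ` S" using S by simp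
  then obtain b where b: "b \<in> S" "snd b = Max (snd ` S)" by force
  have b2: "snd r \<le> snd b" if "r \<in> S" for r using S that by (simp add: b(2))
  have bS: "b \<in> Q - {a}" "slope b = \<mu>" using b(1) by (simp_all add: S_def Q'_def)
  then have bQ: "b \<in> Q" "fst b < fst a" "snd a < snd b" using lt[OF bS(1)] by simp_all
  have \<mu>b: "fst a - fst b = \<mu> * (snd b - snd a)"
    using bS(2) bQ by (simp add: slope_def field_simps)
  have pb: "fst b = fst a - \<mu> * (snd b - snd a)" using \<mu>b by simp
  from \<mu>b have "\<mu> > 0" using bQ by (metis diff_gt_0_iff_gt zero_less_mult_pos2)
  \<comment> \<open>The determinant of \<open>a\<close> and \<open>b\<close>; \<alpha> and \<gamma>
    are then coordinates by Cramer's rule.\<close>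
  define \<Delta> where "\<Delta> = fst a * snd b - fst b * snd a"
  have \<Delta>: "\<Delta> = (snd b - snd a) * (fst a + \<mu> * snd a)"
    unfolding \<Delta>_def pb by (simp add: algebra_simps)
  have pa: "0 < fst a" "0 < snd a" using pos[OF a(1)] by simp_all
  then have k: "0 < fst a + \<mu> * snd a" using \<open>\<mu> > 0\<close> by (simp add: add_pos_pos)
  then have "\<Delta> > 0" unfolding \<Delta> using bQ by simp
  define \<alpha> where "\<alpha> r = (fst r * snd b - snd r * fst b) / \<Delta>" for r
  define \<gamma> where "\<gamma> r = (snd r * fst a - fst r * snd a) / \<Delta>" for r
  have "fst r = \<alpha> r * fst a + \<gamma> r * fst b" "snd r = \<alpha> r * snd a + \<gamma> r * snd b" for r
    using \<open>\<Delta> > 0\<close> by (simp_all add: \<alpha>_def \<gamma>_def field_simps) (simp_all add: \<Delta>_def algebra_simps)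
  moreover have "0 \<le> \<alpha> r \<and> 0 \<le> \<gamma> r \<and> \<alpha> r + \<gamma> r = 1 \<or> \<alpha> r + \<gamma> r < 1" if r: "r \<in> Q" for r
  proof -
    have sum: "\<alpha> r + \<gamma> r = (snd b - snd a) * (fst r + \<mu> * snd r) / \<Delta>"
    proof -
      have "fst r * snd b - snd r * fst b + (snd r * fst a - fst r * snd a)
          = (snd b - snd a) * fst r + snd r * (fst a - fst b)" by (simp add: algebra_simps)
      also have "\<dots> = (snd b - snd a) * (fst r + \<mu> * snd r)" unfolding \<mu>b by (simp add: algebra_simps)
      finally show ?thesis by (simp add: \<alpha>_def \<gamma>_def flip: add_divide_distrib)
    qed
    show ?thesis
    proof (cases "fst r + \<mu> * snd r < fst a + \<mu> * snd a")
      case True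
      then have "(snd b - snd a) * (fst r + \<mu> * snd r) < \<Delta>" unfolding \<Delta> using bQ by simp
      then have "\<alpha> r + \<gamma> r < 1" unfolding sum using \<open>\<Delta> > 0\<close> by simp
      then show ?thesis ..
    next
      case False
      have le: "snd a \<le> snd r \<and> snd r \<le> snd b \<and> fst r = fst a - \<mu> * (snd r - snd a)"
      proof (cases "r = a")
        case True
        then show ?thesis using bQ by simp
      next
        case ra: False
        then have rQ: "r \<in> Q'" using r by (simp add: Q'_def)
        then have l: "fst r < fst a" "snd a < snd r" using lt by (auto simp: Q'_def)
        have "\<mu> * (snd r - snd a) \<le> fst a - fst r"
          using \<mu>_le[OF rQ] l by (simp add: slope_def field_simps)
        then have e: "fst r = fst a - \<mu> * (snd r - snd a)" using False by (simp add: algebra_simps)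
        then have "slope r = \<mu>" using l by (simp add: slope_def)
        then have "r \<in> S" using rQ by (simp add: S_def)
        then show ?thesis using b2 l e by simp
      qed
      then have er: "fst r = fst a - \<mu> * (snd r - snd a)" by blast
      have "(snd b - snd a) * (fst r + \<mu> * snd r) = \<Delta>"
        unfolding \<Delta> er by (simp add: algebra_simps)
      then have "\<alpha> r + \<gamma> r = 1" unfolding sum using \<open>\<Delta> > 0\<close> by simp
      moreover have "fst r * snd b - snd r * fst b = (snd b - snd r) * (fst a + \<mu> * snd a)"
        unfolding pb er by (simp add: algebra_simps)
      then have "\<alpha> r = (snd b - snd r) * (fst a + \<mu> * snd a) / \<Delta>" by (simp add: \<alpha>_def)
      moreover have "snd r * fst a - fst r * snd a = (snd r - snd a) * (fst a + \<mu> * snd a)"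
        unfolding er by (simp add: algebra_simps)
      then have "\<gamma> r = (snd r - snd a) * (fst a + \<mu> * snd a) / \<Delta>" by (simp add: \<gamma>_def)
      ultimately show ?thesis using le k \<open>\<Delta> > 0\<close> by simp
    qed
  qed
  ultimately show ?thesis using a(1) bQ by blast
qed

lemma eventually_small_multiple:
  "0 < c \<Longrightarrow> eventually (\<lambda>\<epsilon>. \<epsilon> * A < c) (at_right (0::real))"
  by (rule order_tendstoD(2)[of _ "0 * A"]) (auto intro!: tendsto_eq_intros)

text \<open>Put \<open>D = diag(0, \<dots>, m - 1)\<close>, \<open>J\<close> the all-ones matrix, \<open>E = e0 + e1 D + e2 J\<close> and \<open>F = f0 + f1 D + f2 J\<close>.
  Then \<open>fst r E + snd r F\<close> is \<open>1 - \<epsilon> D\<close> for \<open>r = ra\<close>, is \<open>1 - \<epsilon> J\<close> for \<open>r = rb\<close>, and is at most \<open>1\<close>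
  for every \<open>r \<in> Q\<close>.\<close>

lemma planar_coefficients:
  fixes Q :: "(real \<times> real) set" and m :: real
  assumes Q: "finite Q" "\<And>r. r \<in> Q \<Longrightarrow> 0 < fst r \<and> 0 < snd r" "2 \<le> card Q"
    "\<And>r r'. r \<in> Q \<Longrightarrow> r' \<in> Q \<Longrightarrow> fst r \<le> fst r' \<Longrightarrow> snd r \<le> snd r' \<Longrightarrow> r = r'"
  obtains \<epsilon> e0 e1 e2 f0 f1 f2 :: real and ra rb where
    "ra \<in> Q" "rb \<in> Q" "0 < \<epsilon>"
    "m * (\<bar>e1\<bar> + \<bar>e2\<bar>) < e0" "m * (\<bar>f1\<bar> + \<bar>f2\<bar>) < f0"
    "fst ra * e0 + snd ra * f0 = 1" "fst ra * e1 + snd ra * f1 = - \<epsilon>" "fst ra * e2 + snd ra * f2 = 0"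
    "fst rb * e0 + snd rb * f0 = 1" "fst rb * e1 + snd rb * f1 = 0" "fst rb * e2 + snd rb * f2 = - \<epsilon>"
    "\<And>r. r \<in> Q \<Longrightarrow>
      fst r * e0 + snd r * f0 = 1 \<and> fst r * e1 + snd r * f1 \<le> 0 \<and> fst r * e2 + snd r * f2 \<le> 0 \<or>
      m * (\<bar>fst r * e1 + snd r * f1\<bar> + \<bar>fst r * e2 + snd r * f2\<bar>) < 1 - (fst r * e0 + snd r * f0)"
proof -
  have "\<exists>a\<in>Q. \<exists>b\<in>Q. \<exists>\<alpha> \<gamma>. fst b < fst a \<and> snd a < snd b \<and>
    (\<forall>r\<in>Q. fst r = \<alpha> r * fst a + \<gamma> r * fst b \<and> snd r = \<alpha> r * snd a + \<gamma> r * snd b \<and>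
      (0 \<le> \<alpha> r \<and> 0 \<le> \<gamma> r \<and> \<alpha> r + \<gamma> r = 1 \<or> \<alpha> r + \<gamma> r < 1))"
    by (rule planar_edge) (use Q in blast)+
  then obtain a b \<alpha> \<gamma> where ab: "a \<in> Q" "b \<in> Q" "fst b < fst a" "snd a < snd b"
    and \<alpha>\<gamma>: "\<forall>r\<in>Q. fst r = \<alpha> r * fst a + \<gamma> r * fst b \<and> snd r = \<alpha> r * snd a + \<gamma> r * snd b \<and>
      (0 \<le> \<alpha> r \<and> 0 \<le> \<gamma> r \<and> \<alpha> r + \<gamma> r = 1 \<or> \<alpha> r + \<gamma> r < 1)" by blast
  then have comb: "fst r = \<alpha> r * fst a + \<gamma> r * fst b" "snd r = \<alpha> r * snd a + \<gamma> r * snd b"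
    and le: "0 \<le> \<alpha> r \<and> 0 \<le> \<gamma> r \<and> \<alpha> r + \<gamma> r = 1 \<or> \<alpha> r + \<gamma> r < 1" if "r \<in> Q" for r
    using that by blast+
  define \<Delta> where "\<Delta> = fst a * snd b - fst b * snd a"
  have "fst b * snd a < fst a * snd b"
    using ab Q(2)[OF ab(1)] Q(2)[OF ab(2)] by (intro mult_strict_mono) auto
  then have \<Delta>: "\<Delta> > 0" by (simp add: \<Delta>_def)
  \<comment> \<open>The linear functional with value 1 at both \<open>a\<close> and
    \<open>b\<close>.\<close>
  define e0 f0 where "e0 = (snd b - snd a) / \<Delta>" and "f0 = (fst a - fst b) / \<Delta>"
  have ef: "e0 > 0" "f0 > 0" using ab \<Delta> by (simp_all add: e0_def f0_def)
  \<comment> \<open>One small \<epsilon> keeps E and F positive definite and absorbs the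
    perturbation at the finitely many points with \<alpha> + \<gamma> < 1.\<close>
  have "eventually (\<lambda>\<epsilon>. \<epsilon> * (m * ((\<bar>snd b\<bar> + \<bar>snd a\<bar>) / \<Delta>)) < e0 \<and> \<epsilon> * (m * ((\<bar>fst b\<bar> + \<bar>fst a\<bar>) / \<Delta>)) < f0 \<and>
      (\<forall>r\<in>{r \<in> Q. \<alpha> r + \<gamma> r < 1}. \<epsilon> * (m * (\<bar>\<alpha> r\<bar> + \<bar>\<gamma> r\<bar>)) < 1 - (\<alpha> r + \<gamma> r)) \<and> 0 < \<epsilon>) (at_right 0)"
    using Q(1) ef
    by (intro eventually_conj eventually_small_multiple eventually_ball_finite ballI eventually_at_right_less) auto
  then obtain \<epsilon> where \<epsilon>: "\<epsilon> * (m * ((\<bar>snd b\<bar> + \<bar>snd a\<bar>) / \<Delta>)) < e0" "\<epsilon> * (m * ((\<bar>fst b\<bar> + \<bar>fst a\<bar>) / \<Delta>)) < f0"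
    "\<And>r. r \<in> Q \<Longrightarrow> \<alpha> r + \<gamma> r < 1 \<Longrightarrow> \<epsilon> * (m * (\<bar>\<alpha> r\<bar> + \<bar>\<gamma> r\<bar>)) < 1 - (\<alpha> r + \<gamma> r)" "0 < \<epsilon>"
    using eventually_happens'[OF trivial_limit_at_right_real] by blast
  \<comment> \<open>Up to the factor -\<epsilon> the basis dual to a, b: (e1, f1) detects
    \<open>a\<close> and (e2, f2) detects \<open>b\<close>.\<close>
  define e1 e2 f1 f2 where "e1 = - \<epsilon> * snd b / \<Delta>" and "e2 = \<epsilon> * snd a / \<Delta>"
    and "f1 = \<epsilon> * fst b / \<Delta>" and "f2 = - \<epsilon> * fst a / \<Delta>"
  note defs = e0_def f0_def e1_def e2_def f1_def f2_def
  have c: "fst a * e0 + snd a * f0 = 1" "fst a * e1 + snd a * f1 = - \<epsilon>" "fst a * e2 + snd a * f2 = 0"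
    "fst b * e0 + snd b * f0 = 1" "fst b * e1 + snd b * f1 = 0" "fst b * e2 + snd b * f2 = - \<epsilon>"
  proof -
    have "fst a * (snd b - snd a) + snd a * (fst a - fst b) = \<Delta>"
      "fst b * (snd b - snd a) + snd b * (fst a - fst b) = \<Delta>"
      "fst a * (\<epsilon> * snd b) - snd a * (\<epsilon> * fst b) = \<epsilon> * \<Delta>" by (simp_all add: \<Delta>_def algebra_simps)
    with \<Delta> show "fst a * e0 + snd a * f0 = 1" "fst a * e1 + snd a * f1 = - \<epsilon>" "fst a * e2 + snd a * f2 = 0"
      "fst b * e0 + snd b * f0 = 1" "fst b * e1 + snd b * f1 = 0" "fst b * e2 + snd b * f2 = - \<epsilon>"
      by (simp_all add: defs field_simps)
  qed
  have r: "fst r * e0 + snd r * f0 = \<alpha> r + \<gamma> r" "fst r * e1 + snd r * f1 = - \<epsilon> * \<alpha> r"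
    "fst r * e2 + snd r * f2 = - \<epsilon> * \<gamma> r" if "r \<in> Q" for r
  proof -
    have lin: "fst r * x + snd r * y = \<alpha> r * (fst a * x + snd a * y) + \<gamma> r * (fst b * x + snd b * y)" for x y
      using comb[OF that] by (simp add: algebra_simps)
    show "fst r * e0 + snd r * f0 = \<alpha> r + \<gamma> r" "fst r * e1 + snd r * f1 = - \<epsilon> * \<alpha> r"
      "fst r * e2 + snd r * f2 = - \<epsilon> * \<gamma> r" by (simp_all add: lin c)
  qed
  show ?thesis
  proof (rule that[OF ab(1,2) \<epsilon>(4) _ _ c])
    show "m * (\<bar>e1\<bar> + \<bar>e2\<bar>) < e0" "m * (\<bar>f1\<bar> + \<bar>f2\<bar>) < f0"
      using \<epsilon>(1,2,4) \<Delta> by (simp_all add: e1_def e2_def f1_def f2_def abs_mult abs_divide add_divide_distrib algebra_simps)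
    fix r assume rQ: "r \<in> Q"
    show "fst r * e0 + snd r * f0 = 1 \<and> fst r * e1 + snd r * f1 \<le> 0 \<and> fst r * e2 + snd r * f2 \<le> 0 \<or>
      m * (\<bar>fst r * e1 + snd r * f1\<bar> + \<bar>fst r * e2 + snd r * f2\<bar>) < 1 - (fst r * e0 + snd r * f0)"
      unfolding r[OF rQ] using le[OF rQ] \<epsilon>(3)[OF rQ] \<epsilon>(4)
      by (auto simp: abs_mult algebra_simps)
  qed
qed

section \<open>Unital subalgebras of complex matrices\<close>

lemma subalgebraD:
  assumes "subalgebra n B"
  shows "A \<in> B \<Longrightarrow> A \<in> carrier_mat n n" "1\<^sub>m n \<in> B" "A \<in> B \<Longrightarrow> A' \<in> B \<Longrightarrow> A + A' \<in> B"
    "A \<in> B \<Longrightarrow> A' \<in> B \<Longrightarrow> A * A' \<in> B" "A \<in> B \<Longrightarrow> z \<cdot>\<^sub>m A \<in> B"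
  using assms by (auto simp: subalgebra_def)

lemma subalgebra_diff: "subalgebra n B \<Longrightarrow> A \<in> B \<Longrightarrow> A' \<in> B \<Longrightarrow> A - A' \<in> B"
proof -
  assume B: "subalgebra n B" and A: "A \<in> B" "A' \<in> B"
  have "A - A' = A + (- 1) \<cdot>\<^sub>m A'"
    using subalgebraD(1)[OF B A(1)] subalgebraD(1)[OF B A(2)] by (intro eq_matI) auto
  then show ?thesis using subalgebraD[OF B] A by simp
qed

lemma subalgebra_pow: "subalgebra n B \<Longrightarrow> A \<in> B \<Longrightarrow> A ^\<^sub>m k \<in> B"
  using subalgebraD(1)[of n B A] by (induction k) (auto intro: subalgebraD)

lemma subalgebra_sum:
  assumes B: "subalgebra n B" and A: "\<And>i. i \<in> I \<Longrightarrow> A i \<in> B" and I: "finite I"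
  shows "mat n n (\<lambda>ij. \<Sum>i\<in>I. A i $$ ij) \<in> B"
  using I A
proof (induction I)
  case empty
  have "mat n n (\<lambda>ij. 0) = 0 \<cdot>\<^sub>m (1\<^sub>m n :: complex mat)" by (intro eq_matI) auto
  then show ?case using subalgebraD[OF B] by simp
next
  case (insert i I)
  have "mat n n (\<lambda>ij. \<Sum>i\<in>insert i I. A i $$ ij) = A i + mat n n (\<lambda>ij. \<Sum>i\<in>I. A i $$ ij)"
    using insert.hyps subalgebraD(1)[OF B insert.prems[of i]] by (intro eq_matI) auto
  then show ?case using insert subalgebraD(3)[OF B] by simp
qed

lemma subalgebra_all:
  assumes B: "subalgebra n B" and units: "\<And>i j. i < n \<Longrightarrow> j < n \<Longrightarrow> unit_mat n i j \<in> B"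
  shows "carrier_mat n n \<subseteq> B"
proof
  fix M :: "complex mat" assume M: "M \<in> carrier_mat n n"
  have "mat n n (\<lambda>ij. \<Sum>kl\<in>{..<n} \<times> {..<n}. (M $$ kl \<cdot>\<^sub>m unit_mat n (fst kl) (snd kl)) $$ ij) \<in> B"
    by (rule subalgebra_sum[OF B]) (auto intro!: subalgebraD(5)[OF B] units)
  also have "mat n n (\<lambda>ij. \<Sum>kl\<in>{..<n} \<times> {..<n}. (M $$ kl \<cdot>\<^sub>m unit_mat n (fst kl) (snd kl)) $$ ij) = M"
  proof (rule eq_matI)
    fix i j assume "i < dim_row M" "j < dim_col M"
    then have ij: "i < n" "j < n" using M by auto
    have "(\<Sum>kl\<in>{..<n} \<times> {..<n}. (M $$ kl \<cdot>\<^sub>m unit_mat n (fst kl) (snd kl)) $$ (i, j))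
        = (\<Sum>kl\<in>{..<n} \<times> {..<n}. if kl = (i, j) then M $$ (i, j) else 0)"
      using ij by (intro sum.cong) (auto simp: unit_mat_def)
    then show "mat n n (\<lambda>ij. \<Sum>kl\<in>{..<n} \<times> {..<n}. (M $$ kl \<cdot>\<^sub>m unit_mat n (fst kl) (snd kl)) $$ ij) $$ (i, j) = M $$ (i, j)"
      using ij by simp
  qed (use M in auto)
  finally show "M \<in> B" .
qed

text \<open>More than \<open>n\<^sup>2\<close> powers of a matrix are linearly dependent; cancelling the lowest power in a
  dependency expresses the inverse as a polynomial.\<close>

lemma subalgebra_inverse:
  assumes B: "subalgebra n B" and A: "A \<in> B" and A': "A' \<in> carrier_mat n n" "A' * A = 1\<^sub>m n"
  shows "A' \<in> B"
proof -
  have Ac: "A \<in> carrier_mat n n" by (rule subalgebraD(1)[OF B A])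
  have pc: "A ^\<^sub>m k \<in> carrier_mat n n" for k using Ac by simp
  define N where "N = n * n"
  \<comment> \<open>Column k lists the entries of the k-th power; the extra zero row makes the
    matrix square and singular, so a nontrivial dependency exists.\<close>
  define G where "G = mat (Suc N) (Suc N) (\<lambda>(r, k). if r < N then (A ^\<^sub>m k) $$ (r div n, r mod n) else 0)"
  have G: "G \<in> carrier_mat (Suc N) (Suc N)" by (simp add: G_def)
  have "Determinant.det G = 0"
  proof -
    have "(\<Prod>i = 0..<Suc N. G $$ (i, p i)) = 0" if "p permutes {0..<Suc N}" for p
    proof (rule prod_zero)
      have "p N < Suc N" using permutes_in_image[OF that, of N] by simp
      then show "\<exists>i\<in>{0..<Suc N}. G $$ (i, p i) = 0" by (intro bexI[of _ N]) (simp_all add: G_def)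
    qed simp
    then show ?thesis unfolding Determinant.det_def'[OF G] by (intro sum.neutral) simp
  qed
  then obtain v where v: "v \<in> carrier_vec (Suc N)" "v \<noteq> 0\<^sub>v (Suc N)" "G *\<^sub>v v = 0\<^sub>v (Suc N)"
    using det_0_iff_vec_prod_zero[OF G] by blast
  have rel: "(\<Sum>k<Suc N. v $ k * (A ^\<^sub>m k) $$ (i, j)) = 0" if ij: "i < n" "j < n" for i j
  proof -
    have "i * n + j < Suc i * n" using ij by simp
    also have "\<dots> \<le> n * n" using ij by (intro mult_le_mono1) simp
    finally have r: "i * n + j < N" by (simp add: N_def)
    have "(G *\<^sub>v v) $ (i * n + j) = 0" using v(3) r by simp
    then show ?thesis
      using r ij v(1) by (simp add: G_def scalar_prod_def lessThan_atLeast0 mult.commute del: sum.op_ivl_Suc)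
  qed
  have "A' \<in> B" if "\<exists>k<K. c k \<noteq> 0" "\<And>i j. i < n \<Longrightarrow> j < n \<Longrightarrow> (\<Sum>k<K. c k * (A ^\<^sub>m k) $$ (i, j)) = 0" for K c
    using that
  proof (induction K arbitrary: c)
    case (Suc K)
    \<comment> \<open>The dependency reads c 0 + P A = 0. If c 0 = 0, invertibility of A leaves the
      shorter dependency P = 0; otherwise A' = - P / c 0.\<close>
    define P where "P = mat n n (\<lambda>ij. \<Sum>k<K. (c (Suc k) \<cdot>\<^sub>m A ^\<^sub>m k) $$ ij)"
    have PB: "P \<in> B" unfolding P_def by (intro subalgebra_sum[OF B] subalgebraD(5)[OF B] subalgebra_pow[OF B A]) auto
    have Pc: "P \<in> carrier_mat n n" by (simp add: P_def)
    have e: "c 0 \<cdot>\<^sub>m 1\<^sub>m n + P * A = 0\<^sub>m n n"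
    proof (rule eq_matI)
      fix i j assume "i < dim_row (0\<^sub>m n n :: complex mat)" "j < dim_col (0\<^sub>m n n :: complex mat)"
      then have ij: "i < n" "j < n" by auto
      have "(P * A) $$ (i, j) = (\<Sum>l<n. \<Sum>k<K. c (Suc k) * (A ^\<^sub>m k) $$ (i, l) * A $$ (l, j))"
        using ij Ac by (simp add: P_def scalar_prod_def lessThan_atLeast0 sum_distrib_right)
      also have "\<dots> = (\<Sum>k<K. \<Sum>l<n. c (Suc k) * (A ^\<^sub>m k) $$ (i, l) * A $$ (l, j))" by (rule sum.swap)
      also have "\<dots> = (\<Sum>k<K. c (Suc k) * (A ^\<^sub>m Suc k) $$ (i, j))"
        using ij Ac pc by (simp add: scalar_prod_def lessThan_atLeast0 sum_distrib_left mult.assoc)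
      finally have "(c 0 \<cdot>\<^sub>m 1\<^sub>m n + P * A) $$ (i, j) = (\<Sum>k<Suc K. c k * (A ^\<^sub>m k) $$ (i, j))"
        using ij Ac Pc by (simp add: sum.lessThan_Suc_shift del: sum.lessThan_Suc)
      then show "(c 0 \<cdot>\<^sub>m 1\<^sub>m n + P * A) $$ (i, j) = 0\<^sub>m n n $$ (i, j)" using Suc.prems(2)[OF ij] ij by simp
    qed (use Ac Pc in auto)
    have AA': "A * A' = 1\<^sub>m n" using mat_mult_left_right_inverse[OF A'(1) Ac A'(2)] .
    have e': "c 0 \<cdot>\<^sub>m A' + P = 0\<^sub>m n n"
    proof -
      have "c 0 \<cdot>\<^sub>m A' + P = (c 0 \<cdot>\<^sub>m 1\<^sub>m n + P * A) * A'"
        using A' Ac Pc by (simp add: add_mult_distrib_mat[of _ n n _ _ n] mult_smult_assoc_mat[of _ n n _ n]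
            assoc_mult_mat[of _ n n _ n _ n] AA')
      then show ?thesis unfolding e using A' by simp
    qed
    show ?case
    proof (cases "c 0 = 0")
      case False
      have "A' = (- 1 / c 0) \<cdot>\<^sub>m P"
      proof (rule eq_matI)
        fix i j assume "i < dim_row ((- 1 / c 0) \<cdot>\<^sub>m P)" "j < dim_col ((- 1 / c 0) \<cdot>\<^sub>m P)"
        then have ij: "i < n" "j < n" using Pc by auto
        have "(c 0 \<cdot>\<^sub>m A' + P) $$ (i, j) = 0" unfolding e' using ij by simp
        then have "c 0 * A' $$ (i, j) + P $$ (i, j) = 0" using ij A' Pc by simp
        then show "A' $$ (i, j) = ((- 1 / c 0) \<cdot>\<^sub>m P) $$ (i, j)"
          using ij Pc False by (simp add: field_simps add_eq_0_iff)
      qed (use A' Pc in auto)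
      then show ?thesis using subalgebraD(5)[OF B PB] by simp
    next
      case True
      have "P = 0\<^sub>m n n" using e' True A' Pc by (intro eq_matI) (auto simp: mat_eq_iff)
      show ?thesis
      proof (rule Suc.IH[of "\<lambda>k. c (Suc k)"])
        obtain k where "k < Suc K" "c k \<noteq> 0" using Suc.prems(1) by blast
        with True show "\<exists>k<K. c (Suc k) \<noteq> 0" by (cases k) auto
        fix i j assume ij: "i < n" "j < n"
        have "P $$ (i, j) = 0" unfolding \<open>P = 0\<^sub>m n n\<close> using ij by simp
        then show "(\<Sum>k<K. c (Suc k) * (A ^\<^sub>m k) $$ (i, j)) = 0"
          using ij Ac by (simp add: P_def)
      qed
    qed
  qed simp
  moreover have "\<exists>k<Suc N. v $ k \<noteq> 0"
  proof (rule ccontr)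
    assume "\<not> ?thesis"
    then have "v = 0\<^sub>v (Suc N)" using v(1) by (intro eq_vecI) auto
    then show False using v(2) by simp
  qed
  ultimately show ?thesis using rel by blast
qed

section \<open>A pencil of size twice m\<close>

text \<open>The span of 1, D and J, which contains E, F and all 1 - E / x - F / z; its members are
  real symmetric.\<close>

definition diag_ones :: "nat \<Rightarrow> real \<Rightarrow> real \<Rightarrow> real \<Rightarrow> complex mat" where
  "diag_ones m x y z = mat m m (\<lambda>(i, j). of_real ((if i = j then x + y * real i else 0) + z))"

lemma diag_ones_carrier [simp]: "diag_ones m x y z \<in> carrier_mat m m"
  by (simp add: diag_ones_def)

lemma diag_ones_index:
  "i < m \<Longrightarrow> j < m \<Longrightarrow> diag_ones m x y z $$ (i, j) = of_real ((if i = j then x + y * real i else 0) + z)"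
  by (simp add: diag_ones_def)

lemma diag_ones_Her: "diag_ones m x y z \<in> Her m"
  unfolding Her_iff by (auto simp: diag_ones_index)

lemma quad_form_diag_ones:
  "quad_form m (entries (diag_ones m x y z)) v
    = of_real ((\<Sum>i<m. (x + y * real i) * (cmod (v i))\<^sup>2) + z * (cmod (\<Sum>i<m. v i))\<^sup>2)"
proof -
  have sq: "cnj a * a = of_real ((cmod a)\<^sup>2)" for a
    by (metis complex_norm_square mult.commute of_real_power)
  have "quad_form m (entries (diag_ones m x y z)) v
    = (\<Sum>i<m. (\<Sum>j<m. if j = i then of_real (x + y * real i) * (cnj (v i) * v i) else 0)
        + (\<Sum>j<m. of_real z * (cnj (v i) * v j)))"
    unfolding quad_form_def sum.distrib[symmetric]
    by (intro sum.cong refl) (auto simp: diag_ones_index algebra_simps)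
  also have "\<dots> = (\<Sum>i<m. of_real (x + y * real i) * (cnj (v i) * v i)) + of_real z * (cnj (\<Sum>i<m. v i) * (\<Sum>i<m. v i))"
  proof -
    have "cnj (\<Sum>i<m. v i) * (\<Sum>i<m. v i) = (\<Sum>i<m. \<Sum>j<m. cnj (v i) * v j)"
      by (simp only: cnj_sum sum_product)
    then show ?thesis by (simp add: sum.distrib sum_distrib_left)
  qed
  finally show ?thesis by (simp only: sq of_real_add of_real_sum of_real_mult)
qed

text \<open>As forms, D lies between 0 and m, and so does J by the Cauchy-Schwarz inequality; the
  two perturbations together cost at most m (\<bar>y\<bar> + \<bar>z\<bar>).\<close>

lemma quad_form_diag_ones_ge:
  fixes m :: nat
  assumes "real m * (\<bar>y\<bar> + \<bar>z\<bar>) \<le> x - \<delta>"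
  shows "of_real \<delta> * (\<Sum>i<m. cnj (v i) * v i) \<le> quad_form m (entries (diag_ones m x y z)) v"
proof -
  define S where "S = (\<Sum>i<m. (cmod (v i))\<^sup>2)"
  have "S \<ge> 0" by (simp add: S_def sum_nonneg)
  have "cnj a * a = of_real ((cmod a)\<^sup>2)" for a
    by (metis complex_norm_square mult.commute of_real_power)
  then have N: "(\<Sum>i<m. cnj (v i) * v i) = of_real S" by (simp add: S_def)
  have "(x - real m * \<bar>y\<bar>) * S = (\<Sum>i<m. (x - real m * \<bar>y\<bar>) * (cmod (v i))\<^sup>2)"
    by (simp add: S_def sum_distrib_left)
  also have "\<dots> \<le> (\<Sum>i<m. (x + y * real i) * (cmod (v i))\<^sup>2)"
  proof (intro sum_mono mult_right_mono)
    fix i assume "i \<in> {..<m}"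
    then have "real i * \<bar>y\<bar> \<le> real m * \<bar>y\<bar>" by (intro mult_right_mono) auto
    moreover have "- (real i * \<bar>y\<bar>) \<le> y * real i"
      by (metis abs_ge_minus_self abs_mult abs_of_nat minus_le_iff mult.commute)
    ultimately show "x - real m * \<bar>y\<bar> \<le> x + y * real i" by linarith
  qed simp
  finally have 1: "(x - real m * \<bar>y\<bar>) * S \<le> (\<Sum>i<m. (x + y * real i) * (cmod (v i))\<^sup>2)" .
  have "(cmod (\<Sum>i<m. v i))\<^sup>2 \<le> (\<Sum>i<m. cmod (v i))\<^sup>2"
    by (intro power_mono norm_sum) simp
  also have "\<dots> \<le> real m * S"
    using sum_squared_le_sum_of_squares[of "\<lambda>i. cmod (v i)" "{..<m}"] by (simp add: S_def mult.commute)
  finally have "\<bar>z\<bar> * (cmod (\<Sum>i<m. v i))\<^sup>2 \<le> \<bar>z\<bar> * (real m * S)" by (intro mult_left_mono) auto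
  moreover have "- (\<bar>z\<bar> * (cmod (\<Sum>i<m. v i))\<^sup>2) \<le> z * (cmod (\<Sum>i<m. v i))\<^sup>2"
    by (metis abs_ge_minus_self abs_mult abs_power2 minus_le_iff)
  ultimately have 2: "- (real m * \<bar>z\<bar>) * S \<le> z * (cmod (\<Sum>i<m. v i))\<^sup>2" by (simp add: algebra_simps)
  have "\<delta> * S \<le> (x - real m * (\<bar>y\<bar> + \<bar>z\<bar>)) * S" using assms \<open>S \<ge> 0\<close> by (intro mult_right_mono) auto
  also have "\<dots> = (x - real m * \<bar>y\<bar>) * S + - (real m * \<bar>z\<bar>) * S" by (simp add: algebra_simps)
  also have "\<dots> \<le> (\<Sum>i<m. (x + y * real i) * (cmod (v i))\<^sup>2) + z * (cmod (\<Sum>i<m. v i))\<^sup>2"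
    using 1 2 by (rule add_mono)
  finally show ?thesis unfolding quad_form_diag_ones N by (simp add: less_eq_complex_def)
qed

text \<open>D has distinct eigenvalues, so Lagrange interpolation yields the diagonal units e(k, k)
  as polynomials in D; all entries of J are 1, hence e(k, k) J e(l, l) = e(k, l).\<close>

lemma diag_ones_generate:
  assumes B: "subalgebra m B" and D: "diag_ones m 0 1 0 \<in> B" and J: "diag_ones m 0 0 1 \<in> B"
  shows "carrier_mat m m \<subseteq> B"
proof (rule subalgebra_all[OF B])
  have diag: "mat m m (\<lambda>(i, j). if i = j then \<Prod>l\<in>S. (of_nat i - of_nat l) / (of_nat k - of_nat l) else (0::complex)) \<in> B"
    if "finite S" for S :: "nat set" and k
    using that
  proof (induction S)
    case empty
    have "mat m m (\<lambda>(i, j). if i = j then \<Prod>l\<in>{}. (of_nat i - of_nat l) / (of_nat k - of_nat l) else 0) = (1\<^sub>m m :: complex mat)"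
      by (intro eq_matI) auto
    then show ?case using subalgebraD(2)[OF B] by simp
  next
    case (insert a S)
    define P :: "complex mat" where "P = mat m m (\<lambda>(i, j). if i = j then \<Prod>l\<in>S. (of_nat i - of_nat l) / (of_nat k - of_nat l) else 0)"
    define R where "R = (1 / (of_nat k - of_nat a)) \<cdot>\<^sub>m (diag_ones m 0 1 0 - of_nat a \<cdot>\<^sub>m 1\<^sub>m m)"
    have "R \<in> B" unfolding R_def
      by (intro subalgebraD(5)[OF B] subalgebra_diff[OF B] D subalgebraD(2)[OF B])
    then have "R * P \<in> B" using insert.IH subalgebraD(4)[OF B] by (simp add: P_def)
    also have "R * P = mat m m (\<lambda>(i, j). if i = j then \<Prod>l\<in>insert a S. (of_nat i - of_nat l) / (of_nat k - of_nat l) else 0)"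
    proof (rule eq_matI)
      fix i j assume "i < dim_row (mat m m (\<lambda>(i, j). if i = j then \<Prod>l\<in>insert a S. (of_nat i - of_nat l) / (of_nat k - of_nat l) else (0::complex)))"
        "j < dim_col (mat m m (\<lambda>(i, j). if i = j then \<Prod>l\<in>insert a S. (of_nat i - of_nat l) / (of_nat k - of_nat l) else (0::complex)))"
      then have ij: "i < m" "j < m" by auto
      have "(R * P) $$ (i, j) = (\<Sum>l = 0..<m. R $$ (i, l) * P $$ (l, j))"
        using ij by (simp add: R_def P_def scalar_prod_def diag_ones_def)
      also have "\<dots> = (\<Sum>l = 0..<m. if l = i then R $$ (i, i) * P $$ (i, j) else 0)"
        using ij by (intro sum.cong) (auto simp: R_def diag_ones_index)
      finally have "(R * P) $$ (i, j) = R $$ (i, i) * P $$ (i, j)" using ij by simp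
      moreover have "R $$ (i, i) = (of_nat i - of_nat a) / (of_nat k - of_nat a)"
        using ij by (simp add: R_def diag_ones_index)
      ultimately show "(R * P) $$ (i, j) = mat m m (\<lambda>(i, j). if i = j then \<Prod>l\<in>insert a S. (of_nat i - of_nat l) / (of_nat k - of_nat l) else 0) $$ (i, j)"
        using ij insert.hyps by (simp add: P_def)
    qed (auto simp: R_def P_def)
    finally show ?case .
  qed
  have e: "unit_mat m k k \<in> B" if k: "k < m" for k
  proof -
    have "mat m m (\<lambda>(i, j). if i = j then \<Prod>l\<in>{..<m} - {k}. (of_nat i - of_nat l) / (of_nat k - of_nat l) else (0::complex)) = unit_mat m k k"
    proof (rule eq_matI)
      fix i j assume "i < dim_row (unit_mat m k k :: complex mat)" "j < dim_col (unit_mat m k k :: complex mat)"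
      then have ij: "i < m" "j < m" by (auto simp: unit_mat_def)
      have "(\<Prod>l\<in>{..<m} - {k}. (of_nat i - of_nat l) / (of_nat k - of_nat l)) = (if i = k then 1 else (0::complex))"
      proof (cases "i = k")
        case True
        then show ?thesis by (auto intro!: prod.neutral)
      next
        case False
        then show ?thesis using ij by (auto intro!: bexI[of _ i])
      qed
      then show "mat m m (\<lambda>(i, j). if i = j then \<Prod>l\<in>{..<m} - {k}. (of_nat i - of_nat l) / (of_nat k - of_nat l) else (0::complex)) $$ (i, j)
        = unit_mat m k k $$ (i, j)" using ij by (auto simp: unit_mat_def)
    qed (auto simp: unit_mat_def)
    then show ?thesis using diag[of "{..<m} - {k}" k] by simp
  qed
  fix k l assume kl: "k < m" "l < m"
  have "unit_mat m k k * diag_ones m 0 0 1 * unit_mat m l l \<in> B"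
    by (intro subalgebraD(4)[OF B] e kl J)
  also have "unit_mat m k k * diag_ones m 0 0 1 * unit_mat m l l = unit_mat m k l"
  proof (rule eq_matI)
    fix i j assume "i < dim_row (unit_mat m k l :: complex mat)" "j < dim_col (unit_mat m k l :: complex mat)"
    then have ij: "i < m" "j < m" by (auto simp: unit_mat_def)
    have c: "unit_mat m k k * diag_ones m 0 0 1 \<in> carrier_mat m m"
      by (rule mult_carrier_mat[OF unit_mat_carrier diag_ones_carrier])
    show "(unit_mat m k k * diag_ones m 0 0 1 * unit_mat m l l) $$ (i, j) = unit_mat m k l $$ (i, j)"
      using mult_unit_mat_index[OF c kl(2) ij, of l] unit_mat_mult_index[OF diag_ones_carrier kl(1) ij(1) kl(2), of k 0 0 1] ij kl
      by (auto simp: unit_mat_def diag_ones_index)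
  qed (auto simp: unit_mat_def)
  finally show "unit_mat m k l \<in> B" .
qed

section \<open>Matrices acting on coordinate functions\<close>

lemma mv_cong: "(\<And>j. j < m \<Longrightarrow> v j = w j) \<Longrightarrow> mv m A v i = mv m A w i"
  by (simp add: mv_def)

lemma mv_mult:
  assumes "A \<in> carrier_mat m m" "B \<in> carrier_mat m m" "i < m"
  shows "mv m (A * B) v i = mv m A (mv m B v) i"
proof -
  have "mv m A (mv m B v) i = (\<Sum>k<m. \<Sum>j<m. A $$ (i, k) * B $$ (k, j) * v j)"
    by (simp add: mv_def sum_distrib_left mult.assoc)
  also have "\<dots> = (\<Sum>j<m. \<Sum>k<m. A $$ (i, k) * B $$ (k, j) * v j)" by (rule sum.swap)
  also have "\<dots> = mv m (A * B) v i"
    using assms by (simp add: mv_def scalar_prod_def lessThan_atLeast0 sum_distrib_right)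
  finally show ?thesis ..
qed

lemma mv_one: "i < m \<Longrightarrow> mv m (1\<^sub>m m) v i = v i"
proof -
  assume "i < m"
  then have "mv m (1\<^sub>m m) v i = (\<Sum>j<m. if j = i then v i else 0)"
    unfolding mv_def by (intro sum.cong) auto
  then show ?thesis using \<open>i < m\<close> by simp
qed

lemma mv_linear:
  "mv m A (\<lambda>j. v j + w j) i = mv m A v i + mv m A w i"
  "mv m A (\<lambda>j. z * v j) i = z * mv m A v i"
  by (simp_all add: mv_def algebra_simps sum.distrib sum_distrib_left)

text \<open>Rows are paired with vectors without conjugation, which calls for symmetry;
  \<open>sum_mv_hermitian\<close> is the counterpart for forms.\<close>

lemma sum_mv_symmetric:
  assumes "\<And>i j. i < m \<Longrightarrow> j < m \<Longrightarrow> A $$ (i, j) = A $$ (j, i)"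
  shows "(\<Sum>i<m. a i * mv m A b i) = (\<Sum>i<m. mv m A a i * b i)"
proof -
  have "(\<Sum>i<m. a i * mv m A b i) = (\<Sum>i<m. \<Sum>j<m. a i * A $$ (i, j) * b j)"
    by (simp add: mv_def sum_distrib_left mult.assoc)
  also have "\<dots> = (\<Sum>j<m. \<Sum>i<m. a i * A $$ (i, j) * b j)" by (rule sum.swap)
  also have "\<dots> = (\<Sum>j<m. \<Sum>i<m. A $$ (j, i) * a i * b j)"
    by (intro sum.cong refl) (use assms in \<open>simp add: mult.commute\<close>)
  also have "\<dots> = (\<Sum>j<m. mv m A a j * b j)" by (simp add: mv_def sum_distrib_right)
  finally show ?thesis .
qed

lemma quad_form_mv: "quad_form m (entries A) v = (\<Sum>i<m. cnj (v i) * mv m A v i)"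
  by (simp add: quad_form_def mv_def sum_distrib_left mult.assoc)

lemma sum_double: "(\<Sum>p<m + (m::nat). f p) = (\<Sum>i<m. f i) + (\<Sum>i<m. f (m + i) :: 'c::comm_monoid_add)"
proof -
  have "(\<Sum>p<m + k. f p) = (\<Sum>i<m. f i) + (\<Sum>i<k. f (m + i))" for k
    by (induction k) (simp_all add: add.assoc)
  then show ?thesis .
qed

text \<open>For invertible E and F all three matrices have rank m. Their kernels of dimension m are
  large enough to reduce the three values of a row family to m parameters each.\<close>

definition pencil_mat :: "nat \<Rightarrow> complex mat \<Rightarrow> complex mat \<Rightarrow> nat \<Rightarrow> complex mat" where
  "pencil_mat m E F k =
    (if k = 0 then four_block_mat E (0\<^sub>m m m) (0\<^sub>m m m) (0\<^sub>m m m)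
     else if k = 1 then four_block_mat (E * E) (E * F) (F * E) (F * F)
     else four_block_mat (0\<^sub>m m m) (0\<^sub>m m m) (0\<^sub>m m m) F)"

text \<open>The value at x c1 + y c2 + z c3.\<close>

definition pencil :: "nat \<Rightarrow> complex mat \<Rightarrow> complex mat \<Rightarrow> real \<Rightarrow> real \<Rightarrow> real \<Rightarrow> complex mat" where
  "pencil m E F x y z = mat (m + m) (m + m) (\<lambda>(i, j).
     of_real x * pencil_mat m E F 0 $$ (i, j) + of_real y * pencil_mat m E F 1 $$ (i, j)
     + of_real z * pencil_mat m E F 2 $$ (i, j))"

lemma pencil_mat_carrier:
  "E \<in> carrier_mat m m \<Longrightarrow> F \<in> carrier_mat m m \<Longrightarrow> pencil_mat m E F k \<in> carrier_mat (m + m) (m + m)"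
  by (simp add: pencil_mat_def)

text \<open>The middle matrix acts on v only through w = E v0 + F v1, where v0 and v1 are the halves
  of v.\<close>

lemma pencil_mv:
  fixes x y z :: real
  assumes E: "E \<in> carrier_mat m m" and F: "F \<in> carrier_mat m m" and i: "i < m"
  defines "w \<equiv> \<lambda>v i. mv m E v i + mv m F (\<lambda>j. v (m + j)) i"
  shows "mv (m + m) (pencil m E F x y z) v i = of_real x * mv m E v i + of_real y * mv m E (w v) i"
    "mv (m + m) (pencil m E F x y z) v (m + i)
      = of_real z * mv m F (\<lambda>j. v (m + j)) i + of_real y * mv m F (w v) i"
proof -
  have d: "dim_row E = m" "dim_col E = m" "dim_row F = m" "dim_col F = m" using E F by auto
  have p: "pencil m E F x y z $$ (i, j) = of_real x * E $$ (i, j) + of_real y * (E * E) $$ (i, j)"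
    "pencil m E F x y z $$ (i, m + j) = of_real y * (E * F) $$ (i, j)"
    "pencil m E F x y z $$ (m + i, j) = of_real y * (F * E) $$ (i, j)"
    "pencil m E F x y z $$ (m + i, m + j) = of_real z * F $$ (i, j) + of_real y * (F * F) $$ (i, j)"
    if "j < m" for j
    using that i d by (simp_all add: pencil_def pencil_mat_def)
  have "mv (m + m) (pencil m E F x y z) v i
      = of_real x * mv m E v i + of_real y * (mv m (E * E) v i + mv m (E * F) (\<lambda>j. v (m + j)) i)"
    by (simp add: mv_def sum_double p distrib_right sum.distrib distrib_left sum_distrib_left mult.assoc)
  also have "mv m (E * E) v i + mv m (E * F) (\<lambda>j. v (m + j)) i = mv m E (w v) i"
    by (simp add: mv_mult E F i w_def mv_linear)
  finally show "mv (m + m) (pencil m E F x y z) v i = of_real x * mv m E v i + of_real y * mv m E (w v) i" .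
  have "mv (m + m) (pencil m E F x y z) v (m + i)
      = of_real z * mv m F (\<lambda>j. v (m + j)) i + of_real y * (mv m (F * E) v i + mv m (F * F) (\<lambda>j. v (m + j)) i)"
    by (simp add: mv_def sum_double p distrib_right sum.distrib distrib_left sum_distrib_left mult.assoc)
  also have "mv m (F * E) v i + mv m (F * F) (\<lambda>j. v (m + j)) i = mv m F (w v) i"
    by (simp add: mv_mult E F i w_def mv_linear)
  finally show "mv (m + m) (pencil m E F x y z) v (m + i)
      = of_real z * mv m F (\<lambda>j. v (m + j)) i + of_real y * mv m F (w v) i" .
qed

lemma sum_mv_hermitian:
  assumes "A \<in> Her m"
  shows "(\<Sum>i<m. cnj (a i) * mv m A b i) = (\<Sum>i<m. cnj (mv m A a i) * b i)"
proof -
  have h: "cnj (A $$ (i, j)) = A $$ (j, i)" if "i < m" "j < m" for i j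
  proof -
    have "A $$ (j, i) = cnj (A $$ (i, j))" using assms that unfolding Her_iff by blast
    then show ?thesis by (rule sym)
  qed
  have "(\<Sum>i<m. cnj (a i) * mv m A b i) = (\<Sum>i<m. \<Sum>j<m. cnj (a i) * A $$ (i, j) * b j)"
    by (simp add: mv_def sum_distrib_left mult.assoc)
  also have "\<dots> = (\<Sum>j<m. \<Sum>i<m. cnj (a i) * A $$ (i, j) * b j)" by (rule sum.swap)
  also have "\<dots> = (\<Sum>j<m. \<Sum>i<m. cnj (A $$ (j, i) * a i) * b j)"
    by (intro sum.cong refl) (simp add: h mult.commute)
  also have "\<dots> = (\<Sum>j<m. cnj (mv m A a j) * b j)" by (simp add: mv_def sum_distrib_right)
  finally show ?thesis .
qed

lemma quad_form_pencil:
  fixes x y z :: real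
  assumes E: "E \<in> Her m" and F: "F \<in> Her m"
  defines "w \<equiv> \<lambda>v i. mv m E v i + mv m F (\<lambda>j. v (m + j)) i"
  shows "quad_form (m + m) (entries (pencil m E F x y z)) v =
    of_real x * quad_form m (entries E) v + of_real z * quad_form m (entries F) (\<lambda>j. v (m + j))
    + of_real y * (\<Sum>i<m. cnj (w v i) * w v i)"
proof -
  have c: "E \<in> carrier_mat m m" "F \<in> carrier_mat m m" using E F by (auto simp: Her_def)
  have "quad_form (m + m) (entries (pencil m E F x y z)) v
    = of_real x * quad_form m (entries E) v + of_real z * quad_form m (entries F) (\<lambda>j. v (m + j))
     + of_real y * ((\<Sum>i<m. cnj (v i) * mv m E (w v) i) + (\<Sum>i<m. cnj (v (m + i)) * mv m F (w v) i))"
    unfolding quad_form_mv sum_double w_def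
    by (simp add: pencil_mv[OF c] distrib_left sum.distrib sum_distrib_left mult_ac)
  also have "(\<Sum>i<m. cnj (v i) * mv m E (w v) i) + (\<Sum>i<m. cnj (v (m + i)) * mv m F (w v) i)
      = (\<Sum>i<m. cnj (w v i) * w v i)"
    unfolding sum_mv_hermitian[OF E, of v "w v"] sum_mv_hermitian[OF F, of "\<lambda>i. v (m + i)" "w v"]
    by (simp add: w_def distrib_right distrib_left sum.distrib)
  finally show ?thesis .
qed

text \<open>Positivity of the pencil at \<open>x c\<^sub>1 - c\<^sub>2 + z c\<^sub>3\<close>: with \<open>w = E v\<^sub>0 + F v\<^sub>1\<close> the form is
  \<open>x \<langle>E v\<^sub>0, v\<^sub>0\<rangle> + z \<langle>F v\<^sub>1, v\<^sub>1\<rangle> - \<parallel>w\<parallel>\<^sup>2\<close>, and \<open>2 \<parallel>w\<parallel>\<^sup>2\<close> is estimated by Cauchy-Schwarz for \<open>E\<close> and \<open>F\<close>.\<close>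

lemma pencil_nonneg:
  fixes x z :: real
  assumes E: "psd m E" and F: "psd m F" and xz: "0 < x" "0 < z"
    and bound: "\<And>w. Re (quad_form m (entries E) w) / x + Re (quad_form m (entries F) w) / z \<le> (\<Sum>i<m. (cmod (w i))\<^sup>2)"
  shows "0 \<le> quad_form (m + m) (entries (pencil m E F x (- 1) z)) v"
proof -
  have H: "E \<in> Her m" "F \<in> Her m" using E F by (auto simp: psd_iff)
  define v1 where "v1 = (\<lambda>j. v (m + j))"
  define w where "w = (\<lambda>i. mv m E v i + mv m F v1 i)"
  have sq: "cnj a * a = of_real ((cmod a)\<^sup>2)" for a
    by (metis complex_norm_square mult.commute of_real_power)
  \<comment> \<open>Positivity of the form of A at w - t a, divided by t.\<close>
  have half: "2 * Re (\<Sum>i<m. cnj (a i) * mv m A w i) \<le> t * Re (quad_form m (entries A) a) + Re (quad_form m (entries A) w) / t"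
    if A: "psd m A" and t: "0 < t" for A a and t :: real
  proof -
    have herm: "A $$ (j, i) = cnj (A $$ (i, j))" if "i < m" "j < m" for i j
      using A that unfolding psd_iff Her_iff by blast
    have "0 \<le> Re (quad_form m (entries A) (\<lambda>i. w i + of_real (- t) * a i))"
      using A by (simp add: psd_iff less_eq_complex_def)
    also have "quad_form m (entries A) (\<lambda>i. w i + of_real (- t) * a i)
        = quad_form m (entries A) w + of_real (2 * (- t) * Re (\<Sum>i<m. cnj (a i) * (\<Sum>j<m. A $$ (i, j) * w j)))
          + of_real ((- t)\<^sup>2) * quad_form m (entries A) a"
      by (rule quad_form_add_scaled) (rule herm)
    finally have "0 \<le> Re (quad_form m (entries A) w) - 2 * t * Re (\<Sum>i<m. cnj (a i) * mv m A w i)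
        + t\<^sup>2 * Re (quad_form m (entries A) a)"
      by (simp add: mv_def del: Re_sum)
    then show ?thesis using t by (simp add: field_simps power2_eq_square del: Re_sum)
  qed
  have real: "quad_form m (entries A) a = of_real (Re (quad_form m (entries A) a))" if "psd m A" for A a
    using that by (simp add: psd_iff less_eq_complex_def complex_eq_iff)
  have ww: "(\<Sum>i<m. cnj (w i) * w i) = of_real (\<Sum>i<m. (cmod (w i))\<^sup>2)" by (simp only: sq of_real_sum)
  \<comment> \<open>E and F are Hermitian; moving them to the left factors reassembles w.\<close>
  have "(\<Sum>i<m. cnj (v i) * mv m E w i) + (\<Sum>i<m. cnj (v1 i) * mv m F w i) = of_real (\<Sum>i<m. (cmod (w i))\<^sup>2)"
    unfolding ww[symmetric]
    by (simp add: sum_mv_hermitian[OF H(1)] sum_mv_hermitian[OF H(2)] w_def algebra_simps sum.distrib)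
  from arg_cong[OF this, of Re] have "2 * (\<Sum>i<m. (cmod (w i))\<^sup>2)
      = 2 * Re (\<Sum>i<m. cnj (v i) * mv m E w i) + 2 * Re (\<Sum>i<m. cnj (v1 i) * mv m F w i)"
    by (simp del: Re_sum of_real_sum)
  also have "\<dots> \<le> x * Re (quad_form m (entries E) v) + z * Re (quad_form m (entries F) v1) + (\<Sum>i<m. (cmod (w i))\<^sup>2)"
    using half[OF E xz(1), of v] half[OF F xz(2), of v1] bound[of w] by linarith
  finally have "0 \<le> x * Re (quad_form m (entries E) v) + z * Re (quad_form m (entries F) v1) - (\<Sum>i<m. (cmod (w i))\<^sup>2)" by simp
  moreover have "quad_form (m + m) (entries (pencil m E F x (- 1) z)) v
      = of_real (x * Re (quad_form m (entries E) v) + z * Re (quad_form m (entries F) v1) - (\<Sum>i<m. (cmod (w i))\<^sup>2))"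
  proof -
    define a b where "a = Re (quad_form m (entries E) v)" and "b = Re (quad_form m (entries F) v1)"
    have q: "quad_form m (entries E) v = of_real a" "quad_form m (entries F) v1 = of_real b"
      unfolding a_def b_def by (rule real[OF E], rule real[OF F])
    show ?thesis
      unfolding quad_form_pencil[OF H] v1_def[symmetric] q ww[unfolded w_def] by (simp add: w_def)
  qed
  ultimately show ?thesis by (simp only: less_eq_complex_def) simp
qed

lemma inverse_symmetric:
  fixes E :: "complex mat"
  assumes "E \<in> carrier_mat m m" "EI \<in> carrier_mat m m" "E * EI = 1\<^sub>m m"
    and "\<And>i j. i < m \<Longrightarrow> j < m \<Longrightarrow> E $$ (i, j) = E $$ (j, i)"
    and "i < m" "j < m"
  shows "EI $$ (i, j) = EI $$ (j, i)"
proof -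
  have ET: "transpose_mat E = E" using assms(1,4) by (intro eq_matI) auto
  have T: "transpose_mat EI \<in> carrier_mat m m" using assms(2) by simp
  have "transpose_mat (E * EI) = transpose_mat EI * E"
    using transpose_mult[OF assms(1,2)] by (simp add: ET)
  then have 1: "transpose_mat EI * E = 1\<^sub>m m" using assms(3) by simp
  have "transpose_mat EI = transpose_mat EI * (E * EI)" using T assms(3) by simp
  also have "\<dots> = transpose_mat EI * E * EI" using T assms(1,2) by (simp add: assoc_mult_mat[of _ m m _ m _ m])
  also have "\<dots> = EI" using assms(2) 1 by simp
  finally have "transpose_mat EI $$ (j, i) = EI $$ (j, i)" by simp
  then show ?thesis using assms(2,5,6) by simp
qed

lemma sum_delta_mult: "k < n \<Longrightarrow> (\<Sum>p<n. b p * (if p = k then 1 else 0)) = (b k :: 'c::semiring_1)" for n k :: nat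
proof -
  assume "k < n"
  have "(\<Sum>p<n. b p * (if p = k then 1 else 0)) = (\<Sum>p<n. if p = k then b k else 0)" by (intro sum.cong) auto
  then show ?thesis using \<open>k < n\<close> by simp
qed

text \<open>b1, b2, b3 are the values of a row family at c1, c2, c3. The kernels at c1 and c3
  confine b1 to the first half and b3 to the second, and the kernel at c2 gives b2 = (E g, F g). At
  a pair (x, z) the kernel consists of the vectors (w / x, w / z) with E w / x + F w / z = w, and
  the condition becomes (b1 + b3 - g) . w = 0. Once these w span, b1 + b3 = g, and y = (E^-1 b1,
  F^-1 b3) produces all three rows.\<close>

lemma pencil_rows:
  fixes E F EI FI :: "complex mat" and b1 b2 b3 :: "nat \<Rightarrow> complex" and P :: "(real \<times> real) set"
  assumes E: "E \<in> carrier_mat m m" "EI \<in> carrier_mat m m" "E * EI = 1\<^sub>m m"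
    and F: "F \<in> carrier_mat m m" "FI \<in> carrier_mat m m" "F * FI = 1\<^sub>m m"
    and symE: "\<And>i j. i < m \<Longrightarrow> j < m \<Longrightarrow> E $$ (i, j) = E $$ (j, i)"
    and symF: "\<And>i j. i < m \<Longrightarrow> j < m \<Longrightarrow> F $$ (i, j) = F $$ (j, i)"
    and b1: "\<And>v. (\<And>i. i < m \<Longrightarrow> v i = 0) \<Longrightarrow> (\<Sum>p<m + m. b1 p * v p) = 0"
    and b2: "\<And>v. (\<And>i. i < m \<Longrightarrow> mv m E v i + mv m F (\<lambda>j. v (m + j)) i = 0) \<Longrightarrow> (\<Sum>p<m + m. b2 p * v p) = 0"
    and b3: "\<And>v. (\<And>i. i < m \<Longrightarrow> v (m + i) = 0) \<Longrightarrow> (\<Sum>p<m + m. b3 p * v p) = 0"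
    and P: "\<And>x z. (x, z) \<in> P \<Longrightarrow> 0 < x \<and> 0 < z"
    and bP: "\<And>x z v. (x, z) \<in> P \<Longrightarrow>
      (\<And>i. i < m \<Longrightarrow> of_real x * v i = mv m E v i + mv m F (\<lambda>j. v (m + j)) i) \<Longrightarrow>
      (\<And>i. i < m \<Longrightarrow> of_real z * v (m + i) = mv m E v i + mv m F (\<lambda>j. v (m + j)) i) \<Longrightarrow>
      (\<Sum>p<m + m. (of_real x * b1 p - b2 p + of_real z * b3 p) * v p) = 0"
    and span: "\<And>h. (\<And>x z w. (x, z) \<in> P \<Longrightarrow>
      (\<And>i. i < m \<Longrightarrow> of_real (1 / x) * mv m E w i + of_real (1 / z) * mv m F w i = w i) \<Longrightarrow>
      (\<Sum>i<m. h i * w i) = 0) \<Longrightarrow> (\<forall>i<m. h i = 0)"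
  shows "\<exists>y. \<forall>x y' z :: real. \<forall>j<m + m. of_real x * b1 j + of_real y' * b2 j + of_real z * b3 j = mv (m + m) (pencil m E F x y' z) y j"
proof -
  have EEI: "mv m E (mv m EI v) i = v i" "mv m F (mv m FI v) i = v i" if "i < m" for v i
    using mv_mult[OF E(1,2) that, of v] mv_mult[OF F(1,2) that, of v] E(3) F(3) mv_one[OF that] by simp_all
  have z1: "b1 (m + i) = 0" if "i < m" for i
  proof -
    have "(\<Sum>p<m + m. b1 p * (if p = m + i then 1 else 0)) = 0" by (rule b1) simp
    then show ?thesis using sum_delta_mult[of "m + i" "m + m" b1] that by simp
  qed
  have z3: "b3 i = 0" if "i < m" for i
  proof -
    have "(\<Sum>p<m + m. b3 p * (if p = i then 1 else 0)) = 0" by (rule b3) (use that in simp)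
    then show ?thesis using sum_delta_mult[of i "m + m" b3] that by simp
  qed
  \<comment> \<open>Candidates for g from the two halves of b2; the vectors (E^-1 t, - F^-1 t) in
    the kernel at c2 show that they agree.\<close>
  define g where "g = mv m EI b2"
  define g' where "g' = mv m FI (\<lambda>j. b2 (m + j))"
  have gg': "g i = g' i" if i: "i < m" for i
  proof -
    define t where "t k = (if k = i then 1 else (0::complex))" for k
    define v where "v p = (if p < m then mv m EI t p else - mv m FI t (p - m))" for p
    have "(\<Sum>p<m + m. b2 p * v p) = 0"
    proof (rule b2)
      fix k assume k: "k < m"
      have "mv m E v k = mv m E (mv m EI t) k" by (rule mv_cong) (simp add: v_def)
      moreover have "mv m F (\<lambda>j. v (m + j)) k = mv m F (\<lambda>j. (- 1) * mv m FI t j) k"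
        by (rule mv_cong) (simp add: v_def)
      ultimately show "mv m E v k + mv m F (\<lambda>j. v (m + j)) k = 0"
        unfolding mv_linear EEI[OF k] by simp
    qed
    then have "(\<Sum>p<m. b2 p * mv m EI t p) - (\<Sum>p<m. b2 (m + p) * mv m FI t p) = 0"
      by (simp add: sum_double v_def sum_negf)
    moreover have "(\<Sum>p<m. b2 p * mv m EI t p) = g i"
    proof -
      have "(\<Sum>p<m. b2 p * mv m EI t p) = (\<Sum>p<m. g p * t p)"
        unfolding g_def by (rule sum_mv_symmetric) (rule inverse_symmetric[OF E symE])
      also have "\<dots> = g i" unfolding t_def by (rule sum_delta_mult[OF i])
      finally show ?thesis .
    qed
    moreover have "(\<Sum>p<m. b2 (m + p) * mv m FI t p) = g' i"
    proof -
      have "(\<Sum>p<m. b2 (m + p) * mv m FI t p) = (\<Sum>p<m. g' p * t p)"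
        unfolding g'_def by (rule sum_mv_symmetric) (rule inverse_symmetric[OF F symF])
      also have "\<dots> = g' i" unfolding t_def by (rule sum_delta_mult[OF i])
      finally show ?thesis .
    qed
    ultimately show ?thesis by simp
  qed
  have b2g: "b2 i = mv m E g i" "b2 (m + i) = mv m F g i" if "i < m" for i
  proof -
    show "b2 i = mv m E g i" unfolding g_def using EEI(1)[OF that] by simp
    have "mv m F g i = mv m F g' i" by (rule mv_cong) (rule gg')
    then show "b2 (m + i) = mv m F g i" unfolding g'_def using EEI(2)[OF that, of "\<lambda>j. b2 (m + j)"] by simp
  qed
  have h: "b1 i + b3 (m + i) - g i = 0" if "i < m" for i
  proof -
    have "\<forall>i<m. b1 i + b3 (m + i) - g i = 0"
    proof (rule span)
      fix x z w
      assume xz: "(x, z) \<in> P" and w: "\<And>i. i < m \<Longrightarrow> of_real (1 / x) * mv m E w i + of_real (1 / z) * mv m F w i = w i"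
      have pos: "0 < x" "0 < z" using P[OF xz] by auto
      define v where "v p = (if p < m then of_real (1 / x) * w p else of_real (1 / z) * w (p - m))" for p
      have Ev: "mv m E v i = of_real (1 / x) * mv m E w i" for i
        unfolding mv_linear[symmetric] by (rule mv_cong) (simp add: v_def)
      have Fv: "mv m F (\<lambda>j. v (m + j)) i = of_real (1 / z) * mv m F w i" for i
        unfolding mv_linear[symmetric] by (rule mv_cong) (simp add: v_def)
      have "(\<Sum>p<m + m. (of_real x * b1 p - b2 p + of_real z * b3 p) * v p) = 0"
        by (rule bP[OF xz]) (use pos in \<open>simp_all only: Ev Fv w, simp_all add: v_def\<close>)
      then have "(\<Sum>p<m. (of_real x * b1 p - mv m E g p) * (of_real (1 / x) * w p))
          + (\<Sum>p<m. (of_real z * b3 (m + p) - mv m F g p) * (of_real (1 / z) * w p)) = 0"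
        by (simp add: sum_double v_def z1 z3 b2g)
      moreover have "(of_real x * b1 p - mv m E g p) * (of_real (1 / x) * w p) = b1 p * w p - of_real (1 / x) * (mv m E g p * w p)" for p
        using pos by (simp add: field_simps)
      moreover have "(of_real z * b3 (m + p) - mv m F g p) * (of_real (1 / z) * w p) = b3 (m + p) * w p - of_real (1 / z) * (mv m F g p * w p)" for p
        using pos by (simp add: field_simps)
      ultimately have "(\<Sum>p<m. b1 p * w p) - of_real (1 / x) * (\<Sum>p<m. mv m E g p * w p)
          + ((\<Sum>p<m. b3 (m + p) * w p) - of_real (1 / z) * (\<Sum>p<m. mv m F g p * w p)) = 0"
        by (simp only: sum_subtractf sum_distrib_left)
      moreover have "(\<Sum>p<m. mv m E g p * w p) = (\<Sum>p<m. g p * mv m E w p)"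
        "(\<Sum>p<m. mv m F g p * w p) = (\<Sum>p<m. g p * mv m F w p)"
        by (rule sum_mv_symmetric[symmetric], rule symE, assumption+)
          (rule sum_mv_symmetric[symmetric], rule symF, assumption+)
      moreover have "(\<Sum>p<m. g p * w p) = of_real (1 / x) * (\<Sum>p<m. g p * mv m E w p) + of_real (1 / z) * (\<Sum>p<m. g p * mv m F w p)"
      proof -
        have "(\<Sum>p<m. g p * w p) = (\<Sum>p<m. g p * (of_real (1 / x) * mv m E w p + of_real (1 / z) * mv m F w p))"
          by (intro sum.cong refl) (simp only: w lessThan_iff)
        then show ?thesis by (simp add: distrib_left sum.distrib sum_distrib_left mult_ac)
      qed
      moreover have "(\<Sum>i<m. (b1 i + b3 (m + i) - g i) * w i)
          = (\<Sum>p<m. b1 p * w p) + (\<Sum>p<m. b3 (m + p) * w p) - (\<Sum>p<m. g p * w p)"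
        by (simp add: distrib_right left_diff_distrib sum.distrib sum_subtractf)
      ultimately show "(\<Sum>i<m. (b1 i + b3 (m + i) - g i) * w i) = 0" by (simp add: algebra_simps)
    qed
    then show ?thesis using that by blast
  qed
  define y where "y p = (if p < m then mv m EI b1 p else mv m FI (\<lambda>j. b3 (m + j)) (p - m))" for p
  have y1: "mv m E y i = b1 i" "mv m F (\<lambda>j. y (m + j)) i = b3 (m + i)" if i: "i < m" for i
  proof -
    have "mv m E y i = mv m E (mv m EI b1) i" by (rule mv_cong) (simp add: y_def)
    then show "mv m E y i = b1 i" using EEI(1)[OF i] by simp
    have "mv m F (\<lambda>j. y (m + j)) i = mv m F (mv m FI (\<lambda>j. b3 (m + j))) i" by (rule mv_cong) (simp add: y_def)
    then show "mv m F (\<lambda>j. y (m + j)) i = b3 (m + i)" using EEI(2)[OF i, of "\<lambda>j. b3 (m + j)"] by simp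
  qed
  have yg: "mv m E y i + mv m F (\<lambda>j. y (m + j)) i = g i" if "i < m" for i
    using h[OF that] y1[OF that] by simp
  show ?thesis
  proof (intro exI[of _ y] allI impI)
    fix x y' z :: real and j assume j: "j < m + m"
    show "of_real x * b1 j + of_real y' * b2 j + of_real z * b3 j = mv (m + m) (pencil m E F x y' z) y j"
    proof (cases "j < m")
      case True
      have "mv m E (\<lambda>i. mv m E y i + mv m F (\<lambda>j. y (m + j)) i) j = mv m E g j"
        by (rule mv_cong) (rule yg)
      then show ?thesis
        using pencil_mv(1)[OF E(1) F(1) True, of x y' z y] y1[OF True] z3[OF True] b2g[OF True] by simp
    next
      case False
      define i where "i = j - m"
      have i: "i < m" "j = m + i" using False j by (auto simp: i_def)
      have "mv m F (\<lambda>i. mv m E y i + mv m F (\<lambda>j. y (m + j)) i) i = mv m F g i"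
        by (rule mv_cong) (rule yg)
      then show ?thesis
        using pencil_mv(2)[OF E(1) F(1) i(1), of x y' z y] y1[OF i(1)] z1[OF i(1)] b2g[OF i(1)] i(2) by simp
    qed
  qed
qed

lemma pencil_pencil_mat:
  assumes "E \<in> carrier_mat m m" "F \<in> carrier_mat m m"
  shows "pencil m E F 1 0 0 = pencil_mat m E F 0" "pencil m E F 0 1 0 = pencil_mat m E F 1"
    "pencil m E F 0 0 1 = pencil_mat m E F 2"
  using carrier_matD[OF pencil_mat_carrier[OF assms, of 0]] carrier_matD[OF pencil_mat_carrier[OF assms, of 1]]
    carrier_matD[OF pencil_mat_carrier[OF assms, of 2]]
  by (auto simp: pencil_def intro!: eq_matI)

text \<open>The factor N has to be cancelled. N (M0 + M2) = N G with G = E \<oplus> F, and its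
  inverse H U lies in the algebra, hence so does every H M_k. These are the two corner projections
  and the matrix R with both block rows (E, F). The corners of R isolate E and F, and R H supplies
  the off-diagonal identity blocks that move F to the corner of E.\<close>

lemma pencil_algebra:
  fixes E F EI FI :: "complex mat"
  assumes B: "subalgebra (m + m) B" and N: "N \<in> carrier_mat (m + m) (m + m)" "U \<in> carrier_mat (m + m) (m + m)" "N * U = 1\<^sub>m (m + m)"
    and NB: "N * pencil_mat m E F 0 \<in> B" "N * pencil_mat m E F 1 \<in> B" "N * pencil_mat m E F 2 \<in> B"
    and E: "E \<in> carrier_mat m m" "EI \<in> carrier_mat m m" "EI * E = 1\<^sub>m m"
    and F: "F \<in> carrier_mat m m" "FI \<in> carrier_mat m m" "FI * F = 1\<^sub>m m"
    and gen: "\<And>B. subalgebra m B \<Longrightarrow> E \<in> B \<Longrightarrow> F \<in> B \<Longrightarrow> carrier_mat m m \<subseteq> B"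
  shows "carrier_mat (m + m) (m + m) \<subseteq> B"
proof -
  let ?n = "m + m"
  let ?O = "0\<^sub>m m m :: complex mat" and ?I = "1\<^sub>m m :: complex mat"
  note Badd = subalgebraD(3)[OF B] and Bmult = subalgebraD(4)[OF B]
  have UN: "U * N = 1\<^sub>m ?n" using mat_mult_left_right_inverse[OF N(1,2,3)] .
  have EE: "E * EI = 1\<^sub>m m" "F * FI = 1\<^sub>m m"
    using mat_mult_left_right_inverse[OF E(2,1,3)] mat_mult_left_right_inverse[OF F(2,1,3)] by auto
  define G where "G = four_block_mat E ?O ?O F"
  define H where "H = four_block_mat EI ?O ?O FI"
  have GH: "G \<in> carrier_mat ?n ?n" "H \<in> carrier_mat ?n ?n" using E F by (auto simp: G_def H_def)
  have HG: "H * G = 1\<^sub>m ?n"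
    unfolding G_def H_def using E F by (subst mult_four_block_mat[of _ m m _ m _ m _ _ m _ m]) (simp_all add: left_add_zero_mat[of _ m m] right_add_zero_mat[of _ m m])
  have Mc: "pencil_mat m E F k \<in> carrier_mat ?n ?n" for k by (rule pencil_mat_carrier[OF E(1) F(1)])
  have "N * G \<in> B"
  proof -
    have "G = pencil_mat m E F 0 + pencil_mat m E F 2"
      unfolding G_def pencil_mat_def using E F by (simp add: add_four_block_mat[of _ m m _ m _ m])
    then have "N * G = N * pencil_mat m E F 0 + N * pencil_mat m E F 2"
      using N(1) Mc by (simp add: mult_add_distrib_mat[of _ ?n ?n _ ?n])
    then show ?thesis using Badd[OF NB(1,3)] by simp
  qed
  have HU: "H * U \<in> B"
  proof (rule subalgebra_inverse[OF B \<open>N * G \<in> B\<close>])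
    show "H * U \<in> carrier_mat ?n ?n" using GH N by simp
    have "H * U * (N * G) = H * (U * N * G)"
      using GH N by (simp add: assoc_mult_mat[of _ ?n ?n _ ?n _ ?n])
    then show "H * U * (N * G) = 1\<^sub>m ?n" using GH by (simp add: UN HG)
  qed
  have HM: "H * pencil_mat m E F k \<in> B" if "N * pencil_mat m E F k \<in> B" for k
  proof -
    have "H * U * (N * pencil_mat m E F k) = H * (U * N * pencil_mat m E F k)"
      using GH N Mc[of k] by (simp add: assoc_mult_mat[of _ ?n ?n _ ?n _ ?n])
    also have "\<dots> = H * pencil_mat m E F k" using Mc[of k] by (simp add: UN)
    finally show ?thesis using Bmult[OF HU that] by simp
  qed
  note sim = left_add_zero_mat[of _ m m] right_add_zero_mat[of _ m m] left_mult_zero_mat[of _ m m] right_mult_zero_mat[of _ m m]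
  define P where "P = four_block_mat ?I ?O ?O ?O"
  define P' where "P' = four_block_mat ?O ?O ?O ?I"
  define R where "R = four_block_mat E F E F"
  have PB: "P \<in> B"
  proof -
    have "H * pencil_mat m E F 0 = P"
      unfolding H_def P_def pencil_mat_def using E F by (simp, subst mult_four_block_mat[of _ m m _ m _ m _ _ m _ m]) (simp_all add: sim)
    then show ?thesis using HM[OF NB(1)] by simp
  qed
  have P'B: "P' \<in> B"
  proof -
    have "H * pencil_mat m E F 2 = P'"
      unfolding H_def P'_def pencil_mat_def using E F by (simp, subst mult_four_block_mat[of _ m m _ m _ m _ _ m _ m]) (simp_all add: sim)
    then show ?thesis using HM[OF NB(3)] by simp
  qed
  have RB: "R \<in> B"
  proof -
    have "EI * (E * X) = X" "FI * (F * X) = X" if "X \<in> carrier_mat m m" for X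
      using E F that by (simp_all flip: assoc_mult_mat[of _ m m _ m X m])
    then have "H * pencil_mat m E F 1 = R"
      unfolding H_def R_def pencil_mat_def using E F by (simp, subst mult_four_block_mat[of _ m m _ m _ m _ _ m _ m]) (simp_all add: sim)
    then show ?thesis using HM[OF NB(2)] by simp
  qed
  have corner: "P * four_block_mat A1 A2 A3 A4 * P = four_block_mat A1 ?O ?O ?O"
    "P' * four_block_mat A1 A2 A3 A4 * P' = four_block_mat ?O ?O ?O A4"
    "P * four_block_mat A1 A2 A3 A4 * P' = four_block_mat ?O A2 ?O ?O"
    "P' * four_block_mat A1 A2 A3 A4 * P = four_block_mat ?O ?O A3 ?O"
    if "A1 \<in> carrier_mat m m" "A2 \<in> carrier_mat m m" "A3 \<in> carrier_mat m m" "A4 \<in> carrier_mat m m" for A1 A2 A3 A4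
    unfolding P_def P'_def using that by (simp_all add: mult_four_block_mat[of _ m m _ m _ m _ _ m _ m] sim)
  have E0: "four_block_mat E ?O ?O ?O \<in> B" and F0: "four_block_mat ?O ?O ?O F \<in> B"
    using Bmult[OF Bmult[OF PB RB] PB] Bmult[OF Bmult[OF P'B RB] P'B] E F by (simp_all add: R_def corner)
  have "G \<in> B"
    using Badd[OF E0 F0] E F by (simp add: add_four_block_mat[of _ m m _ m _ m] G_def)
  then have HB: "H \<in> B" using subalgebra_inverse[OF B _ GH(2) HG] by simp
  have "R * H = four_block_mat ?I ?I ?I ?I"
    unfolding R_def H_def using E F by (subst mult_four_block_mat[of _ m m _ m _ m _ _ m _ m]) (simp_all add: EE sim)
  then have "four_block_mat ?I ?I ?I ?I \<in> B" using Bmult[OF RB HB] by simp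
  then have U01: "four_block_mat ?O ?I ?O ?O \<in> B" and U10: "four_block_mat ?O ?O ?I ?O \<in> B"
    using Bmult[OF Bmult[OF PB] P'B] Bmult[OF Bmult[OF P'B] PB] corner(3,4)[of ?I ?I ?I ?I] by (metis one_carrier_mat)+
  \<comment> \<open>The algebra cut down to its upper left corner, to which the hypothesis on E and
    F applies.\<close>
  define B0 where "B0 = {A \<in> carrier_mat m m. four_block_mat A ?O ?O ?O \<in> B}"
  have "subalgebra m B0"
    unfolding subalgebra_def
  proof (intro conjI ballI allI)
    show "B0 \<subseteq> carrier_mat m m" by (auto simp: B0_def)
    show "1\<^sub>m m \<in> B0" using PB by (simp add: B0_def P_def)
    fix A assume A: "A \<in> B0"
    then have Ac: "A \<in> carrier_mat m m" "four_block_mat A ?O ?O ?O \<in> B" by (auto simp: B0_def)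
    have "z \<cdot>\<^sub>m four_block_mat A ?O ?O ?O = four_block_mat (z \<cdot>\<^sub>m A) ?O ?O ?O" for z
      using Ac by (intro eq_matI) auto
    then show "z \<cdot>\<^sub>m A \<in> B0" for z using subalgebraD(5)[OF B Ac(2), of z] Ac by (simp add: B0_def)
    fix A' assume "A' \<in> B0"
    then have Ac': "A' \<in> carrier_mat m m" "four_block_mat A' ?O ?O ?O \<in> B" by (auto simp: B0_def)
    show "A + A' \<in> B0"
      using Badd[OF Ac(2) Ac'(2)] Ac Ac' by (simp add: B0_def add_four_block_mat[of _ m m _ m _ m] sim)
    show "A * A' \<in> B0"
      using Bmult[OF Ac(2) Ac'(2)] Ac Ac' by (simp add: B0_def mult_four_block_mat[of _ m m _ m _ m _ _ m _ m] sim)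
  qed
  moreover have "E \<in> B0" using E0 E by (simp add: B0_def)
  moreover have "F \<in> B0"
  proof -
    have "four_block_mat ?O ?I ?O ?O * four_block_mat ?O ?O ?O F * four_block_mat ?O ?O ?I ?O = four_block_mat F ?O ?O ?O"
      using F by (simp add: mult_four_block_mat[of _ m m _ m _ m _ _ m _ m] sim)
    then show ?thesis using Bmult[OF Bmult[OF U01 F0] U10] F by (simp add: B0_def)
  qed
  ultimately have all: "carrier_mat m m \<subseteq> B0" by (rule gen)
  show ?thesis
  proof
    fix M :: "complex mat" assume M: "M \<in> carrier_mat ?n ?n"
    obtain A1 A2 A3 A4 where s: "split_block M m m = (A1, A2, A3, A4)" by (metis prod_cases4)
    have sb: "A1 \<in> carrier_mat m m" "A2 \<in> carrier_mat m m" "A3 \<in> carrier_mat m m" "A4 \<in> carrier_mat m m"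
      "M = four_block_mat A1 A2 A3 A4"
      using split_block[OF s, of m m] carrier_matD[OF M] by auto
    have inB: "four_block_mat A ?O ?O ?O \<in> B" if "A \<in> carrier_mat m m" for A using all that by (auto simp: B0_def)
    have "M = four_block_mat A1 ?O ?O ?O + four_block_mat A2 ?O ?O ?O * four_block_mat ?O ?I ?O ?O
      + (four_block_mat ?O ?O ?I ?O * four_block_mat A3 ?O ?O ?O
      + four_block_mat ?O ?O ?I ?O * four_block_mat A4 ?O ?O ?O * four_block_mat ?O ?I ?O ?O)"
      using sb by (simp add: mult_four_block_mat[of _ m m _ m _ m _ _ m _ m] add_four_block_mat[of _ m m _ m _ m] sim)
    also have "\<dots> \<in> B" by (intro Badd Bmult inB sb U01 U10)
    finally show "M \<in> B" .
  qed
qed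

lemma mv_diag_ones:
  assumes "i < m"
  shows "mv m (diag_ones m x y z) w i = of_real (x + y * real i) * w i + of_real z * (\<Sum>j<m. w j)"
proof -
  have "mv m (diag_ones m x y z) w i = (\<Sum>j<m. (if j = i then of_real (x + y * real i) * w i else 0) + of_real z * w j)"
    unfolding mv_def using assms by (intro sum.cong refl) (auto simp: diag_ones_index algebra_simps)
  then show ?thesis using assms by (simp add: sum.distrib sum_distrib_left)
qed

lemma diag_ones_inverse:
  assumes "real m * (\<bar>y\<bar> + \<bar>z\<bar>) < x"
  shows "\<exists>T\<in>carrier_mat m m. diag_ones m x y z * T = 1\<^sub>m m \<and> T * diag_ones m x y z = 1\<^sub>m m"
proof (rule exists_inverse_if_kernel_trivial[OF diag_ones_carrier])
  fix v assume v: "v \<in> carrier_vec m" "diag_ones m x y z *\<^sub>v v = 0\<^sub>v m"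
  define \<delta> where "\<delta> = x - real m * (\<bar>y\<bar> + \<bar>z\<bar>)"
  have \<delta>: "\<delta> > 0" using assms by (simp add: \<delta>_def)
  have "mv m (diag_ones m x y z) (($) v) i = 0" if "i < m" for i
  proof -
    have "(diag_ones m x y z *\<^sub>v v) $ i = 0" using v(2) that by simp
    then show ?thesis using that v(1) carrier_matD[OF diag_ones_carrier[of m x y z]]
      by (simp add: mv_def scalar_prod_def lessThan_atLeast0)
  qed
  then have "quad_form m (entries (diag_ones m x y z)) (($) v) = 0" by (simp add: quad_form_mv)
  then have "of_real \<delta> * (\<Sum>i<m. cnj (v $ i) * v $ i) \<le> 0"
    using quad_form_diag_ones_ge[of m y z x \<delta> "($) v"] by (simp add: \<delta>_def)
  then have "\<delta> * (\<Sum>i<m. (cmod (v $ i))\<^sup>2) \<le> 0"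
    by (simp add: less_eq_complex_def cmod_power2) (simp add: power2_eq_square)
  then have "(\<Sum>i<m. (cmod (v $ i))\<^sup>2) \<le> 0" using \<delta> by (simp add: mult_le_0_iff)
  then have "(\<Sum>i<m. (cmod (v $ i))\<^sup>2) = 0" by (meson antisym sum_nonneg zero_le_power2)
  then show "v = 0\<^sub>v m" using v(1) by (intro eq_vecI) (auto simp: sum_nonneg_eq_0_iff)
qed

text \<open>With h complex conjugation this is Hermiticity of the blocks, with h the identity it is
  symmetry; both are used.\<close>

lemma pencil_mat_swap:
  assumes E: "E \<in> carrier_mat m m" "F \<in> carrier_mat m m" and h: "h 0 = (0::complex)" "\<And>x y. h (x + y) = h x + h y" "\<And>x y. h (x * y) = h x * h y"
    and sE: "\<And>i j. i < m \<Longrightarrow> j < m \<Longrightarrow> E $$ (j, i) = h (E $$ (i, j))"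
    and sF: "\<And>i j. i < m \<Longrightarrow> j < m \<Longrightarrow> F $$ (j, i) = h (F $$ (i, j))"
    and ij: "i < m + m" "j < m + m"
  shows "pencil_mat m E F k $$ (j, i) = h (pencil_mat m E F k $$ (i, j))"
proof -
  have hs: "h (sum f A) = (\<Sum>k\<in>A. h (f k))" for f and A :: "nat set"
    by (induction A rule: infinite_finite_induct) (simp_all add: h)
  have cm: "(A * B) $$ (j, i) = h ((B * A) $$ (i, j))"
    if ij: "i < m" "j < m" and AB: "A \<in> carrier_mat m m" "B \<in> carrier_mat m m"
      and sA: "\<And>i j. i < m \<Longrightarrow> j < m \<Longrightarrow> A $$ (j, i) = h (A $$ (i, j))"
      and sB: "\<And>i j. i < m \<Longrightarrow> j < m \<Longrightarrow> B $$ (j, i) = h (B $$ (i, j))" for i j A B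
  proof -
    have "(A * B) $$ (j, i) = (\<Sum>k<m. A $$ (j, k) * B $$ (k, i))"
      using ij AB by (simp add: scalar_prod_def lessThan_atLeast0)
    also have "\<dots> = (\<Sum>k<m. h (B $$ (i, k) * A $$ (k, j)))"
    proof (intro sum.cong refl)
      fix k assume "k \<in> {..<m}"
      then show "A $$ (j, k) * B $$ (k, i) = h (B $$ (i, k) * A $$ (k, j))"
        using sA[of k j] sB[of i k] ij by (simp add: h(3) mult.commute)
    qed
    also have "\<dots> = h ((B * A) $$ (i, j))"
      using ij AB by (simp add: scalar_prod_def lessThan_atLeast0 hs)
    finally show ?thesis .
  qed
  have d: "dim_row E = m" "dim_col E = m" "dim_row F = m" "dim_col F = m" using E by auto
  note EE = cm[OF _ _ E(1,1) sE sE] and EFm = cm[OF _ _ E sE sF] and FE = cm[OF _ _ E(2,1) sF sE] and FF = cm[OF _ _ E(2,2) sF sF]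
  consider "i < m" "j < m" | "i < m" "\<not> j < m" "j - m < m" | "\<not> i < m" "i - m < m" "j < m" | "\<not> i < m" "i - m < m" "\<not> j < m" "j - m < m"
    using ij by linarith
  then show ?thesis
  proof cases
    case 1
    show ?thesis using 1 d ij EE[of i j] sE[of i j] by (simp add: pencil_mat_def h(1) del: index_mult_mat(1))
  next
    case 2
    show ?thesis using 2 d ij FE[of i "j - m"] by (simp add: pencil_mat_def h(1) del: index_mult_mat(1))
  next
    case 3
    show ?thesis using 3 d ij EFm[of "i - m" j] by (simp add: pencil_mat_def h(1) del: index_mult_mat(1))
  next
    case 4
    show ?thesis using 4 d ij FF[of "i - m" "j - m"] sF[of "i - m" "j - m"] by (simp add: pencil_mat_def h(1) del: index_mult_mat(1))
  qed
qed

lemma pencil_point: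
  fixes C :: "'a::euclidean_space set" and c1 c2 c3 u :: 'a and \<psi>1 \<psi>2 \<psi>3 :: "'a dual" and J :: "(real \<times> real) set"
  assumes m: "1 \<le> m"
    and dual: "\<psi>1 c1 = 1" "\<psi>2 c1 = 0" "\<psi>3 c1 = 0" "\<psi>1 c2 = 0" "\<psi>2 c2 = 1" "\<psi>3 c2 = 0" "\<psi>1 c3 = 0" "\<psi>2 c3 = 0" "\<psi>3 c3 = 1"
    and basis: "\<And>c. c = \<psi>1 c *\<^sub>R c1 + \<psi>2 c *\<^sub>R c2 + \<psi>3 c *\<^sub>R c3"
    and cC: "c1 \<in> C" "c2 \<in> C" "c3 \<in> C"
    and J: "finite J" "2 \<le> card J" "\<And>x z. (x, z) \<in> J \<Longrightarrow> 0 < x \<and> 0 < z \<and> x *\<^sub>R c1 - c2 + z *\<^sub>R c3 \<in> C"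
    and antichain: "\<And>x z x' z'. (x, z) \<in> J \<Longrightarrow> (x', z') \<in> J \<Longrightarrow> x \<le> x' \<Longrightarrow> z \<le> z' \<Longrightarrow> (x, z) = (x', z')"
    and gen: "C \<subseteq> convex_cone hull ({c1, c2, c3} \<union> (\<lambda>(x, z). x *\<^sub>R c1 - c2 + z *\<^sub>R c3) ` J)"
    and u: "u \<in> interior C"
  shows "\<exists>X\<in>free_polyhedron C u (m + m). rigid C u (m + m) X \<and> generating (m + m) (range (eval_at X))"
proof -
  \<comment> \<open>Reciprocals, since positivity at (x, z) is the condition E / x + F / z \<le> 1;
    inversion reverses the order and preserves antichains.\<close>
  define Q where "Q = (\<lambda>(x, z). (1 / x, 1 / z)) ` J"
  have Q: "finite Q" "\<And>r. r \<in> Q \<Longrightarrow> 0 < fst r \<and> 0 < snd r" "2 \<le> card Q"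
  proof -
    show "finite Q" using J(1) by (simp add: Q_def)
    show "0 < fst r \<and> 0 < snd r" if "r \<in> Q" for r using that J(3) by (auto simp: Q_def)
    have "inj_on (\<lambda>(x, z). (1 / x, 1 / z)) J"
      by (auto simp: inj_on_def)
    then show "2 \<le> card Q" using J(2) by (simp add: Q_def card_image)
  qed
  have Qanti: "r = r'" if "r \<in> Q" "r' \<in> Q" "fst r \<le> fst r'" "snd r \<le> snd r'" for r r'
  proof -
    obtain x z x' z' where r: "r = (1 / x, 1 / z)" "(x, z) \<in> J" "r' = (1 / x', 1 / z')" "(x', z') \<in> J"
      using \<open>r \<in> Q\<close> \<open>r' \<in> Q\<close> by (auto simp: Q_def)
    then have "x' \<le> x" "z' \<le> z" using that(3,4) J(3)[OF r(2)] J(3)[OF r(4)] by (simp_all add: field_simps)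
    then show ?thesis using antichain[OF r(4,2)] r by simp
  qed
  obtain ra rb \<epsilon> e0 e1 e2 f0 f1 f2 where ab: "ra \<in> Q" "rb \<in> Q" and eps: "0 < \<epsilon>"
    and e: "real m * (\<bar>e1\<bar> + \<bar>e2\<bar>) < e0" and f: "real m * (\<bar>f1\<bar> + \<bar>f2\<bar>) < f0"
    and ra: "fst ra * e0 + snd ra * f0 = 1" "fst ra * e1 + snd ra * f1 = - \<epsilon>" "fst ra * e2 + snd ra * f2 = 0"
    and rb: "fst rb * e0 + snd rb * f0 = 1" "fst rb * e1 + snd rb * f1 = 0" "fst rb * e2 + snd rb * f2 = - \<epsilon>"
    and Qle: "\<And>r. r \<in> Q \<Longrightarrow>
      fst r * e0 + snd r * f0 = 1 \<and> fst r * e1 + snd r * f1 \<le> 0 \<and> fst r * e2 + snd r * f2 \<le> 0 \<or>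
      real m * (\<bar>fst r * e1 + snd r * f1\<bar> + \<bar>fst r * e2 + snd r * f2\<bar>) < 1 - (fst r * e0 + snd r * f0)"
    by (rule planar_coefficients[of Q "real m"]) (use Q Qanti in blast)+
  define E where "E = diag_ones m e0 e1 e2"
  define F where "F = diag_ones m f0 f1 f2"
  have EF: "E \<in> carrier_mat m m" "F \<in> carrier_mat m m" "E \<in> Her m" "F \<in> Her m"
    by (simp_all add: E_def F_def diag_ones_Her)
  have sym: "E $$ (i, j) = E $$ (j, i)" "F $$ (i, j) = F $$ (j, i)" if "i < m" "j < m" for i j
    using that by (simp_all add: E_def F_def diag_ones_index)
  have ge: "of_real (e0 - real m * (\<bar>e1\<bar> + \<bar>e2\<bar>)) * (\<Sum>i<m. cnj (v i) * v i) \<le> quad_form m (entries E) v"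
    "of_real (f0 - real m * (\<bar>f1\<bar> + \<bar>f2\<bar>)) * (\<Sum>i<m. cnj (v i) * v i) \<le> quad_form m (entries F) v" for v
    unfolding E_def F_def by (rule quad_form_diag_ones_ge, simp)+
  have nn: "0 \<le> (\<Sum>i<m. cnj (v i) * v i)" for v :: "nat \<Rightarrow> complex"
    by (intro sum_nonneg) (simp add: less_eq_complex_def)
  have psdE: "psd m E"
  proof -
    have "0 \<le> quad_form m (entries E) v" for v
      using quad_form_diag_ones_ge[of m e1 e2 e0 0 v] e by (simp add: E_def)
    then show ?thesis using EF by (simp add: psd_iff)
  qed
  have psdF: "psd m F"
  proof -
    have "0 \<le> quad_form m (entries F) v" for v
      using quad_form_diag_ones_ge[of m f1 f2 f0 0 v] f by (simp add: F_def)
    then show ?thesis using EF by (simp add: psd_iff)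
  qed
  obtain EI where EI: "EI \<in> carrier_mat m m" "E * EI = 1\<^sub>m m" "EI * E = 1\<^sub>m m"
    using diag_ones_inverse[OF e] by (auto simp: E_def)
  obtain FI where FI: "FI \<in> carrier_mat m m" "F * FI = 1\<^sub>m m" "FI * F = 1\<^sub>m m"
    using diag_ones_inverse[OF f] by (auto simp: F_def)
  define \<psi> where "\<psi> k = (if k = 0 then \<psi>1 else if k = 1 then \<psi>2 else \<psi>3)" for k :: nat
  define Xt where "Xt c = mat (m + m) (m + m) (\<lambda>(i, j). \<Sum>k<3. of_real (blinfun_apply (\<psi> k) c) * pencil_mat m E F k $$ (i, j))" for c
  have Xt: "Xt c = pencil m E F (\<psi>1 c) (\<psi>2 c) (\<psi>3 c)" for c
    unfolding Xt_def pencil_def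
    by (rule eq_matI) (auto simp: \<psi>_def numeral_3_eq_3 numeral_2_eq_2)
  have quad: "quad_form (m + m) (entries (Xt c)) v =
    of_real (\<psi>1 c) * quad_form m (entries E) v + of_real (\<psi>3 c) * quad_form m (entries F) (\<lambda>j. v (m + j))
    + of_real (\<psi>2 c) * (\<Sum>i<m. cnj (mv m E v i + mv m F (\<lambda>j. v (m + j)) i) * (mv m E v i + mv m F (\<lambda>j. v (m + j)) i))" for c v
    unfolding Xt by (rule quad_form_pencil[OF EF(3,4)])
  have quad_lin: "quad_form (m + m) (entries (Xt (c + c'))) v = quad_form (m + m) (entries (Xt c)) v + quad_form (m + m) (entries (Xt c')) v"
    "quad_form (m + m) (entries (Xt (t *\<^sub>R c))) v = of_real t * quad_form (m + m) (entries (Xt c)) v" for c c' t v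
    unfolding quad by (simp_all add: blinfun.add_right blinfun.scaleR_right distrib_right distrib_left mult.assoc)
  have comb: "of_real p * mv m E w i + of_real q * mv m F w i
      = of_real (p * e0 + q * f0 + (p * e1 + q * f1) * real i) * w i + of_real (p * e2 + q * f2) * (\<Sum>j<m. w j)"
    if "i < m" for p q w i
    unfolding E_def F_def mv_diag_ones[OF that] by (simp add: algebra_simps)
  have posJ: "0 \<le> quad_form (m + m) (entries (Xt (x *\<^sub>R c1 - c2 + z *\<^sub>R c3))) v" if xz: "(x, z) \<in> J" for x z v
  proof -
    have pos: "0 < x" "0 < z" using J(3)[OF xz] by auto
    have "(1 / x, 1 / z) \<in> Q" using xz by (force simp: Q_def)
    note r = Qle[OF this, unfolded fst_conv snd_conv]
    have "0 \<le> quad_form (m + m) (entries (pencil m E F x (- 1) z)) v"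
    proof (rule pencil_nonneg[OF psdE psdF pos])
      fix w :: "nat \<Rightarrow> complex"
      define S where "S = (\<Sum>i<m. (cmod (w i))\<^sup>2)"
      define S1 where "S1 = (\<Sum>i<m. real i * (cmod (w i))\<^sup>2)"
      define S2 where "S2 = (cmod (\<Sum>i<m. w i))\<^sup>2"
      have nonneg: "0 \<le> S1" "0 \<le> S2" by (simp_all add: S1_def S2_def sum_nonneg)
      have q: "Re (quad_form m (entries (diag_ones m a b c)) w) = a * S + b * S1 + c * S2" for a b c
        unfolding quad_form_diag_ones
        by (simp add: S_def S1_def S2_def distrib_right sum.distrib sum_distrib_left mult.assoc del: of_real_add of_real_sum of_real_mult of_real_power)
      \<comment> \<open>The coefficients of 1 - E / x - F / z with respect to 1, D, J.\<close>
      define r0 r1 r2 where "r0 = 1 - (1 / x * e0 + 1 / z * f0)" and "r1 = - (1 / x * e1 + 1 / z * f1)"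
        and "r2 = - (1 / x * e2 + 1 / z * f2)"
      have "0 \<le> Re (quad_form m (entries (diag_ones m r0 r1 r2)) w)"
        using r
      proof
        assume "1 / x * e0 + 1 / z * f0 = 1 \<and> 1 / x * e1 + 1 / z * f1 \<le> 0 \<and> 1 / x * e2 + 1 / z * f2 \<le> 0"
        then have "r0 = 0" "0 \<le> r1" "0 \<le> r2" by (simp_all add: r0_def r1_def r2_def)
        then show ?thesis unfolding q using nonneg by simp
      next
        assume "real m * (\<bar>1 / x * e1 + 1 / z * f1\<bar> + \<bar>1 / x * e2 + 1 / z * f2\<bar>) < 1 - (1 / x * e0 + 1 / z * f0)"
        then have "real m * (\<bar>r1\<bar> + \<bar>r2\<bar>) \<le> r0 - 0" unfolding r0_def r1_def r2_def abs_minus_cancel by simp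
        from quad_form_diag_ones_ge[OF this, of w] show ?thesis by (simp add: less_eq_complex_def)
      qed
      then show "Re (quad_form m (entries E) w) / x + Re (quad_form m (entries F) w) / z \<le> (\<Sum>i<m. (cmod (w i))\<^sup>2)"
        unfolding E_def F_def q S_def[symmetric] r0_def r1_def r2_def
        by (simp add: algebra_simps add_divide_distrib)
    qed
    moreover have "\<psi>1 (x *\<^sub>R c1 - c2 + z *\<^sub>R c3) = x" "\<psi>2 (x *\<^sub>R c1 - c2 + z *\<^sub>R c3) = - 1" "\<psi>3 (x *\<^sub>R c1 - c2 + z *\<^sub>R c3) = z"
      by (simp_all add: blinfun.add_right blinfun.diff_right blinfun.scaleR_right dual)
    ultimately show ?thesis unfolding Xt by simp
  qed
  have pos: "0 \<le> quad_form (m + m) (entries (Xt c)) v" if "c \<in> C" for c v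
  proof -
    \<comment> \<open>The region of positivity is a convex cone, so generators of C suffice.\<close>
    define K where "K = {c. \<forall>v. 0 \<le> quad_form (m + m) (entries (Xt c)) v}"
    have "convex_cone K"
      unfolding convex_cone_iff K_def
    proof (intro conjI ballI allI impI)
      have "quad_form (m + m) (entries (Xt 0)) v = 0" for v using quad_lin(2)[of 0 0 v] by simp
      then show "0 \<in> {c. \<forall>v. 0 \<le> quad_form (m + m) (entries (Xt c)) v}" by simp
    qed (auto simp: quad_lin less_eq_complex_def)
    moreover have "{c1, c2, c3} \<union> (\<lambda>(x, z). x *\<^sub>R c1 - c2 + z *\<^sub>R c3) ` J \<subseteq> K"
    proof -
      have "0 \<le> quad_form m (entries E) v" "0 \<le> quad_form m (entries F) v" for v
        using psdE psdF by (auto simp: psd_iff)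
      then have "c1 \<in> K" "c2 \<in> K" "c3 \<in> K"
        using nn[of "\<lambda>i. mv m E _ i + mv m F _ i"] by (simp_all add: K_def quad dual)
      then show ?thesis using posJ by (auto simp: K_def)
    qed
    ultimately have "C \<subseteq> K" using order_trans[OF gen hull_minimal] by blast
    then show ?thesis using that by (auto simp: K_def)
  qed
  \<comment> \<open>Interiority of u is used here: X(u) dominates \<delta> times the value E
    \<oplus> F at c1 + c3, and is therefore positive definite.\<close>
  obtain \<delta> where \<delta>: "\<delta> > 0" "u - \<delta> *\<^sub>R (c1 + c3) \<in> C"
  proof -
    obtain \<rho> where \<rho>: "\<rho> > 0" "ball u \<rho> \<subseteq> C" using u by (auto simp: mem_interior)
    define \<delta> where "\<delta> = \<rho> / (2 * (norm (c1 + c3) + 1))"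
    have n: "0 < norm (c1 + c3) + 1" by (simp add: add_nonneg_pos)
    have "\<delta> > 0" using \<rho> n by (simp add: \<delta>_def)
    have "\<delta> * norm (c1 + c3) < \<delta> * (norm (c1 + c3) + 1) * 2"
      using \<open>\<delta> > 0\<close> n by (simp add: mult_pos_pos add_pos_nonneg algebra_simps)
    also have "\<dots> = \<rho>" using n by (simp add: \<delta>_def field_simps)
    finally have "u - \<delta> *\<^sub>R (c1 + c3) \<in> ball u \<rho>"
      using \<open>\<delta> > 0\<close> by (simp add: dist_norm del: scaleR_add_right)
    then show ?thesis using that \<rho>(2) \<open>\<delta> > 0\<close> by blast
  qed
  define \<epsilon>' where "\<epsilon>' = min (e0 - real m * (\<bar>e1\<bar> + \<bar>e2\<bar>)) (f0 - real m * (\<bar>f1\<bar> + \<bar>f2\<bar>))"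
  have \<epsilon>': "\<epsilon>' > 0" using e f by (simp add: \<epsilon>'_def)
  have pd: "of_real (\<delta> * \<epsilon>') * (\<Sum>i<m + m. cnj (v i) * v i) \<le> quad_form (m + m) (entries (Xt u)) v" for v
  proof -
    define S0 where "S0 = (\<Sum>i<m. cnj (v i) * v i)"
    define S1 where "S1 = (\<Sum>i<m. cnj (v (m + i)) * v (m + i))"
    have S: "0 \<le> S0" "0 \<le> S1" unfolding S0_def S1_def by (rule nn)+
    have le: "of_real \<epsilon>' * S0 \<le> quad_form m (entries E) v" "of_real \<epsilon>' * S1 \<le> quad_form m (entries F) (\<lambda>j. v (m + j))"
    proof -
      have "of_real \<epsilon>' * S0 \<le> of_real (e0 - real m * (\<bar>e1\<bar> + \<bar>e2\<bar>)) * S0"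
        using S(1) by (intro mult_right_mono) (simp_all add: \<epsilon>'_def less_eq_complex_def)
      then show "of_real \<epsilon>' * S0 \<le> quad_form m (entries E) v" using ge(1)[of v] unfolding S0_def by (rule order_trans)
      have "of_real \<epsilon>' * S1 \<le> of_real (f0 - real m * (\<bar>f1\<bar> + \<bar>f2\<bar>)) * S1"
        using S(2) by (intro mult_right_mono) (simp_all add: \<epsilon>'_def less_eq_complex_def)
      then show "of_real \<epsilon>' * S1 \<le> quad_form m (entries F) (\<lambda>j. v (m + j))"
        using ge(2)[of "\<lambda>j. v (m + j)"] unfolding S1_def by (rule order_trans)
    qed
    have "u = (u - \<delta> *\<^sub>R (c1 + c3)) + \<delta> *\<^sub>R (c1 + c3)" by simp
    then have "quad_form (m + m) (entries (Xt u)) v = quad_form (m + m) (entries (Xt (u - \<delta> *\<^sub>R (c1 + c3)))) v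
        + of_real \<delta> * (quad_form (m + m) (entries (Xt c1)) v + quad_form (m + m) (entries (Xt c3)) v)"
      by (metis quad_lin)
    also have "quad_form (m + m) (entries (Xt c1)) v = quad_form m (entries E) v" by (simp add: quad dual)
    also have "quad_form (m + m) (entries (Xt c3)) v = quad_form m (entries F) (\<lambda>j. v (m + j))" by (simp add: quad dual)
    finally have "quad_form (m + m) (entries (Xt u)) v = quad_form (m + m) (entries (Xt (u - \<delta> *\<^sub>R (c1 + c3)))) v
        + of_real \<delta> * (quad_form m (entries E) v + quad_form m (entries F) (\<lambda>j. v (m + j)))" .
    moreover have "0 + of_real \<delta> * (of_real \<epsilon>' * S0 + of_real \<epsilon>' * S1) \<le> quad_form (m + m) (entries (Xt (u - \<delta> *\<^sub>R (c1 + c3)))) v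
        + of_real \<delta> * (quad_form m (entries E) v + quad_form m (entries F) (\<lambda>j. v (m + j)))"
      by (intro add_mono mult_left_mono le pos \<delta>(2)) (use \<delta>(1) in \<open>simp add: less_eq_complex_def\<close>)
    ultimately show ?thesis by (simp add: sum_double S0_def S1_def algebra_simps)
  qed
  have kernel: "(\<Sum>j<m + m. Xt c $$ (i, j) * v j) = mv (m + m) (pencil m E F (\<psi>1 c) (\<psi>2 c) (\<psi>3 c)) v i" for c i v
    by (simp add: mv_def Xt)
  have Mher: "pencil_mat m E F k \<in> Her (m + m)" for k
  proof -
    have "pencil_mat m E F k $$ (j, i) = cnj (pencil_mat m E F k $$ (i, j))" if "i < m + m" "j < m + m" for i j
      by (rule pencil_mat_swap[OF EF(1,2) _ _ _ _ _ that]) (simp_all add: E_def F_def diag_ones_index)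
    then show ?thesis unfolding Her_iff using pencil_mat_carrier[OF EF(1,2), of k] by blast
  qed
  show ?thesis
  proof (rule normalized_pencil[where n="m + m" and M="pencil_mat m E F" and \<psi>=\<psi> and K=3 and \<epsilon>="\<delta> * \<epsilon>'", folded Xt_def])
    show "pencil_mat m E F k \<in> Her (m + m)" for k by (rule Mher)
    show "0 \<le> quad_form (m + m) (entries (Xt c)) v" if "c \<in> C" for c v by (rule pos[OF that])
    show "0 < \<delta> * \<epsilon>'" using \<delta> \<epsilon>' by simp
    show "of_real (\<delta> * \<epsilon>') * (\<Sum>i<m + m. cnj (v i) * v i) \<le> quad_form (m + m) (entries (Xt u)) v" for v by (rule pd)
  next
    fix b :: "'a \<Rightarrow> nat \<Rightarrow> complex"
    assume lin: "\<And>i. i < m + m \<Longrightarrow> linear (\<lambda>c. b c i)"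
      and ker: "\<And>c v. c \<in> C \<Longrightarrow> (\<And>i. i < m + m \<Longrightarrow> (\<Sum>j<m + m. Xt c $$ (i, j) * v j) = 0) \<Longrightarrow> (\<Sum>i<m + m. b c i * v i) = 0"
    have ker': "(\<Sum>i<m + m. b c i * v i) = 0"
      if c: "c \<in> C" and 1: "\<And>i. i < m \<Longrightarrow> of_real (\<psi>1 c) * mv m E v i
          + of_real (\<psi>2 c) * mv m E (\<lambda>i. mv m E v i + mv m F (\<lambda>j. v (m + j)) i) i = 0"
        and 2: "\<And>i. i < m \<Longrightarrow> of_real (\<psi>3 c) * mv m F (\<lambda>j. v (m + j)) i
          + of_real (\<psi>2 c) * mv m F (\<lambda>i. mv m E v i + mv m F (\<lambda>j. v (m + j)) i) i = 0" for c v
    proof (rule ker[OF c])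
      fix i assume i: "i < m + m"
      show "(\<Sum>j<m + m. Xt c $$ (i, j) * v j) = 0"
      proof (cases "i < m")
        case True
        then show ?thesis unfolding kernel using pencil_mv(1)[OF EF(1,2) True] 1 by simp
      next
        case False
        then have "i - m < m" "i = m + (i - m)" using i by auto
        then show ?thesis unfolding kernel using pencil_mv(2)[OF EF(1,2), of "i - m"] 2 by metis
      qed
    qed
    have mv0: "mv m A (\<lambda>j. w j) i = 0" if "\<And>j. j < m \<Longrightarrow> w j = 0" for A w i
      using that by (simp add: mv_def)
    \<comment> \<open>The two distinguished pairs, at which 1 - E / x - F / z is \<epsilon> D and
      \<epsilon> J.\<close>
    define P where "P = {(1 / fst ra, 1 / snd ra), (1 / fst rb, 1 / snd rb)}"
    have PJ: "(x, z) \<in> J" if "(x, z) \<in> P" for x z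
      using that ab by (auto simp: P_def Q_def)
    have "\<exists>y. \<forall>x y' z :: real. \<forall>j<m + m. of_real x * b c1 j + of_real y' * b c2 j + of_real z * b c3 j
        = mv (m + m) (pencil m E F x y' z) y j"
    proof (rule pencil_rows[OF EF(1) EI(1,2) EF(2) FI(1,2) sym, where P=P])
      show "(\<Sum>p<m + m. b c1 p * v p) = 0" if "\<And>i. i < m \<Longrightarrow> v i = 0" for v
        by (rule ker'[OF cC(1)]) (simp_all add: dual mv0 that)
      show "(\<Sum>p<m + m. b c3 p * v p) = 0" if "\<And>i. i < m \<Longrightarrow> v (m + i) = 0" for v
        by (rule ker'[OF cC(3)]) (simp_all add: dual mv0 that)
      show "(\<Sum>p<m + m. b c2 p * v p) = 0" if "\<And>i. i < m \<Longrightarrow> mv m E v i + mv m F (\<lambda>j. v (m + j)) i = 0" for v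
        by (rule ker'[OF cC(2)]) (simp_all add: dual mv0 that)
      show "0 < x \<and> 0 < z" if "(x, z) \<in> P" for x z using J(3)[OF PJ[OF that]] by blast
      show "(\<Sum>p<m + m. (of_real x * b c1 p - b c2 p + of_real z * b c3 p) * v p) = 0"
        if xz: "(x, z) \<in> P"
          and v1: "\<And>i. i < m \<Longrightarrow> of_real x * v i = mv m E v i + mv m F (\<lambda>j. v (m + j)) i"
          and v2: "\<And>i. i < m \<Longrightarrow> of_real z * v (m + i) = mv m E v i + mv m F (\<lambda>j. v (m + j)) i" for x z v
      proof -
        define c where "c = x *\<^sub>R c1 - c2 + z *\<^sub>R c3"
        have c: "c \<in> C" "\<psi>1 c = x" "\<psi>2 c = - 1" "\<psi>3 c = z"
          using J(3)[OF PJ[OF xz]] by (simp_all add: c_def blinfun.add_right blinfun.diff_right blinfun.scaleR_right dual)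
        have "(\<Sum>i<m + m. b c i * v i) = 0"
        proof (rule ker'[OF c(1)])
          fix i assume i: "i < m"
          have "mv m E (\<lambda>i. mv m E v i + mv m F (\<lambda>j. v (m + j)) i) i = mv m E (\<lambda>i. of_real x * v i) i"
            by (rule mv_cong) (simp add: v1)
          then show "of_real (\<psi>1 c) * mv m E v i + of_real (\<psi>2 c) * mv m E (\<lambda>i. mv m E v i + mv m F (\<lambda>j. v (m + j)) i) i = 0"
            unfolding c by (simp add: mv_linear)
          have "mv m F (\<lambda>i. mv m E v i + mv m F (\<lambda>j. v (m + j)) i) i = mv m F (\<lambda>i. of_real z * v (m + i)) i"
            by (rule mv_cong) (simp add: v2)
          then show "of_real (\<psi>3 c) * mv m F (\<lambda>j. v (m + j)) i + of_real (\<psi>2 c) * mv m F (\<lambda>i. mv m E v i + mv m F (\<lambda>j. v (m + j)) i) i = 0"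
            unfolding c by (simp add: mv_linear)
        qed
        moreover have "b c p = of_real x * b c1 p - b c2 p + of_real z * b c3 p" if "p < m + m" for p
          unfolding c_def
          by (simp add: linear_add[OF lin[OF that]] linear_diff[OF lin[OF that]] linear_scale[OF lin[OF that]] scaleR_conv_of_real)
        ultimately show ?thesis by simp
      qed
      show "\<forall>i<m. h i = 0"
        if h: "\<And>x z w. (x, z) \<in> P \<Longrightarrow>
          (\<And>i. i < m \<Longrightarrow> of_real (1 / x) * mv m E w i + of_real (1 / z) * mv m F w i = w i) \<Longrightarrow>
          (\<Sum>i<m. h i * w i) = 0" for h
      proof -
        \<comment> \<open>The unit vector e_0 lies in the kernel of D.\<close>
        have 0: "h 0 = 0"
        proof -
          have "(\<Sum>i<m. h i * (if i = 0 then 1 else 0)) = 0"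
            by (rule h[of "1 / fst ra" "1 / snd ra"]) (use m in \<open>simp_all add: P_def comb ra\<close>)
          then show ?thesis using sum_delta_mult[of 0 m h] m by simp
        qed
        have "h i = 0" if i: "i < m" for i
        proof (cases "i = 0")
          case False
          \<comment> \<open>e_i - e_0 has coordinate sum 0 and so lies in the kernel of J.\<close>
          have "(\<Sum>j<m. h j * ((if j = i then 1 else 0) - (if j = 0 then 1 else 0))) = 0"
          proof (rule h[of "1 / fst rb" "1 / snd rb"])
            have "(\<Sum>j<m. (if j = i then 1 else 0) - (if j = 0 then 1 else (0::complex))) = 0"
              using i m by (simp add: sum_subtractf)
            then show "of_real (1 / (1 / fst rb)) * mv m E (\<lambda>j. (if j = i then 1 else 0) - (if j = 0 then 1 else 0)) k
                + of_real (1 / (1 / snd rb)) * mv m F (\<lambda>j. (if j = i then 1 else 0) - (if j = 0 then 1 else 0)) k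
                = (if k = i then 1 else 0) - (if k = 0 then 1 else 0)" if "k < m" for k
              using that unfolding comb[OF that] by (simp add: rb)
          qed (simp add: P_def)
          moreover have "(\<Sum>j<m. h j * ((if j = i then 1 else 0) - (if j = 0 then 1 else 0))) = h i - h 0"
            using sum_delta_mult[OF i, of h] sum_delta_mult[of 0 m h] m by (simp add: right_diff_distrib sum_subtractf)
          ultimately show ?thesis using 0 by simp
        qed (use 0 in simp)
        then show ?thesis by blast
      qed
    qed
    then obtain y where y: "\<And>x y' z :: real. \<And>j. j < m + m \<Longrightarrow> of_real x * b c1 j + of_real y' * b c2 j + of_real z * b c3 j
        = mv (m + m) (pencil m E F x y' z) y j" by blast
    have "b c j = (\<Sum>i<m + m. y i * Xt c $$ (i, j))" if j: "j < m + m" for c j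
    proof -
      have "b c j = b (\<psi>1 c *\<^sub>R c1 + \<psi>2 c *\<^sub>R c2 + \<psi>3 c *\<^sub>R c3) j" using basis[of c] by simp
      also have "\<dots> = of_real (\<psi>1 c) * b c1 j + of_real (\<psi>2 c) * b c2 j + of_real (\<psi>3 c) * b c3 j"
        by (simp add: linear_add[OF lin[OF j]] linear_scale[OF lin[OF j]] scaleR_conv_of_real)
      also have "\<dots> = (\<Sum>i<m + m. Xt c $$ (j, i) * y i)" unfolding y[OF j] by (simp add: mv_def Xt)
      also have "\<dots> = (\<Sum>i<m + m. y i * Xt c $$ (i, j))"
      proof (intro sum.cong refl)
        fix i assume "i \<in> {..<m + m}"
        then have i: "i < m + m" by simp
        have "pencil_mat m E F k $$ (j, i) = pencil_mat m E F k $$ (i, j)" for k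
          by (rule pencil_mat_swap[OF EF(1,2) _ _ _ _ _ i j, where h="\<lambda>x. x"]) (simp_all add: E_def F_def diag_ones_index)
        then show "Xt c $$ (j, i) * y i = y i * Xt c $$ (i, j)" using i j by (simp add: Xt_def)
      qed
      finally show ?thesis .
    qed
    then show "\<exists>y. \<forall>c. \<forall>j<m + m. b c j = (\<Sum>i<m + m. y i * Xt c $$ (i, j))" by blast
  next
    fix B N
    assume B: "subalgebra (m + m) B" and N: "N \<in> carrier_mat (m + m) (m + m)" "N * Xt u = 1\<^sub>m (m + m)"
      and NB: "\<And>c. N * Xt c \<in> B"
    have X3: "Xt c1 = pencil_mat m E F 0" "Xt c2 = pencil_mat m E F 1" "Xt c3 = pencil_mat m E F 2"
      by (simp_all add: Xt dual pencil_pencil_mat[OF EF(1,2)])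
    show "carrier_mat (m + m) (m + m) \<subseteq> B"
    proof (rule pencil_algebra[OF B N(1) _ N(2) _ _ _ EF(1) EI(1,3) EF(2) FI(1,3)])
      show "Xt u \<in> carrier_mat (m + m) (m + m)" by (simp add: Xt_def)
      show "N * pencil_mat m E F 0 \<in> B" "N * pencil_mat m E F 1 \<in> B" "N * pencil_mat m E F 2 \<in> B"
        using NB[of c1] NB[of c2] NB[of c3] by (simp_all add: X3)
      fix B0 assume B0: "subalgebra m B0" "E \<in> B0" "F \<in> B0"
      \<comment> \<open>At the two distinguished pairs this combination of E, F and 1 equals D and
        J.\<close>
      have "of_real (- 1 / \<epsilon>) \<cdot>\<^sub>m (of_real (fst r) \<cdot>\<^sub>m E + of_real (snd r) \<cdot>\<^sub>m F - 1\<^sub>m m) \<in> B0" for r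
        by (intro subalgebraD[OF B0(1)] subalgebra_diff[OF B0(1)] B0)
      moreover have "of_real (- 1 / \<epsilon>) \<cdot>\<^sub>m (of_real (fst ra) \<cdot>\<^sub>m E + of_real (snd ra) \<cdot>\<^sub>m F - 1\<^sub>m m) = diag_ones m 0 1 0"
        "of_real (- 1 / \<epsilon>) \<cdot>\<^sub>m (of_real (fst rb) \<cdot>\<^sub>m E + of_real (snd rb) \<cdot>\<^sub>m F - 1\<^sub>m m) = diag_ones m 0 0 1"
      proof -
        have "of_real (- 1 / \<epsilon>) \<cdot>\<^sub>m (of_real p \<cdot>\<^sub>m E + of_real q \<cdot>\<^sub>m F - 1\<^sub>m m)
          = diag_ones m ((1 - (p * e0 + q * f0)) / \<epsilon>) (- (p * e1 + q * f1) / \<epsilon>) (- (p * e2 + q * f2) / \<epsilon>)" for p q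
        proof (rule eq_matI)
          fix i j assume "i < dim_row (diag_ones m ((1 - (p * e0 + q * f0)) / \<epsilon>) (- (p * e1 + q * f1) / \<epsilon>) (- (p * e2 + q * f2) / \<epsilon>))"
            "j < dim_col (diag_ones m ((1 - (p * e0 + q * f0)) / \<epsilon>) (- (p * e1 + q * f1) / \<epsilon>) (- (p * e2 + q * f2) / \<epsilon>))"
          then have ij: "i < m" "j < m" by (auto simp: diag_ones_def)
          have "- 1 / \<epsilon> * (p * ((if i = j then e0 + e1 * real i else 0) + e2) + q * ((if i = j then f0 + f1 * real i else 0) + f2) - (if i = j then 1 else 0))
              = (if i = j then (1 - (p * e0 + q * f0)) / \<epsilon> + - (p * e1 + q * f1) / \<epsilon> * real i else 0) + - (p * e2 + q * f2) / \<epsilon>"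
            using eps by (simp add: field_simps)
          then have "complex_of_real (- 1 / \<epsilon> * (p * ((if i = j then e0 + e1 * real i else 0) + e2) + q * ((if i = j then f0 + f1 * real i else 0) + f2) - (if i = j then 1 else 0)))
              = of_real ((if i = j then (1 - (p * e0 + q * f0)) / \<epsilon> + - (p * e1 + q * f1) / \<epsilon> * real i else 0) + - (p * e2 + q * f2) / \<epsilon>)"
            by (simp only:)
          then show "(of_real (- 1 / \<epsilon>) \<cdot>\<^sub>m (of_real p \<cdot>\<^sub>m E + of_real q \<cdot>\<^sub>m F - 1\<^sub>m m)) $$ (i, j)
            = diag_ones m ((1 - (p * e0 + q * f0)) / \<epsilon>) (- (p * e1 + q * f1) / \<epsilon>) (- (p * e2 + q * f2) / \<epsilon>) $$ (i, j)"
            using ij carrier_matD[OF diag_ones_carrier] by (simp add: E_def F_def diag_ones_index split: if_splits)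
        qed (simp_all add: E_def F_def diag_ones_def)
        then show "of_real (- 1 / \<epsilon>) \<cdot>\<^sub>m (of_real (fst ra) \<cdot>\<^sub>m E + of_real (snd ra) \<cdot>\<^sub>m F - 1\<^sub>m m) = diag_ones m 0 1 0"
          "of_real (- 1 / \<epsilon>) \<cdot>\<^sub>m (of_real (fst rb) \<cdot>\<^sub>m E + of_real (snd rb) \<cdot>\<^sub>m F - 1\<^sub>m m) = diag_ones m 0 0 1"
          using eps by (simp_all only: ra rb) simp_all
      qed
      ultimately have "diag_ones m 0 1 0 \<in> B0" "diag_ones m 0 0 1 \<in> B0" by metis+
      then show "carrier_mat m m \<subseteq> B0" by (rule diag_ones_generate[OF B0(1)])
    qed
  qed
qed

section \<open>Normal form of a polyhedral cone\<close>

lemma exists_irredundant_cone_generators: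
  fixes S :: "'a::real_vector set"
  assumes "finite S"
  obtains T where "T \<subseteq> S" "convex_cone hull T = convex_cone hull S" "\<And>t. t \<in> T \<Longrightarrow> t \<notin> convex_cone hull (T - {t})"
proof -
  have "\<exists>T\<subseteq>S. convex_cone hull T = convex_cone hull S \<and> (\<forall>t\<in>T. t \<notin> convex_cone hull (T - {t}))"
    using assms
  proof (induction S rule: finite_psubset_induct)
    case (psubset S)
    show ?case
    proof (cases "\<exists>t\<in>S. t \<in> convex_cone hull (S - {t})")
      case True
      then obtain t where t: "t \<in> S" "t \<in> convex_cone hull (S - {t})" by blast
      then have "convex_cone hull (S - {t}) = convex_cone hull S"
        using hull_redundant[of t convex_cone "S - {t}"] by (simp add: insert_absorb)
      then show ?thesis using psubset.IH[of "S - {t}"] t(1) by blast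
    qed blast
  qed
  then show ?thesis using that by blast
qed

text \<open>Every extreme ray R contains a nonzero generator: otherwise all generators lie in the
  complement of R in C together with 0, which is a convex cone because R is a face. A ray is
  determined by any nonzero vector on it, so the choice of generators is injective.\<close>

lemma card_extreme_rays_le:
  fixes T :: "'a::real_vector set"
  assumes "finite T"
  shows "card (extreme_rays (convex_cone hull T)) \<le> card T"
proof -
  define C where "C = convex_cone hull T"
  have C: "0 \<in> C" "\<And>x y. x \<in> C \<Longrightarrow> y \<in> C \<Longrightarrow> x + y \<in> C" "\<And>x c. x \<in> C \<Longrightarrow> 0 \<le> c \<Longrightarrow> c *\<^sub>R x \<in> C"
    by (simp_all add: C_def convex_cone_hull_contains_0 convex_cone_hull_add convex_cone_hull_mul)
  have gen: "\<exists>t\<in>T. R = {x *\<^sub>R t | x. 0 \<le> x}" if "R \<in> extreme_rays C" for R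
  proof -
    obtain r where face: "R face_of C" and r: "r \<noteq> 0" "R = {x *\<^sub>R r | x. 0 \<le> x}"
      using \<open>R \<in> extreme_rays C\<close> by (auto simp: extreme_rays_def)
    have scale: "c *\<^sub>R x \<in> R" if "x \<in> R" "0 \<le> c" for x c
    proof -
      obtain y where "x = y *\<^sub>R r" "0 \<le> y" using \<open>x \<in> R\<close> unfolding r(2) by blast
      then have "c *\<^sub>R x = (c * y) *\<^sub>R r" "0 \<le> c * y" using \<open>0 \<le> c\<close> by simp_all
      then show ?thesis unfolding r(2) by blast
    qed
    have "r = 1 *\<^sub>R r" by simp
    then have "r \<in> R" unfolding r(2) using zero_le_one by blast
    have "\<exists>t\<in>T. t \<in> R \<and> t \<noteq> 0"
    proof (rule ccontr)
      assume n: "\<not> (\<exists>t\<in>T. t \<in> R \<and> t \<noteq> 0)"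
      have "convex_cone (insert 0 (C - R))"
        unfolding convex_cone_iff
      proof (intro conjI ballI allI impI)
        have sum: "x + y \<notin> R" if x: "x \<in> C" "x \<notin> R" and y: "y \<in> C" "y \<notin> R" for x y
        proof
          assume xy: "x + y \<in> R"
          have "2 *\<^sub>R x \<in> R"
          proof (cases "x = y")
            case True
            then show ?thesis using xy by (simp add: scaleR_2)
          next
            case False
            \<comment> \<open>x + y is the midpoint of 2 x and 2 y, so the face property puts 2 x
              into R.\<close>
            have "midpoint (2 *\<^sub>R x) (2 *\<^sub>R y) = x + y" by (simp add: midpoint_def scaleR_add_right[symmetric])
            moreover have "midpoint (2 *\<^sub>R x) (2 *\<^sub>R y) \<in> open_segment (2 *\<^sub>R x) (2 *\<^sub>R y)"
              using False by simp
            ultimately show ?thesis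
              using face xy C(3)[OF x(1), of 2] C(3)[OF y(1), of 2] by (simp add: face_of_def) blast
          qed
          then have "(1 / 2) *\<^sub>R (2 *\<^sub>R x) \<in> R" by (rule scale) simp
          then show False using x(2) by simp
        qed
        show "x + y \<in> insert 0 (C - R)" if "x \<in> insert 0 (C - R)" "y \<in> insert 0 (C - R)" for x y
          using that sum C(2) by auto
        show "c *\<^sub>R x \<in> insert 0 (C - R)" if x: "x \<in> insert 0 (C - R)" and "0 \<le> c" for x c
        proof (cases "c = 0 \<or> x = 0")
          case False
          have "c *\<^sub>R x \<notin> R"
          proof
            assume "c *\<^sub>R x \<in> R"
            then have "(1 / c) *\<^sub>R (c *\<^sub>R x) \<in> R" by (rule scale) (use \<open>0 \<le> c\<close> in simp)
            then show False using False x by simp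
          qed
          then show ?thesis using False x C(3) \<open>0 \<le> c\<close> by auto
        qed auto
      qed simp
      moreover have "T \<subseteq> insert 0 (C - R)" using n hull_subset[of T convex_cone] by (auto simp: C_def)
      ultimately have "C \<subseteq> insert 0 (C - R)" unfolding C_def by (rule hull_minimal[rotated])
      then show False using \<open>r \<in> R\<close> r(1) face_of_imp_subset[OF face] by auto
    qed
    then obtain t x where t: "t \<in> T" "t = x *\<^sub>R r" "0 \<le> x" "t \<noteq> 0" unfolding r(2) by blast
    then have "x > 0" by (cases "x = 0") auto
    have "R = {y *\<^sub>R t | y. 0 \<le> y}"
    proof (intro equalityI subsetI)
      fix w assume "w \<in> R"
      then obtain y where "w = y *\<^sub>R r" "0 \<le> y" by (auto simp: r(2))
      then have "w = (y / x) *\<^sub>R t" "0 \<le> y / x" using \<open>x > 0\<close> t(2) by auto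
      then show "w \<in> {y *\<^sub>R t | y. 0 \<le> y}" by blast
    next
      fix w assume "w \<in> {y *\<^sub>R t | y. 0 \<le> y}"
      then obtain y where "w = (y * x) *\<^sub>R r" "0 \<le> y * x" using t by auto
      then show "w \<in> R" unfolding r(2) by blast
    qed
    then show ?thesis using t(1) by blast
  qed
  then have "\<exists>f. \<forall>R\<in>extreme_rays C. f R \<in> T \<and> R = {x *\<^sub>R f R | x. 0 \<le> x}" by (intro bchoice) blast
  then obtain f where f: "\<And>R. R \<in> extreme_rays C \<Longrightarrow> f R \<in> T" "\<And>R. R \<in> extreme_rays C \<Longrightarrow> R = {x *\<^sub>R f R | x. 0 \<le> x}"
    by blast
  have "inj_on f (extreme_rays C)"
  proof (rule inj_onI)
    fix R R' assume R: "R \<in> extreme_rays C" "R' \<in> extreme_rays C" "f R = f R'"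
    then show "R = R'" using f(2)[OF R(1)] f(2)[OF R(2)] by simp
  qed
  then show ?thesis using card_inj_on_le[of f] f(1) assms unfolding C_def[symmetric] by blast
qed

lemma pointed_cone_minus_zero_convex:
  assumes "convex_cone C" "C \<inter> uminus ` C = {0}"
  shows "convex (C - {0})"
proof (rule convexI)
  fix x y and a b :: real
  assume xy: "x \<in> C - {0}" "y \<in> C - {0}" and ab: "0 \<le> a" "0 \<le> b" "a + b = 1"
  have C: "\<And>x y. x \<in> C \<Longrightarrow> y \<in> C \<Longrightarrow> x + y \<in> C" "\<And>x c. x \<in> C \<Longrightarrow> 0 \<le> c \<Longrightarrow> c *\<^sub>R x \<in> C"
    using assms(1) by (auto simp: convex_cone_iff)
  have c: "a *\<^sub>R x \<in> C" "b *\<^sub>R y \<in> C" using xy ab by (auto intro: C(2))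
  have "a *\<^sub>R x + b *\<^sub>R y \<noteq> 0"
  proof
    assume "a *\<^sub>R x + b *\<^sub>R y = 0"
    then have eq: "a *\<^sub>R x = - (b *\<^sub>R y)" by (simp add: eq_neg_iff_add_eq_0)
    then have "a *\<^sub>R x \<in> C \<inter> uminus ` C" using c by auto
    then have "a *\<^sub>R x = 0" "b *\<^sub>R y = 0" using assms(2) eq by auto
    then show False using xy ab by auto
  qed
  then show "a *\<^sub>R x + b *\<^sub>R y \<in> C - {0}" using c C(1) by blast
qed

text \<open>Separate the compact hull of the other generators from the line through
  \<open>c\<close>. A point t c of the hull contradicts irredundancy if t > 0 and pointedness if t
  \<le> 0. A functional bounded below on a line through 0 vanishes on it.\<close>

lemma supporting_functional_irredundant:
  fixes T :: "'a::euclidean_space set"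
  assumes T: "finite T" "c \<in> T" "T \<noteq> {c}"
    and irr: "\<And>t. t \<in> T \<Longrightarrow> t \<notin> convex_cone hull (T - {t})"
    and pointed: "(convex_cone hull T) \<inter> uminus ` (convex_cone hull T) = {0}"
  obtains p where "inner p c = 0" "\<And>t. t \<in> T \<Longrightarrow> t \<noteq> c \<Longrightarrow> 0 < inner p t"
proof -
  let ?A = "convex hull (T - {c})" and ?L = "range (\<lambda>t. t *\<^sub>R c)"
  have T0: "0 \<notin> T" using irr[of 0] convex_cone_hull_contains_0[of "T - {0}"] by blast
  have sub: "T \<subseteq> convex_cone hull T" by (rule hull_subset)
  have L: "?L = span {c}" by (simp add: span_singleton)
  have "?A \<inter> ?L = {}"
  proof (rule ccontr)
    assume "?A \<inter> ?L \<noteq> {}"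
    then obtain t where t: "t *\<^sub>R c \<in> ?A" by auto
    show False
    proof (cases "t > 0")
      case True
      have "t *\<^sub>R c \<in> convex_cone hull (T - {c})" using t convex_hull_subset_convex_cone_hull by blast
      then have "(1 / t) *\<^sub>R (t *\<^sub>R c) \<in> convex_cone hull (T - {c})"
        by (rule convex_cone_hull_mul) (use True in simp)
      then show False using irr[OF T(2)] True by simp
    next
      case False
      have "?A \<subseteq> convex_cone hull T - {0}"
        using sub T0 by (intro hull_minimal pointed_cone_minus_zero_convex pointed convex_cone_convex_cone_hull) auto
      then have 1: "t *\<^sub>R c \<in> convex_cone hull T" "t *\<^sub>R c \<noteq> 0" using t by auto
      have "(- t) *\<^sub>R c \<in> convex_cone hull T" by (rule convex_cone_hull_mul) (use False T(2) sub in auto)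
      then have "t *\<^sub>R c \<in> uminus ` (convex_cone hull T)" by (intro image_eqI[of _ _ "(- t) *\<^sub>R c"]) simp_all
      then show False using 1 pointed by blast
    qed
  qed
  moreover have "compact ?A" using T(1) by (simp add: finite_imp_compact_convex_hull)
  moreover have "?A \<noteq> {}" using T by auto
  moreover have "convex ?L" "closed ?L" unfolding L by (simp_all add: closed_subspace subspace_imp_convex)
  ultimately obtain a b where ab: "\<And>x. x \<in> ?A \<Longrightarrow> inner a x < b" "\<And>x. x \<in> ?L \<Longrightarrow> b < inner a x"
    using separating_hyperplane_compact_closed[of ?A ?L] convex_convex_hull by blast
  have Lb: "b < t * inner a c" for t using ab(2)[OF rangeI[of "\<lambda>t. t *\<^sub>R c" t]] by simp
  have b: "b < 0" using Lb[of 0] by simp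
  have "inner a c = 0"
  proof (rule ccontr)
    assume "inner a c \<noteq> 0"
    then show False using Lb[of "b / inner a c"] by simp
  qed
  moreover have "inner a t < 0" if "t \<in> T" "t \<noteq> c" for t
    using ab(1)[of t] b hull_inc[of t "T - {c}" convex] that by force
  ultimately show ?thesis using that[of "- a"] by simp
qed

text \<open>A nonzero remainder would be a fourth pairwise orthogonal vector in a space of dimension
  three.\<close>

lemma orthogonal_triple_expansion:
  fixes p q r x :: "'a::euclidean_space"
  assumes dim: "DIM('a) = 3" and nz: "p \<noteq> 0" "q \<noteq> 0" "r \<noteq> 0"
    and orth: "inner p q = 0" "inner p r = 0" "inner q r = 0"
    and x: "inner q x = 0" "inner r x = 0"
  shows "x = (inner p x / inner p p) *\<^sub>R p"
proof (rule ccontr)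
  assume n: "\<not> ?thesis"
  define y where "y = x - (inner p x / inner p p) *\<^sub>R p"
  have y: "y \<noteq> 0" "inner p y = 0" "inner q y = 0" "inner r y = 0"
    using n nz orth x by (simp_all add: y_def inner_diff_right inner_commute[of q p] inner_commute[of r p])
  have d: "p \<noteq> q" "p \<noteq> r" "q \<noteq> r" "p \<noteq> y" "q \<noteq> y" "r \<noteq> y" using orth y nz by auto
  have "pairwise real_inner_class.orthogonal {p, q, r, y}"
    using orth y by (auto simp: pairwise_def real_inner_class.orthogonal_def inner_commute)
  then have "independent {p, q, r, y}" using nz y by (intro pairwise_orthogonal_independent) auto
  then have "card {p, q, r, y} \<le> DIM('a)" using independent_bound by blast
  then show False using d dim by simp
qed

text \<open>Modulo a generator c2 the space is a plane with coordinates p and q, and p is positive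
  on the other generators; \<tau> is their slope. The extreme slopes belong to the neighbours c1 and
  c3. Irredundancy enters three times: slopes are distinct, further generators have negative
  c2-coordinate, and the normalized pairs form an antichain.\<close>

lemma polyhedral_cone_normal_form:
  fixes C :: "'a::euclidean_space set"
  assumes dim: "DIM('a) = 3" and C: "proper_polyhedral_cone C" "5 \<le> card (extreme_rays C)"
  obtains \<psi>1 \<psi>2 \<psi>3 :: "'a dual" and c1 c2 c3 :: 'a and J :: "(real \<times> real) set"
  where "\<psi>1 c1 = 1" "\<psi>2 c1 = 0" "\<psi>3 c1 = 0" "\<psi>1 c2 = 0" "\<psi>2 c2 = 1" "\<psi>3 c2 = 0" "\<psi>1 c3 = 0" "\<psi>2 c3 = 0" "\<psi>3 c3 = 1"
    and "\<And>c. c = \<psi>1 c *\<^sub>R c1 + \<psi>2 c *\<^sub>R c2 + \<psi>3 c *\<^sub>R c3"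
    and "c1 \<in> C" "c2 \<in> C" "c3 \<in> C"
    and "finite J" "2 \<le> card J" "\<And>x z. (x, z) \<in> J \<Longrightarrow> 0 < x \<and> 0 < z \<and> x *\<^sub>R c1 - c2 + z *\<^sub>R c3 \<in> C"
    and "\<And>x z x' z'. (x, z) \<in> J \<Longrightarrow> (x', z') \<in> J \<Longrightarrow> x \<le> x' \<Longrightarrow> z \<le> z' \<Longrightarrow> (x, z) = (x', z')"
    and "C \<subseteq> convex_cone hull ({c1, c2, c3} \<union> (\<lambda>(x, z). x *\<^sub>R c1 - c2 + z *\<^sub>R c3) ` J)"
proof -
  obtain S where S: "finite S" "C = convex_cone hull S" and pointed: "C \<inter> uminus ` C = {0}"
    using C(1) by (auto simp: proper_polyhedral_cone_def)
  obtain T where T: "T \<subseteq> S" "convex_cone hull T = convex_cone hull S" and irr: "\<And>t. t \<in> T \<Longrightarrow> t \<notin> convex_cone hull (T - {t})"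
    using exists_irredundant_cone_generators[OF S(1)] by blast
  have fin: "finite T" using S(1) T(1) finite_subset by blast
  have CT: "C = convex_cone hull T" using S T by simp
  have card: "5 \<le> card T" using card_extreme_rays_le[OF fin] C(2) CT by simp
  have TC: "t \<in> C" if "t \<in> T" for t using that hull_inc CT by metis
  have comb: "a *\<^sub>R x + b *\<^sub>R y + c *\<^sub>R z \<in> convex_cone hull U"
    if "x \<in> convex_cone hull U" "y \<in> convex_cone hull U" "z \<in> convex_cone hull U" "0 \<le> a" "0 \<le> b" "0 \<le> c" for x y z :: 'a and U a b c
    using that by (intro convex_cone_hull_add convex_cone_hull_mul)
  have irr3: "t \<noteq> a *\<^sub>R x + b *\<^sub>R y + c *\<^sub>R z"
    if "t \<in> T" "x \<in> T - {t}" "y \<in> T - {t}" "z \<in> T - {t}" "0 \<le> a" "0 \<le> b" "0 \<le> c" for t x y z a b c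
    using irr[OF that(1)] comb[OF hull_inc[OF that(2)] hull_inc[OF that(3)] hull_inc[OF that(4)] that(5-7)] by metis
  have "T \<noteq> {}" using card by auto
  then obtain c2 where c2: "c2 \<in> T" by blast
  have "T \<noteq> {c2}" using card by auto
  obtain p where p: "inner p c2 = 0" "\<And>t. t \<in> T \<Longrightarrow> t \<noteq> c2 \<Longrightarrow> 0 < inner p t"
    using supporting_functional_irredundant[OF fin c2 \<open>T \<noteq> {c2}\<close> irr] pointed CT by blast
  have T0: "0 \<notin> T" using irr[of 0] convex_cone_hull_contains_0[of "T - {0}"] by blast
  have "c2 \<noteq> 0" using T0 c2 by auto
  have "p \<noteq> 0" using p(2) \<open>T \<noteq> {c2}\<close> c2 by force
  have "dim {c2, p} \<le> card {c2, p}" by (rule dim_le_card') simp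
  also have "\<dots> < DIM('a)" using dim card_insert_le_m1[of 2 "{p}" c2] by simp
  \<comment> \<open>c2, p, q are orthogonal, so p and q vanish jointly only on the line through
    c2.\<close>
  finally obtain q where q: "q \<noteq> 0" "span {c2, p} \<subseteq> {x. inner q x = 0}" using lowdim_subset_hyperplane by blast
  have qo: "inner q c2 = 0" "inner q p = 0" using q(2) span_base[of _ "{c2, p}"] by blast+
  have expand: "x = (inner c2 x / inner c2 c2) *\<^sub>R c2" if "inner p x = 0" "inner q x = 0" for x
    using orthogonal_triple_expansion[OF dim \<open>c2 \<noteq> 0\<close> \<open>p \<noteq> 0\<close> q(1) _ _ _ that] p(1) qo by (simp add: inner_commute)
  define \<tau> where "\<tau> t = inner q t / inner p t" for t
  have inj: "s = t" if s: "s \<in> T" "s \<noteq> c2" and t: "t \<in> T" "t \<noteq> c2" and le: "\<tau> s = \<tau> t" for s t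
  proof (rule ccontr)
    assume "s \<noteq> t"
    \<comment> \<open>Two generators of equal slope, scaled to p = 1, differ by a multiple of c2;
      its sign decides which of them is redundant.\<close>
    define k where "k = inner c2 ((1 / inner p s) *\<^sub>R s - (1 / inner p t) *\<^sub>R t) / inner c2 c2"
    have ps: "0 < inner p s" "0 < inner p t" using p(2) s t by auto
    have k: "(1 / inner p s) *\<^sub>R s - (1 / inner p t) *\<^sub>R t = k *\<^sub>R c2"
      unfolding k_def by (rule expand) (use ps le in \<open>simp_all add: inner_diff_right \<tau>_def\<close>)
    show False
    proof (cases "0 \<le> k")
      case True
      have "s = inner p s *\<^sub>R ((1 / inner p s) *\<^sub>R s)" using ps by simp
      also have "(1 / inner p s) *\<^sub>R s = (1 / inner p t) *\<^sub>R t + k *\<^sub>R c2" using k by (simp add: algebra_simps)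
      finally have "s = (inner p s / inner p t) *\<^sub>R t + (inner p s * k) *\<^sub>R c2 + 0 *\<^sub>R c2" by (simp add: scaleR_add_right)
      then show False using irr3[of s t c2 c2 "inner p s / inner p t" "inner p s * k" 0] s t c2 \<open>s \<noteq> t\<close> ps True by simp
    next
      case False
      have "t = inner p t *\<^sub>R ((1 / inner p t) *\<^sub>R t)" using ps by simp
      also have "(1 / inner p t) *\<^sub>R t = (1 / inner p s) *\<^sub>R s + (- k) *\<^sub>R c2" using k by (simp add: algebra_simps)
      finally have "t = (inner p t / inner p s) *\<^sub>R s + (inner p t * - k) *\<^sub>R c2 + 0 *\<^sub>R c2"
        by (simp only: scaleR_add_right) simp
      then show False using irr3[of t s c2 c2 "inner p t / inner p s" "inner p t * - k" 0] s t c2 \<open>s \<noteq> t\<close> ps False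
        by (simp add: mult_nonneg_nonpos)
    qed
  qed
  have T2: "finite (T - {c2})" "T - {c2} \<noteq> {}" using fin c2 \<open>T \<noteq> {c2}\<close> by auto
  obtain c1 where c1: "c1 \<in> T" "c1 \<noteq> c2" "\<And>t. t \<in> T \<Longrightarrow> t \<noteq> c2 \<Longrightarrow> \<tau> c1 \<le> \<tau> t"
    using ex_is_arg_min_if_finite[OF T2, of \<tau>] by (auto simp: is_arg_min_linorder)
  obtain c3 where c3: "c3 \<in> T" "c3 \<noteq> c2" "\<And>t. t \<in> T \<Longrightarrow> t \<noteq> c2 \<Longrightarrow> \<tau> t \<le> \<tau> c3"
    using ex_is_arg_min_if_finite[OF T2, of "\<lambda>t. - \<tau> t"] by (auto simp: is_arg_min_linorder)
  define T' where "T' = T - {c1, c2, c3}"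
  have card': "2 \<le> card T'"
  proof -
    have "card {c1, c2, c3} \<le> 3" by (simp add: card_insert_if)
    then show ?thesis using card diff_card_le_card_Diff[of "{c1, c2, c3}" T] by (simp add: T'_def)
  qed
  have strict: "\<tau> c1 < \<tau> t" "\<tau> t < \<tau> c3" if "t \<in> T'" for t
  proof -
    have t: "t \<in> T" "t \<noteq> c1" "t \<noteq> c2" "t \<noteq> c3" using that by (auto simp: T'_def)
    show "\<tau> c1 < \<tau> t" using c1(3)[OF t(1,3)] inj[OF c1(1,2) t(1,3)] t(2) by (cases "\<tau> c1 = \<tau> t") auto
    show "\<tau> t < \<tau> c3" using c3(3)[OF t(1,3)] inj[OF t(1,3) c3(1,2)] t(4) by (cases "\<tau> t = \<tau> c3") auto
  qed
  have lt: "\<tau> c1 < \<tau> c3"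
  proof -
    have "T' \<noteq> {}" using card' by auto
    then show ?thesis using strict by (metis ex_in_conv less_trans)
  qed
  have pc: "0 < inner p c1" "0 < inner p c3" using p(2) c1 c3 by auto
  \<comment> \<open>The determinant of c1 and c3 in the coordinates p, q. Cramer's rule gives p1 and
    p3, and p2 corrects the component along c2; together they represent the basis dual to c1, c2,
    c3.\<close>
  define D where "D = inner p c1 * inner q c3 - inner p c3 * inner q c1"
  have \<tau>q: "inner q t = \<tau> t * inner p t" if "t \<in> T" "t \<noteq> c2" for t using p(2)[OF that] by (simp add: \<tau>_def)
  have q13: "inner q c1 = \<tau> c1 * inner p c1" "inner q c3 = \<tau> c3 * inner p c3" using \<tau>q c1 c3 by auto
  have "D = inner p c1 * inner p c3 * (\<tau> c3 - \<tau> c1)" unfolding D_def q13 by (simp add: algebra_simps)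
  then have D: "0 < D" using pc lt by simp
  define p1 where "p1 = (1 / D) *\<^sub>R (inner q c3 *\<^sub>R p - inner p c3 *\<^sub>R q)"
  define p3 where "p3 = (1 / D) *\<^sub>R (inner p c1 *\<^sub>R q - inner q c1 *\<^sub>R p)"
  define p2 where "p2 = (1 / inner c2 c2) *\<^sub>R (c2 - inner c2 c1 *\<^sub>R p1 - inner c2 c3 *\<^sub>R p3)"
  have p1: "inner p1 x = (inner q c3 * inner p x - inner p c3 * inner q x) / D" for x
    by (simp add: p1_def inner_diff_left)
  have p3: "inner p3 x = (inner p c1 * inner q x - inner q c1 * inner p x) / D" for x
    by (simp add: p3_def inner_diff_left)
  have p2: "inner p2 x = (inner c2 x - inner c2 c1 * inner p1 x - inner c2 c3 * inner p3 x) / inner c2 c2" for x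
    by (simp add: p2_def inner_diff_left)
  have dual13: "inner p1 c1 = 1" "inner p1 c2 = 0" "inner p1 c3 = 0" "inner p3 c1 = 0" "inner p3 c2 = 0" "inner p3 c3 = 1"
    unfolding p1 p3 p(1) qo using D by (simp_all add: D_def mult.commute)
  have dual2: "inner p2 c1 = 0" "inner p2 c2 = 1" "inner p2 c3 = 0"
    unfolding p2 dual13 using \<open>c2 \<noteq> 0\<close> by simp_all
  have basis: "c = inner p1 c *\<^sub>R c1 + inner p2 c *\<^sub>R c2 + inner p3 c *\<^sub>R c3" for c
  proof -
    have pD: "inner p1 c * D = inner q c3 * inner p c - inner p c3 * inner q c"
      "inner p3 c * D = inner p c1 * inner q c - inner q c1 * inner p c"
      unfolding p1 p3 using D by simp_all
    define y where "y = c - inner p1 c *\<^sub>R c1 - inner p3 c *\<^sub>R c3"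
    have "inner p y * D = inner p c * D - (inner p1 c * D) * inner p c1 - (inner p3 c * D) * inner p c3"
      by (simp add: y_def inner_diff_right algebra_simps)
    also have "\<dots> = 0" unfolding pD by (simp add: D_def algebra_simps)
    finally have 1: "inner p y = 0" using D by simp
    have "inner q y * D = inner q c * D - (inner p1 c * D) * inner q c1 - (inner p3 c * D) * inner q c3"
      by (simp add: y_def inner_diff_right algebra_simps)
    also have "\<dots> = 0" unfolding pD by (simp add: D_def algebra_simps)
    finally have 2: "inner q y = 0" using D by simp
    have "inner c2 y / inner c2 c2 = inner p2 c"
      unfolding p2 by (simp add: y_def inner_diff_right mult.commute)
    then have "y = inner p2 c *\<^sub>R c2" using expand[OF 1 2] by simp
    then show ?thesis by (simp add: y_def algebra_simps)
  qed
  have pos13: "0 < inner p1 t" "0 < inner p3 t" if "t \<in> T'" for t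
  proof -
    have t: "t \<in> T" "t \<noteq> c2" using that by (auto simp: T'_def)
    have "inner p1 t = inner p c3 * inner p t * (\<tau> c3 - \<tau> t) / D" "inner p3 t = inner p c1 * inner p t * (\<tau> t - \<tau> c1) / D"
      unfolding p1 p3 q13 \<tau>q[OF t] by (simp_all add: algebra_simps)
    then show "0 < inner p1 t" "0 < inner p3 t" using D pc p(2)[OF t] strict[OF that] by simp_all
  qed
  \<comment> \<open>A nonnegative c2-coordinate would make t a nonnegative combination of c1, c2,
    c3.\<close>
  have neg2: "inner p2 t < 0" if "t \<in> T'" for t
  proof (rule ccontr)
    assume "\<not> inner p2 t < 0"
    then show False
      using irr3[of t c1 c2 c3 "inner p1 t" "inner p2 t" "inner p3 t"] basis[of t] pos13[OF that] that c1 c2 c3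
      by (auto simp: T'_def)
  qed
  \<comment> \<open>The outer coordinates after scaling t to c2-coordinate -1.\<close>
  define g where "g t = (inner p1 t / - inner p2 t, inner p3 t / - inner p2 t)" for t
  define J where "J = g ` T'"
  have gt: "fst (g t) *\<^sub>R c1 - c2 + snd (g t) *\<^sub>R c3 = (1 / - inner p2 t) *\<^sub>R t" if "t \<in> T'" for t
  proof -
    have "(1 / - inner p2 t) *\<^sub>R t = (1 / - inner p2 t) *\<^sub>R (inner p1 t *\<^sub>R c1 + inner p2 t *\<^sub>R c2 + inner p3 t *\<^sub>R c3)"
      using basis[of t] by simp
    also have "\<dots> = fst (g t) *\<^sub>R c1 - c2 + snd (g t) *\<^sub>R c3"
      using neg2[OF that] by (simp add: g_def scaleR_add_right)
    finally show ?thesis by simp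
  qed
  \<comment> \<open>If the pair of \<open>s\<close> lies below that of \<open>t\<close>, the scaled
    \<open>t\<close> exceeds the scaled \<open>s\<close> by a nonnegative combination of c1 and c3,
    so \<open>t\<close> is redundant.\<close>
  have anti: "s = t" if s: "s \<in> T'" and t: "t \<in> T'" and le: "fst (g s) \<le> fst (g t)" "snd (g s) \<le> snd (g t)" for s t
  proof (rule ccontr)
    assume "s \<noteq> t"
    define k where "k = - inner p2 t"
    have k: "0 < k" "0 < - inner p2 s" using neg2[OF t] neg2[OF s] by (simp_all add: k_def)
    have "t = k *\<^sub>R ((1 / - inner p2 t) *\<^sub>R t)" using k by (simp add: k_def)
    also have "(1 / - inner p2 t) *\<^sub>R t
        = (fst (g t) - fst (g s)) *\<^sub>R c1 + (1 / - inner p2 s) *\<^sub>R s + (snd (g t) - snd (g s)) *\<^sub>R c3"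
      unfolding gt[OF s, symmetric] gt[OF t, symmetric] by (simp add: algebra_simps)
    finally have "t = (k * (fst (g t) - fst (g s))) *\<^sub>R c1 + (k * (1 / - inner p2 s)) *\<^sub>R s + (k * (snd (g t) - snd (g s))) *\<^sub>R c3"
      by (simp only: scaleR_add_right scaleR_scaleR)
    moreover have "0 \<le> k * (fst (g t) - fst (g s))" "0 \<le> k * (1 / - inner p2 s)" "0 \<le> k * (snd (g t) - snd (g s))"
      using k le by (simp_all add: divide_nonneg_neg less_imp_le)
    moreover have "t \<in> T" "c1 \<in> T - {t}" "s \<in> T - {t}" "c3 \<in> T - {t}"
      using s t c1(1) c3(1) \<open>s \<noteq> t\<close> by (auto simp: T'_def)
    ultimately show False using irr3 by blast
  qed
  have app: "blinfun_apply (blinfun_inner_right w) x = inner w x" for w x :: 'a by simp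
  show ?thesis
  proof (rule that[of "blinfun_inner_right p1" c1 "blinfun_inner_right p2" "blinfun_inner_right p3" c2 c3 J], unfold app)
    show "c = inner p1 c *\<^sub>R c1 + inner p2 c *\<^sub>R c2 + inner p3 c *\<^sub>R c3" for c by (rule basis)
    show "finite J" using fin by (simp add: J_def T'_def)
    have "inj_on g T'" using anti by (auto intro!: inj_onI)
    then show "2 \<le> card J" using card' by (simp add: J_def card_image)
    show "0 < x \<and> 0 < z \<and> x *\<^sub>R c1 - c2 + z *\<^sub>R c3 \<in> C" if xz: "(x, z) \<in> J" for x z
    proof -
      obtain t where t: "t \<in> T'" "g t = (x, z)" using xz by (auto simp: J_def)
      have "0 < fst (g t)" "0 < snd (g t)"
        using pos13[OF t(1)] neg2[OF t(1)] unfolding g_def fst_conv snd_conv by (intro divide_pos_pos; simp)+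
      moreover have "(1 / - inner p2 t) *\<^sub>R t \<in> C"
        unfolding CT by (rule convex_cone_hull_mul) (use neg2[OF t(1)] t(1) in \<open>simp_all add: hull_inc T'_def\<close>)
      ultimately show ?thesis using gt[OF t(1)] t(2) by simp
    qed
    show "(x, z) = (x', z')" if xz: "(x, z) \<in> J" "(x', z') \<in> J" "x \<le> x'" "z \<le> z'" for x z x' z'
    proof -
      obtain s t where st: "s \<in> T'" "g s = (x, z)" "t \<in> T'" "g t = (x', z')" using xz by (auto simp: J_def)
      then have "s = t" using anti[of s t] xz(3,4) by simp
      then show ?thesis using st by simp
    qed
    show "C \<subseteq> convex_cone hull ({c1, c2, c3} \<union> (\<lambda>(x, z). x *\<^sub>R c1 - c2 + z *\<^sub>R c3) ` J)" (is "C \<subseteq> ?H")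
      unfolding CT
    proof (intro hull_minimal convex_cone_convex_cone_hull subsetI)
      fix t assume t: "t \<in> T"
      show "t \<in> ?H"
      proof (cases "t \<in> T'")
        case False
        then show ?thesis using t by (intro hull_inc) (auto simp: T'_def)
      next
        case True
        have "(1 / - inner p2 t) *\<^sub>R t \<in> ?H"
          unfolding gt[OF True, symmetric]
          by (rule hull_inc, rule UnI2) (use True in \<open>auto simp: J_def split_beta intro!: image_eqI\<close>)
        then have "(- inner p2 t) *\<^sub>R ((1 / - inner p2 t) *\<^sub>R t) \<in> ?H"
          by (rule convex_cone_hull_mul) (use neg2[OF True] in simp)
        then show ?thesis using neg2[OF True] by simp
      qed
    qed
  qed (use dual13 dual2 TC c1(1) c2 c3(1) in simp_all)
qed

theorem theorem3p1:
  fixes C :: "'a::euclidean_space set" and u :: 'a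
  assumes "DIM('a) = 3"
    and "proper_polyhedral_cone C"
    and "5 \<le> card (extreme_rays C)"
    and "u \<in> interior C"
  shows "(\<forall>m\<ge>1. \<exists>X \<in> free_polyhedron C u (2 * m).
             irreducible_point (2 * m) X \<and> arveson_boundary_point C u (2 * m) X)
       \<and> \<not> (\<exists>d\<ge>1. \<forall>s\<ge>1. free_polyhedron C u s = mconv d (free_polyhedron C u d) s)
       \<and> \<not> Cmin_subhomogeneous_over TYPE('b::comm_cstar_algebra) C u"
proof -
  have point: "\<exists>X\<in>free_polyhedron C u (2 * m). rigid C u (2 * m) X \<and> generating (2 * m) (range (eval_at X))"
    if "1 \<le> m" for m
    unfolding mult_2
    by (rule polyhedral_cone_normal_form[OF assms(1-3)], rule pencil_point[OF that]) (assumption | rule assms(4) | blast)+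
  have "\<exists>X \<in> free_polyhedron C u (2 * m). irreducible_point (2 * m) X \<and> arveson_boundary_point C u (2 * m) X"
    if m: "1 \<le> m" for m
  proof -
    obtain X where X: "X \<in> free_polyhedron C u (2 * m)" "rigid C u (2 * m) X" "generating (2 * m) (range (eval_at X))"
      using point[OF m] by blast
    have "irreducible_point (2 * m) X"
      by (rule generating_imp_irreducible_point[OF free_polyhedron_carrier[OF X(1)] _ X(3)]) (use m in simp)
    then show ?thesis using X rigid_imp_arveson_boundary_point[OF X(1,2)] by blast
  qed
  moreover have "\<not> (\<exists>d\<ge>1. \<forall>s\<ge>1. free_polyhedron C u s = mconv d (free_polyhedron C u d) s)"
  proof
    assume "\<exists>d\<ge>1. \<forall>s\<ge>1. free_polyhedron C u s = mconv d (free_polyhedron C u d) s"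
    then obtain d where d: "\<And>s. 1 \<le> s \<Longrightarrow> free_polyhedron C u s = mconv d (free_polyhedron C u d) s" by blast
    \<comment> \<open>m = d * d + 2 makes the size 2 m larger than the bound d * d + 1.\<close>
    obtain X where X: "X \<in> free_polyhedron C u (2 * (d * d + 2))" "rigid C u (2 * (d * d + 2)) X"
      "generating (2 * (d * d + 2)) (range (eval_at X))"
      using point[of "d * d + 2"] by auto
    have "X \<notin> mconv d (free_polyhedron C u d) (2 * (d * d + 2))" by (rule not_in_mconv[OF X]) simp
    then show False using X(1) d[of "2 * (d * d + 2)"] by simp
  qed
  moreover have "\<not> Cmin_subhomogeneous_over TYPE('b) C u"
  proof
    assume "Cmin_subhomogeneous_over TYPE('b) C u"
    then obtain d and \<Phi> :: "'a \<Rightarrow> 'b mat" where d: "1 \<le> d" "unital_complete_order_embedding C u d \<Phi>"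
      by (auto simp: Cmin_subhomogeneous_over_def)
    obtain X where X: "X \<in> free_polyhedron C u (2 * (d * d + 2))" "rigid C u (2 * (d * d + 2)) X"
      "generating (2 * (d * d + 2)) (range (eval_at X))"
      using point[of "d * d + 2"] by auto
    have "2 * (d * d + 2) \<le> d * d + 1" by (rule embedding_level_bound[OF d(1) _ d(2) X]) simp
    then show False by simp
  qed
  ultimately show ?thesis by blast
qed

end
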